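(* Let $\mathcal{O}$ be a maximal $\mathbb{Z}$-order in $\mathcal{A}$, where $\mathcal{A}$ is an imaginary quadratic number field (with $\mathbb{K}=\mathbb{C}$, $r=2$) or a totally definite quaternion $\mathbb{Q}$-algebra (with $\mathbb{K}=\mathbb{H}$, $r=4$). For each integer $m\geq 3$, $$\gamma(\mathcal{O}, rm)\leq \gamma(\mathcal{O},r(m-1))^{\frac{m-1}{m-2}}\,D_{\mathcal{O}}^{\frac{1}{r(m-2)}}.$$ Equality holds if and only if for every optimal $rm$-dimensional $\mathcal{O}$-lattice $\Lambda$ the $\mathcal{O}$-dual lattice $\Lambda^\#$ is also optimal and, for all minimal vectors $x\in\Lambda^\#$, the relative $\mathcal{O}$-lattices $\Lambda\cap(\mathbb{K}x)^\perp$ and $\Lambda^\#\cap\mathbb{K}x$ satisfy: (1) $\mathrm{N}(\Lambda\cap(\mathbb{K}x)^\perp)=\mathrm{N}(\Lambda)$; (2) $\Lambda^\#\cap\mathbb{K}x=\mathcal{O}x$; (3) $\gamma(\Lambda\cap(\mathbb{K}x)^\perp)=\gamma(\mathcal{O},r(m-1))$.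
   Context: $\mathbb{K}$ is either $\mathbb{C}$ or Hamilton's quaternions $\mathbb{H}$; $r=\dim_{\mathbb{R}}\mathbb{K}\in\{2,4\}$; $x\mapsto\overline{x}$ is complex, respectively quaternionic, conjugation. $\mathcal{A}$ is an imaginary quadratic field if $\mathbb{K}=\mathbb{C}$, and a totally definite quaternion $\mathbb{Q}$-algebra if $\mathbb{K}=\mathbb{H}$; $\mathbb{K}$ is identified with $\mathbb{R}\otimes_{\mathbb{Q}}\mathcal{A}$, so $\mathcal{A}\subset\mathbb{K}$. $\mathcal{O}\subset\mathbb{K}$ is a maximal $\mathbb{Z}$-order of $\mathcal{A}$ (a subring that is a free $\mathbb{Z}$-module of rank $r$ with $\mathbb{Q}\mathcal{O}=\mathcal{A}$, maximal among such). For a $\mathbb{Z}$-basis $\alpha_1,\dots,\alpha_r$ of $\mathcal{O}$ put $D_{\mathcal{O}}=\det\left(\left(\frac12(\alpha_i\overline{\alpha_j}+\alpha_j\overline{\alpha_i})\right)_{1\le i,j\le r}\right)$; it is independent of the basis. $E_{rm}$ is a left $\mathbb{K}$-vector space of dimension $m$ with a positive definite Hermitian product $h:E_{rm}\times E_{rm}\to\mathbb{K}$ (left linear in the first variable, right conjugate-linear in the second, $h(y,x)=\overline{h(x,y)}$). It is a Euclidean space of real dimension $rm$ with inner product $\langle x,y\rangle=\frac12(h(x,y)+\overline{h(x,y)})$; the norm of a vector is $\mathrm{N}(x)=h(x,x)=\langle x,x\rangle$. The orthogonal complement $F^\perp$ of a $\mathbb{K}$-subspace $F$ is the same for $h$ and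 $\langle\cdot,\cdot\rangle$. A $\mathbb{K}$-subspace carries the restricted Hermitian product. An $rm$-dimensional $\mathcal{O}$-lattice (an $\mathcal{O}$-lattice in $E_{rm}$) is a full-rank lattice $\Lambda\subset E_{rm}$ that is a left $\mathcal{O}$-submodule. Its $\mathcal{O}$-dual is $\Lambda^\#=\{x\in E_{rm}: h(x,\Lambda)\subseteq\mathcal{O}\}$. A relative $\mathcal{O}$-lattice in a $\mathbb{K}$-subspace $F$ is a left $\mathcal{O}$-invariant lattice in some $\mathbb{K}$-subspace of $F$ (possibly not full-dimensional in $F$). For a lattice $\Lambda$ of rank $n$, $\mathrm{N}(\Lambda)$ is the minimum of $\mathrm{N}(x)$ over nonzero $x\in\Lambda$, the minimal vectors of $\Lambda$ are the nonzero vectors attaining it, $\det(\Lambda)$ is the determinant of a Gram matrix of a $\mathbb{Z}$-basis with respect to $\langle\cdot,\cdot\rangle$, and the Hermite invariant is $\gamma(\Lambda)=\mathrm{N}(\Lambda)/\det(\Lambda)^{1/n}$. The $\mathcal{O}$-Hermite constant $\gamma(\mathcal{O},rm)$ is the supremum of $\gamma(\Lambda)$ over all $rm$-dimensional $\mathcal{O}$-lattices $\Lambda$; an $rm$-dimensional $\mathcal{O}$-lattice $\Lambda$ is optimal if $\gamma(\Lambda)=\gamma(\mathcal{O},rm)$. *)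

theory Defs
  imports "HOL-Analysis.Analysis" "Jordan_Normal_Form.Determinant"
begin

no_notation Matrix.scalar_prod (infix "\<bullet>" 70)

section \<open>Hamilton's quaternions\<close>

datatype quat = Quat (qRe: real) (qI: real) (qJ: real) (qK: real)

lemma quat_eq_iff: "x = y \<longleftrightarrow> qRe x = qRe y \<and> qI x = qI y \<and> qJ x = qJ y \<and> qK x = qK y"
  by (cases x; cases y) auto

instantiation quat :: real_vector
begin

definition "0 = Quat 0 0 0 0"
definition "x + y = Quat (qRe x + qRe y) (qI x + qI y) (qJ x + qJ y) (qK x + qK y)"
definition "- x = Quat (- qRe x) (- qI x) (- qJ x) (- qK x)"
definition "x - y = Quat (qRe x - qRe y) (qI x - qI y) (qJ x - qJ y) (qK x - qK y)"
definition "c *\<^sub>R x = Quat (c * qRe x) (c * qI x) (c * qJ x) (c * qK x)"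

instance
  by standard
    (simp_all add: quat_eq_iff zero_quat_def plus_quat_def uminus_quat_def minus_quat_def
      scaleR_quat_def algebra_simps)

end

lemma quat_sel_simps [simp]:
  "qRe 0 = 0" "qI 0 = 0" "qJ 0 = 0" "qK 0 = 0"
  "qRe (x + y) = qRe x + qRe y" "qI (x + y) = qI x + qI y"
  "qJ (x + y) = qJ x + qJ y" "qK (x + y) = qK x + qK y"
  "qRe (- x) = - qRe x" "qI (- x) = - qI x" "qJ (- x) = - qJ x" "qK (- x) = - qK x"
  "qRe (x - y) = qRe x - qRe y" "qI (x - y) = qI x - qI y"
  "qJ (x - y) = qJ x - qJ y" "qK (x - y) = qK x - qK y"
  "qRe (c *\<^sub>R x) = c * qRe x" "qI (c *\<^sub>R x) = c * qI x"
  "qJ (c *\<^sub>R x) = c * qJ x" "qK (c *\<^sub>R x) = c * qK x"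
  by (simp_all add: zero_quat_def plus_quat_def uminus_quat_def minus_quat_def scaleR_quat_def)

instantiation quat :: real_inner
begin

definition inner_quat :: "quat \<Rightarrow> quat \<Rightarrow> real" where
  "inner_quat x y = qRe x * qRe y + qI x * qI y + qJ x * qJ y + qK x * qK y"
definition norm_quat :: "quat \<Rightarrow> real" where "norm_quat x = sqrt (inner x x)"
definition sgn_quat :: "quat \<Rightarrow> quat" where "sgn_quat x = x /\<^sub>R norm x"
definition dist_quat :: "quat \<Rightarrow> quat \<Rightarrow> real" where "dist_quat x y = norm (x - y)"
definition uniformity_quat :: "(quat \<times> quat) filter" where
  "uniformity_quat = (INF e\<in>{0<..}. principal {(x, y). dist x y < e})"
definition open_quat :: "quat set \<Rightarrow> bool" where
  "open_quat U \<longleftrightarrow> (\<forall>x\<in>U. eventually (\<lambda>(x', y). x' = x \<longrightarrow> y \<in> U) uniformity)"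

instance
proof
  fix x y z :: quat and c :: real
  show "0 \<le> inner x x" by (simp add: inner_quat_def)
  show "inner x x = 0 \<longleftrightarrow> x = 0"
  proof
    assume "inner x x = 0"
    then have "qRe x ^ 2 + qI x ^ 2 + qJ x ^ 2 + qK x ^ 2 = 0"
      by (simp add: inner_quat_def power2_eq_square)
    then show "x = 0"
      by (simp add: quat_eq_iff add_nonneg_eq_0_iff)
  qed (simp add: inner_quat_def)
qed (simp_all add: inner_quat_def norm_quat_def sgn_quat_def dist_quat_def uniformity_quat_def
      open_quat_def algebra_simps)

end

instantiation quat :: real_normed_div_algebra
begin

definition one_quat :: quat where "one_quat = Quat 1 0 0 0"
definition times_quat :: "quat \<Rightarrow> quat \<Rightarrow> quat" where
  "times_quat x y = Quat
     (qRe x * qRe y - qI x * qI y - qJ x * qJ y - qK x * qK y)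
     (qRe x * qI y + qI x * qRe y + qJ x * qK y - qK x * qJ y)
     (qRe x * qJ y - qI x * qK y + qJ x * qRe y + qK x * qI y)
     (qRe x * qK y + qI x * qJ y - qJ x * qI y + qK x * qRe y)"
definition inverse_quat :: "quat \<Rightarrow> quat" where
  "inverse_quat x = Quat (qRe x) (- qI x) (- qJ x) (- qK x) /\<^sub>R inner x x"
definition divide_quat :: "quat \<Rightarrow> quat \<Rightarrow> quat" where
  "divide_quat x y = x * inverse y"

instance
proof
  fix x y z :: quat and c :: real
  show "x * y * z = x * (y * z)" "(x + y) * z = x * z + y * z" "x * (y + z) = x * y + x * z"
    "1 * x = x" "x * 1 = x" "c *\<^sub>R x * y = c *\<^sub>R (x * y)" "x * c *\<^sub>R y = c *\<^sub>R (x * y)"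
    by (simp_all add: quat_eq_iff times_quat_def one_quat_def algebra_simps)
  show "(0::quat) \<noteq> 1"
    by (simp add: quat_eq_iff one_quat_def)
  show "inverse (0::quat) = 0"
    by (simp add: quat_eq_iff inverse_quat_def)
  show "x div y = x * inverse y"
    by (simp add: divide_quat_def)
  show "inverse x * x = 1" "x * inverse x = 1" if "x \<noteq> 0"
  proof -
    have n: "inner x x \<noteq> 0" using that by simp
    have e: "x * Quat (qRe x) (- qI x) (- qJ x) (- qK x) = inner x x *\<^sub>R 1"
      "Quat (qRe x) (- qI x) (- qJ x) (- qK x) * x = inner x x *\<^sub>R 1"
      by (simp_all add: quat_eq_iff times_quat_def one_quat_def inner_quat_def)
    have sc: "a *\<^sub>R u * v = a *\<^sub>R (u * v)" "u * a *\<^sub>R v = a *\<^sub>R (u * v)"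
      for a :: real and u v :: quat
      by (simp_all add: quat_eq_iff times_quat_def algebra_simps)
    show "inverse x * x = 1" "x * inverse x = 1"
      using n by (simp_all add: inverse_quat_def sc e)
  qed
  have "inner (x * y) (x * y) = inner x x * inner y y"
    by (simp add: inner_quat_def times_quat_def algebra_simps)
  then show "norm (x * y) = norm x * norm y"
    by (simp add: norm_quat_def real_sqrt_mult)
qed

end

instantiation quat :: euclidean_space
begin

definition Basis_quat :: "quat set" where
  "Basis_quat = {Quat 1 0 0 0, Quat 0 1 0 0, Quat 0 0 1 0, Quat 0 0 0 1}"

instance
proof
  fix u v x :: quat
  show "u \<in> Basis \<Longrightarrow> v \<in> Basis \<Longrightarrow> u \<bullet> v = (if u = v then 1 else 0)"
    unfolding Basis_quat_def insert_iff empty_iff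
    by (elim disjE; simp only: inner_quat_def quat.sel quat.inject; simp)
  show "(\<forall>u\<in>Basis. x \<bullet> u = 0) \<longleftrightarrow> x = 0"
    unfolding Basis_quat_def ball_simps inner_quat_def quat.sel quat_eq_iff by simp
qed (unfold Basis_quat_def, blast, blast)

end

lemma DIM_quat: "DIM(quat) = 4"
  unfolding Basis_quat_def by (simp add: card_insert_if)


section \<open>Conjugation on $\mathbb{C}$ and $\mathbb{H}$\<close>

text \<open>The class only serves to state the definitions below once for both \<^typ>\<open>complex\<close> and
  \<^typ>\<open>quat\<close>.\<close>

class conj_div_algebra = real_normed_div_algebra + euclidean_space +
  fixes kcnj :: "'a \<Rightarrow> 'a"
  assumes kcnj_add: "kcnj (x + y) = kcnj x + kcnj y"
    and kcnj_mult: "kcnj (x * y) = kcnj y * kcnj x"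
    and kcnj_kcnj: "kcnj (kcnj x) = x"
    and kcnj_scaleR_1: "kcnj (t *\<^sub>R 1) = t *\<^sub>R 1"
    and inner_scaleR_1: "(x \<bullet> y) *\<^sub>R 1 = (1/2) *\<^sub>R (x * kcnj y + y * kcnj x)"

lemma of_real_inner:
  "of_real (x \<bullet> y) = (1/2) *\<^sub>R (x * kcnj y + y * kcnj (x::'a::conj_div_algebra))"
  unfolding of_real_def by (rule inner_scaleR_1)

instantiation complex :: conj_div_algebra
begin

definition kcnj_complex :: "complex \<Rightarrow> complex" where "kcnj_complex = cnj"

instance
proof
  fix x y :: complex and t :: real
  show "(x \<bullet> y) *\<^sub>R 1 = (1/2) *\<^sub>R (x * kcnj y + y * kcnj x)"
    by (rule complex_eqI) (simp_all add: kcnj_complex_def inner_complex_def)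
qed (simp_all add: kcnj_complex_def)

end

instantiation quat :: conj_div_algebra
begin

definition kcnj_quat :: "quat \<Rightarrow> quat" where
  "kcnj_quat x = Quat (qRe x) (- qI x) (- qJ x) (- qK x)"

instance
  by standard
    (simp_all add: kcnj_quat_def quat_eq_iff times_quat_def one_quat_def inner_quat_def)

end


section \<open>Integral bases\<close>

global_interpretation int_module: Modules.module "\<lambda>(k::int) (x::'v::real_vector). of_int k *\<^sub>R x"
  by standard (simp_all add: scaleR_add_right scaleR_add_left)

definition int_basis :: "'v::real_vector list \<Rightarrow> 'v set \<Rightarrow> bool" where
  "int_basis bs L \<longleftrightarrow> distinct bs \<and> int_module.independent (set bs) \<and> int_module.span (set bs) = L"


section \<open>Maximal orders\<close>

definition imaginary_quadratic_field :: "complex set \<Rightarrow> bool" where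
  "imaginary_quadratic_field A \<longleftrightarrow>
     (\<exists>d::nat. d > 0 \<and> A = {of_rat p + of_rat q * (\<i> * of_real (sqrt (real d))) | p q. True})"

text \<open>The quaternion algebra $(a,b)_{\mathbb{Q}}$ with basis $1, i, j, ij$. It is totally definite,
  that is $\mathbb{R}\otimes_{\mathbb{Q}}(a,b)_{\mathbb{Q}} \cong \mathbb{H}$, iff $a, b < 0$; the
  inclusion into \<^typ>\<open>quat\<close> then induces such an isomorphism.\<close>

definition totally_definite_quaternion_algebra :: "quat set \<Rightarrow> bool" where
  "totally_definite_quaternion_algebra A \<longleftrightarrow>
     (\<exists>a b :: rat. \<exists>i j. a < 0 \<and> b < 0 \<and> i * i = of_real (of_rat a) \<and> j * j = of_real (of_rat b) \<and>
        i * j = - (j * i) \<and>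
        A = {of_real (of_rat p) + of_rat q *\<^sub>R i + of_rat s *\<^sub>R j + of_rat t *\<^sub>R (i * j) | p q s t. True})"

definition is_order :: "'k::conj_div_algebra set \<Rightarrow> 'k set \<Rightarrow> bool" where
  "is_order A R \<longleftrightarrow>
     1 \<in> R \<and> (\<forall>x\<in>R. \<forall>y\<in>R. x - y \<in> R \<and> x * y \<in> R) \<and>
     (\<exists>bs. length bs = DIM('k) \<and> int_basis bs R) \<and>
     A = {of_rat q *\<^sub>R x | q x. x \<in> R}"

definition is_maximal_order :: "'k::conj_div_algebra set \<Rightarrow> 'k set \<Rightarrow> bool" where
  "is_maximal_order A R \<longleftrightarrow> is_order A R \<and> (\<forall>R'. is_order A R' \<and> R \<subseteq> R' \<longrightarrow> R' = R)"

text \<open>The matrix entries are real elements of $\mathbb{K}$ (see \<open>of_real_inner\<close>); taking the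
  inner product with 1 reads off the real number.\<close>

definition order_disc :: "'k::conj_div_algebra set \<Rightarrow> real" where
  "order_disc R = (THE d. \<exists>bs. int_basis bs R \<and>
     d = Determinant.det (mat (length bs) (length bs) (\<lambda>(i, j).
           ((1/2) *\<^sub>R (bs ! i * kcnj (bs ! j) + bs ! j * kcnj (bs ! i))) \<bullet> 1)))"


section \<open>Euclidean lattices\<close>

text \<open>A lattice need not span the ambient space; its rank is \<^term>\<open>dim L\<close>.\<close>

definition is_lattice :: "'v::euclidean_space set \<Rightarrow> bool" where
  "is_lattice L \<longleftrightarrow> (\<exists>B. independent B \<and> L = int_module.span B)"

definition lattice_det :: "'v::euclidean_space set \<Rightarrow> real" where
  "lattice_det L = (THE d. \<exists>bs. int_basis bs L \<and>
     d = Determinant.det (mat (length bs) (length bs) (\<lambda>(i, j). bs ! i \<bullet> bs ! j)))"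

text \<open>The infimum is attained for every nonzero lattice.\<close>

definition min_norm :: "'v::euclidean_space set \<Rightarrow> real" where
  "min_norm L = (INF x\<in>L - {0}. x \<bullet> x)"

definition minimal_vectors :: "'v::euclidean_space set \<Rightarrow> 'v set" where
  "minimal_vectors L = {x \<in> L - {0}. x \<bullet> x = min_norm L}"

definition hermite_invariant :: "'v::euclidean_space set \<Rightarrow> real" where
  "hermite_invariant L = min_norm L / lattice_det L powr (1 / real (dim L))"

lemma order_disc_eq_lattice_det: "order_disc R = lattice_det R"
proof -
  have "((1/2) *\<^sub>R (x * kcnj y + y * kcnj x)) \<bullet> 1 = x \<bullet> y" for x y :: 'a
    by (simp only: of_real_inner[symmetric])
      (simp add: of_real_def flip: power2_norm_eq_inner)
  then show ?thesis
    by (simp only: order_disc_def lattice_det_def)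
qed


section \<open>Hermitian spaces and $\mathcal{O}$-lattices\<close>

text \<open>A left $\mathbb{K}$-vector space with a positive definite Hermitian product, whose underlying
  Euclidean space is the type \<^typ>\<open>'v\<close>. Positive definiteness of \<open>h\<close> follows from that of the inner
  product, see \<open>h_self\<close> below. The dimension over $\mathbb{K}$ is $m$ iff
  \<open>DIM('v) = DIM('k) * m\<close>.\<close>

locale hermitian_space =
  fixes sc :: "'k::conj_div_algebra \<Rightarrow> 'v::euclidean_space \<Rightarrow> 'v"
    and h :: "'v \<Rightarrow> 'v \<Rightarrow> 'k"
  assumes scale_add_right: "sc a (x + y) = sc a x + sc a y"
    and scale_add_left: "sc (a + b) x = sc a x + sc b x"
    and scale_scale: "sc a (sc b x) = sc (a * b) x"
    and scale_of_real: "sc (of_real t) x = t *\<^sub>R x"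
    and h_add_left: "h (x + y) z = h x z + h y z"
    and h_scale_left: "h (sc a x) y = a * h x y"
    and h_sym: "h y x = kcnj (h x y)"
    and inner_h: "of_real (x \<bullet> y) = (1/2) *\<^sub>R (h x y + kcnj (h x y))"
begin

lemma h_self: "h x x = of_real (x \<bullet> x)"
  unfolding inner_h h_sym[of x x, symmetric] by (rule scaleR_half_double[symmetric])

end

lemma hermitian_space_vec:
  "hermitian_space ((*s) :: 'k::conj_div_algebra \<Rightarrow> 'k ^ 'n \<Rightarrow> 'k ^ 'n)
     (\<lambda>x y. \<Sum>i\<in>UNIV. vec_nth x i * kcnj (vec_nth y i))"
proof -
  have kcnj_0: "kcnj (0::'k) = 0"
    using kcnj_scaleR_1[of 0] by simp
  have kcnj_sum: "kcnj (sum f S) = (\<Sum>i\<in>S. kcnj (f i))" if "finite S" for f :: "'n \<Rightarrow> 'k" and S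
    using that by (induction S) (simp_all add: kcnj_0 kcnj_add)
  have sym: "(\<Sum>i\<in>UNIV. vec_nth y i * kcnj (vec_nth x i)) =
      kcnj (\<Sum>i\<in>UNIV. vec_nth x i * kcnj (vec_nth y i))" for x y :: "'k ^ 'n"
    by (simp add: kcnj_sum kcnj_mult kcnj_kcnj)
  have inn: "of_real (x \<bullet> y) = (1/2) *\<^sub>R ((\<Sum>i\<in>UNIV. vec_nth x i * kcnj (vec_nth y i)) +
      kcnj (\<Sum>i\<in>UNIV. vec_nth x i * kcnj (vec_nth y i)))" for x y :: "'k ^ 'n"
    unfolding sym[symmetric] inner_vec_def of_real_sum of_real_inner
    by (simp only: sum.distrib[symmetric] scaleR_sum_right)
  show ?thesis
  proof
    fix a b :: 'k and t :: real and x y z :: "'k ^ 'n"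
    show "a *s (x + y) = a *s x + a *s y" "(a + b) *s x = a *s x + b *s x"
      "a *s (b *s x) = (a * b) *s x" "of_real t *s x = t *\<^sub>R x"
      by (simp_all add: Finite_Cartesian_Product.vec_eq_iff distrib_left distrib_right mult.assoc of_real_def)
    show "(\<Sum>i\<in>UNIV. vec_nth (x + y) i * kcnj (vec_nth z i)) =
        (\<Sum>i\<in>UNIV. vec_nth x i * kcnj (vec_nth z i)) + (\<Sum>i\<in>UNIV. vec_nth y i * kcnj (vec_nth z i))"
      by (simp add: distrib_right sum.distrib)
    show "(\<Sum>i\<in>UNIV. vec_nth (a *s x) i * kcnj (vec_nth y i)) =
        a * (\<Sum>i\<in>UNIV. vec_nth x i * kcnj (vec_nth y i))"
      by (simp add: sum_distrib_left mult.assoc)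
  qed (rule sym inn)+
qed

text \<open>For a $\mathbb{K}$-subspace such as \<open>K_line sc x\<close>, the complement with respect to \<open>h\<close> is the
  Euclidean \<^const>\<open>orthogonal_comp\<close>.\<close>

definition K_line :: "('k \<Rightarrow> 'v \<Rightarrow> 'v) \<Rightarrow> 'v \<Rightarrow> 'v set" where
  "K_line sc x = {sc a x | a. True}"

definition is_O_lattice ::
  "'k::conj_div_algebra set \<Rightarrow> ('k \<Rightarrow> 'v::euclidean_space \<Rightarrow> 'v) \<Rightarrow> 'v set \<Rightarrow> bool" where
  "is_O_lattice R sc L \<longleftrightarrow>
     is_lattice L \<and> span L = UNIV \<and> (\<forall>a\<in>R. \<forall>x\<in>L. sc a x \<in> L)"

definition O_dual ::
  "'k::conj_div_algebra set \<Rightarrow> ('v \<Rightarrow> 'v \<Rightarrow> 'k) \<Rightarrow> 'v::euclidean_space set \<Rightarrow> 'v set" where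
  "O_dual R h L = {x. \<forall>y\<in>L. h x y \<in> R}"

definition hermite_constant ::
  "'k::conj_div_algebra set \<Rightarrow> ('k \<Rightarrow> 'v::euclidean_space \<Rightarrow> 'v) \<Rightarrow> real" where
  "hermite_constant R sc = (SUP L\<in>{L. is_O_lattice R sc L}. hermite_invariant L)"

definition optimal ::
  "'k::conj_div_algebra set \<Rightarrow> ('k \<Rightarrow> 'v::euclidean_space \<Rightarrow> 'v) \<Rightarrow> 'v set \<Rightarrow> bool" where
  "optimal R sc L \<longleftrightarrow>
     is_O_lattice R sc L \<and> hermite_invariant L = hermite_constant R sc"

end

(*
  Let x be a minimal vector of the dual lattice L# and F = Kx. Projecting L to F gives a rank one
  lattice, so det L is det (L cap F^perp) times the determinant of that projection, whose dual is
  L# cap F and contains Ox. Hence det (L cap F^perp) <= det L * N(x)^r / D. Bounding N(L) by the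
  minimum of L cap F^perp, that minimum by the Hermite constant in dimension r(m-1), and N(x) by
  the one in dimension rm yields the inequality, and it is an equality exactly if every step is.

  Two ingredients are less elementary. First, det L * det L# = D^(2m): the codifferent I of O is
  invertible because O is maximal, so L## = L, and L |-> I L is an automorphism of the poset of
  O-lattices that preserves the annihilators of simple quotients. A simple module over a finite
  ring is determined by its annihilator, so the automorphism preserves indices, and det (I L) /
  det L can be computed on a free lattice. Second, the converse of the equality case needs an
  optimal lattice, which exists because normalized lattices with bounded minimum have bases of
  bounded length (Hermite's reduction).
*)

theory Submission
  imports Defs
begin

text \<open>Lattices need not be free over the order, so det L# cannot be read off a dual basis, and
  ideals of a quaternion order need not be principal. What makes them tractable is that, by
  maximality, both multiplier rings of a two-sided ideal B equal O; hence y B and B y lie in O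
  simultaneously. This symmetry drives both the invertibility of the codifferent and the invariance
  of annihilators, without localization.

  Write r for dim K and c for the constant in dimension r(m-1). For an optimal L, N(L)^r = gamma^r
  det(L)^(1/m), while det L# = D^(2m) / det L gives N(x)^r <= gamma^r D^2 det(L)^(-1/m). In
  N(L)^(r(m-1)) <= c^(r(m-1)) det(L) N(x)^r / D both sides then carry det(L)^((m-1)/m), and
  gamma^(r(m-2)) <= c^(r(m-1)) D is left.

  In logarithms the chain is an exact identity with four nonnegative defects. Their weighted sum
  depends only on the constants and not on L or x, so if it vanishes for one pair it vanishes for
  all: this is how equality becomes a statement on every optimal lattice.\<close>

section \<open>Lattice bases as lists of vectors\<close>

definition lcomb :: "'v::real_vector list \<Rightarrow> (nat \<Rightarrow> real) \<Rightarrow> 'v" where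
  "lcomb bs c = (\<Sum>j<length bs. c j *\<^sub>R bs ! j)"

definition free_list :: "'v::real_vector list \<Rightarrow> bool" where
  "free_list bs \<longleftrightarrow> (\<forall>c. lcomb bs c = 0 \<longrightarrow> (\<forall>j<length bs. c j = 0))"

text \<open>Independence is required over the reals, which makes L discrete;
  \<open>int_basis\<close> asks for it only over the integers, and 1, sqrt 2 form such a basis of a
  dense subgroup of the line. Lists with coefficients on the naturals match the index sets of
  \<open>mat\<close>.\<close>

definition lbasis :: "'v::real_vector list \<Rightarrow> 'v set \<Rightarrow> bool" where
  "lbasis bs L \<longleftrightarrow> free_list bs \<and> L = range (\<lambda>c::nat \<Rightarrow> int. lcomb bs (\<lambda>j. of_int (c j)))"

lemma lcomb_cong: "(\<And>j. j < length bs \<Longrightarrow> c j = d j) \<Longrightarrow> lcomb bs c = lcomb bs d"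
  by (simp add: lcomb_def)

lemma lcomb_zero [simp]: "lcomb bs (\<lambda>j. 0) = 0"
  by (simp add: lcomb_def)

lemma lcomb_add: "lcomb bs c + lcomb bs d = lcomb bs (\<lambda>j. c j + d j)"
  by (simp add: lcomb_def sum.distrib scaleR_add_left)

lemma lcomb_diff: "lcomb bs c - lcomb bs d = lcomb bs (\<lambda>j. c j - d j)"
  by (simp add: lcomb_def sum_subtractf scaleR_diff_left)

lemma lcomb_scale: "a *\<^sub>R lcomb bs c = lcomb bs (\<lambda>j. a * c j)"
  by (simp add: lcomb_def scaleR_sum_right)

lemma lcomb_sum: "(\<Sum>i\<in>I. lcomb bs (c i)) = lcomb bs (\<lambda>j. \<Sum>i\<in>I. c i j)"
  unfolding lcomb_def by (subst sum.swap) (simp add: scaleR_sum_left)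

lemma lcomb_unit: "i < length bs \<Longrightarrow> lcomb bs (\<lambda>j. if j = i then 1 else 0) = bs ! i"
proof -
  assume i: "i < length bs"
  have "lcomb bs (\<lambda>j. if j = i then 1 else 0) = (\<Sum>j<length bs. if j = i then bs ! j else 0)"
    unfolding lcomb_def by (rule sum.cong) auto
  also have "\<dots> = bs ! i" using i by (simp add: sum.delta)
  finally show ?thesis .
qed

lemma linear_lcomb: "linear f \<Longrightarrow> f (lcomb bs c) = lcomb (map f bs) c"
  by (simp add: lcomb_def linear_sum linear_cmul)

lemma inner_lcomb: "lcomb bs c \<bullet> y = (\<Sum>j<length bs. c j * (bs ! j \<bullet> y))"
  by (simp add: lcomb_def inner_sum_left)

lemma inner_lcomb_right: "y \<bullet> lcomb bs c = (\<Sum>j<length bs. c j * (y \<bullet> bs ! j))"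
  by (simp add: lcomb_def inner_sum_right)

lemma lcomb_append: "lcomb (bs @ cs) c = lcomb bs c + lcomb cs (\<lambda>j. c (length bs + j))"
proof -
  have "lcomb (bs @ cs) c = (\<Sum>j<length bs. c j *\<^sub>R (bs @ cs) ! j)
      + (\<Sum>j<length cs. c (length bs + j) *\<^sub>R (bs @ cs) ! (length bs + j))"
    unfolding lcomb_def length_append sum.nat_group[symmetric]
    using sum.atLeastLessThan_concat[of 0 "length bs" "length bs + length cs" "\<lambda>j. c j *\<^sub>R (bs @ cs) ! j"]
      sum.shift_bounds_nat_ivl[of "\<lambda>j. c j *\<^sub>R (bs @ cs) ! j" 0 "length bs" "length cs"]
    by (simp add: lessThan_atLeast0 add.commute)
  then show ?thesis
    by (simp add: lcomb_def nth_append)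
qed

lemma lcomb_single [simp]: "lcomb [v] c = c 0 *\<^sub>R v"
  by (simp add: lcomb_def)

lemma lcomb_Nil [simp]: "lcomb [] c = 0"
  by (simp add: lcomb_def)

lemma span_eq_lcomb: "span (set bs) = range (lcomb bs)"
proof
  show "span (set bs) \<subseteq> range (lcomb bs)"
  proof (rule span_minimal)
    show "set bs \<subseteq> range (lcomb bs)"
    proof
      fix x assume "x \<in> set bs"
      then show "x \<in> range (lcomb bs)"
        by (metis in_set_conv_nth lcomb_unit rangeI)
    qed
    show "subspace (range (lcomb bs))"
      unfolding subspace_def
      by (auto simp: lcomb_add lcomb_scale intro: rev_image_eqI[of "\<lambda>j. 0"])
  qed
  show "range (lcomb bs) \<subseteq> span (set bs)"
    unfolding lcomb_def by (auto intro: span_sum[OF span_scale[OF span_base]])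
qed

lemma int_span_eq_lcomb:
  "int_module.span (set bs) = range (\<lambda>c::nat \<Rightarrow> int. lcomb bs (\<lambda>j. of_int (c j)))" (is "_ = ?R")
proof
  show "int_module.span (set bs) \<subseteq> ?R"
  proof (rule int_module.span_minimal)
    show "set bs \<subseteq> ?R"
    proof
      fix x assume "x \<in> set bs"
      then obtain i where i: "i < length bs" "x = bs ! i" by (auto simp: in_set_conv_nth)
      then have "x = lcomb bs (\<lambda>j. of_int (if j = i then 1 else 0))"
        using lcomb_unit[OF i(1)] by (simp add: if_distrib[of of_int] cong: if_cong)
      then show "x \<in> ?R" by (rule image_eqI[where x = "\<lambda>j. if j = i then 1 else 0"]) (rule UNIV_I)
    qed
    show "int_module.subspace ?R"
      unfolding int_module.subspace_def
    proof (intro conjI ballI allI)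
      show "0 \<in> ?R" by (rule image_eqI[of _ _ "\<lambda>j. 0"]) auto
      show "x + y \<in> ?R" if "x \<in> ?R" "y \<in> ?R" for x y
        using that by (auto simp: lcomb_add simp flip: of_int_add)
      show "of_int c *\<^sub>R x \<in> ?R" if "x \<in> ?R" for c x
        using that by (auto simp: lcomb_scale simp flip: of_int_mult)
    qed
  qed
  show "?R \<subseteq> int_module.span (set bs)"
    unfolding lcomb_def by (auto intro: int_module.span_sum[OF int_module.span_scale[OF int_module.span_base]])
qed

lemma lcomb_distinct:
  assumes "distinct bs"
  shows "lcomb bs c = (\<Sum>v\<in>set bs. c (inv_into {..<length bs} (\<lambda>j. bs ! j) v) *\<^sub>R v)"
proof -
  have bij: "bij_betw (\<lambda>j. bs ! j) {..<length bs} (set bs)"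
    using assms by (rule bij_betw_nth) auto
  then have inj: "inj_on (\<lambda>j. bs ! j) {..<length bs}" by (rule bij_betw_imp_inj_on)
  show ?thesis
    unfolding lcomb_def
    by (subst sum.reindex_bij_betw[OF bij, symmetric]) (simp add: inv_into_f_f[OF inj])
qed

lemma free_list_iff: "free_list bs \<longleftrightarrow> distinct bs \<and> independent (set bs)"
proof
  assume f: "free_list bs"
  have d: "distinct bs"
    unfolding distinct_conv_nth
  proof (intro allI impI notI)
    fix i j assume ij: "i < length bs" "j < length bs" "i \<noteq> j" "bs ! i = bs ! j"
    have "lcomb bs (\<lambda>k. (if k = i then 1 else 0) - (if k = j then 1 else 0)) = 0"
      unfolding lcomb_diff[symmetric] using ij lcomb_unit[OF ij(1)] lcomb_unit[OF ij(2)] by simp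
    with f ij(1) have "(if i = i then 1 else 0) - (if i = j then 1 else 0) = (0::real)"
      unfolding free_list_def by blast
    with ij(3) show False by simp
  qed
  moreover have "independent (set bs)"
    unfolding independent_explicit_finite_subsets[OF, of "set bs"] 
  proof (intro allI impI ballI)
    fix S u v assume S: "S \<subseteq> set bs" "finite S" and z: "(\<Sum>v\<in>S. u v *\<^sub>R v) = 0" and v: "v \<in> S"
    have bij: "bij_betw (\<lambda>j. bs ! j) {..<length bs} (set bs)"
      using d by (rule bij_betw_nth) auto
    let ?c = "\<lambda>j. if bs ! j \<in> S then u (bs ! j) else 0"
    have "lcomb bs ?c = (\<Sum>v\<in>set bs. (if v \<in> S then u v else 0) *\<^sub>R v)"
      unfolding lcomb_def by (rule sum.reindex_bij_betw[OF bij])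
    also have "\<dots> = (\<Sum>v\<in>S. u v *\<^sub>R v)"
      using S by (intro sum.mono_neutral_cong_right) auto
    finally have "lcomb bs ?c = 0" using z by simp
    with f have c: "\<forall>j<length bs. ?c j = 0" unfolding free_list_def by blast
    obtain j where "j < length bs" "bs ! j = v" using v S by (metis in_set_conv_nth subsetD)
    with c v show "u v = 0" by auto
  qed
  ultimately show "distinct bs \<and> independent (set bs)" ..
next
  assume d: "distinct bs \<and> independent (set bs)"
  have bij: "bij_betw (\<lambda>j. bs ! j) {..<length bs} (set bs)"
    using d by (intro bij_betw_nth) auto
  have inj: "inj_on (\<lambda>j. bs ! j) {..<length bs}" using bij by (rule bij_betw_imp_inj_on)
  show "free_list bs"
    unfolding free_list_def
  proof (intro allI impI)
    fix c j assume z: "lcomb bs c = 0" and j: "j < length bs"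
    let ?u = "\<lambda>v. c (inv_into {..<length bs} (\<lambda>j. bs ! j) v)"
    have "(\<Sum>v\<in>set bs. ?u v *\<^sub>R v) = 0"
      using lcomb_distinct[of bs c] d z by simp
    then have "?u (bs ! j) = 0"
      using independentD[of "set bs" "set bs" ?u "bs ! j"] d j by simp
    then show "c j = 0" using inv_into_f_f[OF inj, of j] j by simp
  qed
qed

lemma lbasis_imp_int_basis:
  assumes "lbasis bs L" shows "int_basis bs L"
proof -
  have f: "free_list bs" and L: "L = int_module.span (set bs)"
    using assms by (auto simp: lbasis_def int_span_eq_lcomb)
  have "int_module.independent (set bs)"
    unfolding int_module.independent_explicit_module
  proof (intro allI impI)
    fix t and u :: "'a \<Rightarrow> int" and v assume t: "finite t" "t \<subseteq> set bs" "(\<Sum>v\<in>t. of_int (u v) *\<^sub>R v) = 0" "v \<in> t"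
    have "independent (set bs)" using f by (simp add: free_list_iff)
    from independentD[OF this t(1,2,3) t(4)] show "u v = 0" by simp
  qed
  then show ?thesis using f L by (simp add: int_basis_def free_list_iff)
qed

lemma lbasis_imp_is_lattice: "lbasis bs L \<Longrightarrow> is_lattice L"
  unfolding is_lattice_def lbasis_def free_list_iff int_span_eq_lcomb[symmetric] by blast

lemma is_lattice_imp_lbasis:
  fixes L :: "'v::euclidean_space set"
  assumes "is_lattice L" obtains bs where "lbasis bs L"
proof -
  obtain B where B: "independent B" "L = int_module.span B"
    using assms unfolding is_lattice_def by blast
  have "finite B" using B(1) by (rule independent_imp_finite)
  then obtain bs where "set bs = B" "distinct bs" using finite_distinct_list by blast
  with B have "lbasis bs L" by (simp add: lbasis_def free_list_iff flip: int_span_eq_lcomb)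
  then show ?thesis by (rule that)
qed

text \<open>Take a real basis B of L with bs = U B and B = V bs, where U and V are integral.
  Independence over the integers gives U V = 1. A real relation c on bs gives c U = 0, because B is
  independent over the reals, and so c = c U V = 0.\<close>

lemma int_basis_imp_lbasis:
  fixes L :: "'v::euclidean_space set"
  assumes L: "is_lattice L" and bs: "int_basis bs L"
  shows "lbasis bs L"
proof -
  obtain B where B: "lbasis B L" using L by (rule is_lattice_imp_lbasis)
  have Lbs: "L = range (\<lambda>c::nat \<Rightarrow> int. lcomb bs (\<lambda>j. of_int (c j)))"
    using bs by (simp add: int_basis_def int_span_eq_lcomb)
  have LB: "L = range (\<lambda>c::nat \<Rightarrow> int. lcomb B (\<lambda>j. of_int (c j)))" and fB: "free_list B"
    using B by (auto simp: lbasis_def)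
  have "bs ! i \<in> L" if "i < length bs" for i
    using bs that by (auto simp: int_basis_def int_module.span_base)
  then have "\<forall>i. \<exists>u::nat\<Rightarrow>int. i < length bs \<longrightarrow> bs ! i = lcomb B (\<lambda>j. of_int (u j))"
    unfolding LB by blast
  then obtain U :: "nat \<Rightarrow> nat \<Rightarrow> int" where
    U: "\<And>i. i < length bs \<Longrightarrow> bs ! i = lcomb B (\<lambda>j. of_int (U i j))" by metis
  have "B ! i \<in> L" if "i < length B" for i
    using lbasis_imp_int_basis[OF B] that by (auto simp: int_basis_def int_module.span_base)
  then have "\<forall>i. \<exists>u::nat\<Rightarrow>int. i < length B \<longrightarrow> B ! i = lcomb bs (\<lambda>j. of_int (u j))"
    unfolding Lbs by blast
  then obtain V :: "nat \<Rightarrow> nat \<Rightarrow> int" where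
    V: "\<And>i. i < length B \<Longrightarrow> B ! i = lcomb bs (\<lambda>j. of_int (V i j))" by metis
  have ind: "c j = 0" if "lcomb bs (\<lambda>j. of_int (c j)) = 0" "j < length bs" for c :: "nat \<Rightarrow> int" and j
  proof -
    have d: "distinct bs" and i: "int_module.independent (set bs)" using bs by (auto simp: int_basis_def)
    have bij: "bij_betw (\<lambda>j. bs ! j) {..<length bs} (set bs)"
      using d by (intro bij_betw_nth) auto
    have inj: "inj_on (\<lambda>j. bs ! j) {..<length bs}" using bij by (rule bij_betw_imp_inj_on)
    let ?u = "\<lambda>v. c (inv_into {..<length bs} (\<lambda>j. bs ! j) v)"
    have z: "(\<Sum>v\<in>set bs. of_int (?u v) *\<^sub>R v) = 0"
      using lcomb_distinct[OF d, of "\<lambda>j. of_int (c j)"] that(1) by simp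
    have "?u (bs ! j) = 0"
      by (rule i[unfolded int_module.independent_explicit_module, rule_format, of "set bs"])
        (use z that(2) in auto)
    then show ?thesis using inv_into_f_f[OF inj, of j] that(2) by simp
  qed
  have UV: "(\<Sum>j<length B. U i j * V j l) = (if l = i then 1 else 0)" if il: "i < length bs" "l < length bs" for i l
  proof -
    have "lcomb bs (\<lambda>l. of_int (\<Sum>j<length B. U i j * V j l)) = (\<Sum>j<length B. of_int (U i j) *\<^sub>R lcomb bs (\<lambda>l. of_int (V j l)))"
      by (simp add: lcomb_scale lcomb_sum)
    also have "\<dots> = (\<Sum>j<length B. of_int (U i j) *\<^sub>R B ! j)"
      by (intro sum.cong refl) (simp add: V)
    also have "\<dots> = bs ! i"
      by (simp only: U[OF il(1)] lcomb_def)
    finally have e: "lcomb bs (\<lambda>l. of_int (\<Sum>j<length B. U i j * V j l)) = bs ! i" .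
    have "lcomb bs (\<lambda>l. of_int ((\<Sum>j<length B. U i j * V j l) - (if l = i then 1 else 0)))
        = lcomb bs (\<lambda>l. of_int (\<Sum>j<length B. U i j * V j l)) - lcomb bs (\<lambda>l. if l = i then 1 else 0)"
      unfolding lcomb_diff by (intro lcomb_cong) simp
    then have "lcomb bs (\<lambda>l. of_int ((\<Sum>j<length B. U i j * V j l) - (if l = i then 1 else 0))) = 0"
      using e lcomb_unit[OF il(1)] by simp
    from ind[OF this il(2)] show ?thesis by simp
  qed
  have "free_list bs"
    unfolding free_list_def
  proof (intro allI impI)
    fix c l assume z: "lcomb bs c = 0" and l: "l < length bs"
    have "lcomb B (\<lambda>j. \<Sum>i<length bs. c i * of_int (U i j)) = (\<Sum>i<length bs. c i *\<^sub>R lcomb B (\<lambda>j. of_int (U i j)))"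
      by (simp add: lcomb_scale lcomb_sum)
    also have "\<dots> = 0" using z U by (simp add: lcomb_def[of bs])
    finally have z': "(\<Sum>i<length bs. c i * of_int (U i j)) = 0" if "j < length B" for j
      using fB that unfolding free_list_def by blast
    have "(\<Sum>i<length bs. c i * of_int (if l = i then 1 else 0)) = (\<Sum>i<length bs. if l = i then c i else 0)"
      by (rule sum.cong) auto
    then have "c l = (\<Sum>i<length bs. c i * of_int (if l = i then 1 else 0))"
      using l by simp
    also have "\<dots> = (\<Sum>i<length bs. \<Sum>j<length B. c i * of_int (U i j) * of_int (V j l))"
    proof (rule sum.cong[OF refl])
      fix i assume "i \<in> {..<length bs}"
      then have "i < length bs" by simp
      from UV[OF this l] show "c i * of_int (if l = i then 1 else 0) = (\<Sum>j<length B. c i * of_int (U i j) * of_int (V j l))"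
        by (simp only: mult.assoc sum_distrib_left[symmetric] of_int_mult[symmetric] of_int_sum[symmetric])
    qed
    also have "\<dots> = (\<Sum>j<length B. (\<Sum>i<length bs. c i * of_int (U i j)) * of_int (V j l))"
      by (subst sum.swap) (simp add: sum_distrib_right)
    also have "\<dots> = 0" using z' by simp
    finally show "c l = 0" .
  qed
  then show ?thesis using Lbs by (simp add: lbasis_def)
qed

section \<open>Gram determinants\<close>

definition gdet :: "'v::real_inner list \<Rightarrow> real" where
  "gdet bs = Determinant.det (mat (length bs) (length bs) (\<lambda>(i, j). bs ! i \<bullet> bs ! j))"

lemma gdet_change:
  assumes len: "length cs = length bs"
    and cs: "\<And>i. i < length bs \<Longrightarrow> cs ! i = lcomb bs (U i)"
  shows "gdet cs = (Determinant.det (mat (length bs) (length bs) (\<lambda>(i, j). U i j)))\<^sup>2 * gdet bs"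
proof -
  let ?n = "length bs"
  let ?U = "mat ?n ?n (\<lambda>(i, j). U i j)" and ?G = "mat ?n ?n (\<lambda>(i, j). bs ! i \<bullet> bs ! j)"
  have "mat ?n ?n (\<lambda>(i, j). cs ! i \<bullet> cs ! j) = ?U * ?G * transpose_mat ?U"
  proof (rule eq_matI)
    fix i j assume ij: "i < dim_row (?U * ?G * transpose_mat ?U)" "j < dim_col (?U * ?G * transpose_mat ?U)"
    then have ij: "i < ?n" "j < ?n" by auto
    have "cs ! i \<bullet> cs ! j = (\<Sum>k<?n. U i k * (\<Sum>l<?n. U j l * (bs ! k \<bullet> bs ! l)))"
      unfolding cs[OF ij(1)] cs[OF ij(2)] by (subst inner_lcomb) (simp add: inner_lcomb_right)
    also have "\<dots> = (\<Sum>k<?n. \<Sum>l<?n. U i k * (bs ! k \<bullet> bs ! l) * U j l)"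
      by (simp add: sum_distrib_left mult_ac)
    also have "\<dots> = (\<Sum>l<?n. (\<Sum>k<?n. U i k * (bs ! k \<bullet> bs ! l)) * U j l)"
      by (subst sum.swap) (simp add: sum_distrib_right)
    also have "\<dots> = (?U * ?G * transpose_mat ?U) $$ (i, j)"
      using ij by (simp add: scalar_prod_def lessThan_atLeast0)
    finally show "mat ?n ?n (\<lambda>(i, j). cs ! i \<bullet> cs ! j) $$ (i, j) = (?U * ?G * transpose_mat ?U) $$ (i, j)"
      using ij by simp
  qed auto
  moreover have "?U * ?G \<in> carrier_mat ?n ?n"
    by (rule mult_carrier_mat[of _ _ ?n]) auto
  ultimately show ?thesis
    unfolding gdet_def len
    using det_mult[of "?U * ?G" ?n "transpose_mat ?U"] det_mult[of ?U ?n ?G] Determinant.det_transpose[of ?U ?n]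
    by (simp add: power2_eq_square)
qed

text \<open>Passing from cs to p cs only removes combinations of bs, so the transition matrix is
  unitriangular; the Gram matrix of bs followed by p cs is block diagonal.\<close>

lemma gdet_append:
  fixes bs cs :: "'v::real_inner list"
  assumes p: "\<And>j. j < length cs \<Longrightarrow> cs ! j - p (cs ! j) \<in> span (set bs)"
    and o: "\<And>i j. i < length bs \<Longrightarrow> j < length cs \<Longrightarrow> bs ! i \<bullet> p (cs ! j) = 0"
  shows "gdet (bs @ cs) = gdet bs * gdet (map p cs)"
proof -
  let ?n = "length bs" and ?m = "length cs"
  have "\<forall>j. \<exists>a. j < ?m \<longrightarrow> cs ! j - p (cs ! j) = lcomb bs a"
    using p unfolding span_eq_lcomb by blast
  then obtain a where a: "\<And>j. j < ?m \<Longrightarrow> cs ! j - p (cs ! j) = lcomb bs (a j)" by metis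
  let ?U = "\<lambda>i j. if i < ?n then (if j = i then 1 else 0)
     else if j < ?n then a (i - ?n) j else (if j = i then 1 else 0) :: real"
  have len: "length (bs @ cs) = length (bs @ map p cs)" by simp
  have "gdet (bs @ cs) = (Determinant.det (mat (length (bs @ map p cs)) (length (bs @ map p cs)) (\<lambda>(i, j). ?U i j)))\<^sup>2 * gdet (bs @ map p cs)"
  proof (rule gdet_change[OF len])
    fix i assume i: "i < length (bs @ map p cs)"
    show "(bs @ cs) ! i = lcomb (bs @ map p cs) (?U i)"
    proof (cases "i < ?n")
      case True
      then show ?thesis
        unfolding lcomb_append
        using lcomb_unit[OF True] lcomb_zero[of "map p cs"]
        by (simp add: nth_append cong: if_cong)
    next
      case False
      then have "lcomb bs (?U i) = lcomb bs (a (i - ?n))" by (intro lcomb_cong) auto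
      moreover have "lcomb (map p cs) (\<lambda>j. ?U i (?n + j)) = lcomb (map p cs) (\<lambda>j. if j = i - ?n then 1 else 0)"
        using False by (intro lcomb_cong) auto
      moreover have k: "i - ?n < ?m" using False i by simp
      ultimately have "lcomb (bs @ map p cs) (?U i) = lcomb bs (a (i - ?n)) + p (cs ! (i - ?n))"
        using lcomb_unit[of "i - ?n" "map p cs"] unfolding lcomb_append by simp
      also have "\<dots> = cs ! (i - ?n)"
        unfolding a[OF k, symmetric] by (rule diff_add_cancel)
      finally show ?thesis
        using False by (simp add: nth_append)
    qed
  qed
  also have "mat (length (bs @ map p cs)) (length (bs @ map p cs)) (\<lambda>(i, j). ?U i j) =
      four_block_mat (1\<^sub>m ?n) (0\<^sub>m ?n ?m) (mat ?m ?n (\<lambda>(i, j). a i j)) (1\<^sub>m ?m)"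
    by (rule eq_matI) auto
  also have "Determinant.det \<dots> = 1"
    by (subst det_four_block_mat_upper_right_zero[of _ ?n _ ?m]) auto
  also have "gdet (bs @ map p cs) = Determinant.det (four_block_mat
      (mat ?n ?n (\<lambda>(i, j). bs ! i \<bullet> bs ! j)) (0\<^sub>m ?n ?m) (0\<^sub>m ?m ?n)
      (mat ?m ?m (\<lambda>(i, j). map p cs ! i \<bullet> map p cs ! j)))"
    unfolding gdet_def
    by (rule arg_cong[of _ _ Determinant.det], rule eq_matI)
       (auto simp: nth_append o o[unfolded inner_commute[of "bs ! _"]])
  also have "\<dots> = gdet bs * gdet (map p cs)"
    by (rule trans[OF det_four_block_mat_upper_right_zero[of _ ?n _ ?m]]) (simp_all add: gdet_def)
  finally show ?thesis by simp
qed

lemma int_subspaceI: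
  assumes "0 \<in> L" and d: "\<And>x y. x \<in> L \<Longrightarrow> y \<in> L \<Longrightarrow> x - y \<in> L"
  shows "int_module.subspace L"
proof -
  have n: "- x \<in> L" if "x \<in> L" for x using d[OF assms(1) that] by simp
  have a: "x + y \<in> L" if "x \<in> L" "y \<in> L" for x y using d[OF that(1) n[OF that(2)]] by simp
  have s: "of_nat k *\<^sub>R x \<in> L" if "x \<in> L" for k :: nat and x
    by (induction k) (auto simp: assms(1) scaleR_add_left intro: a that)
  have "of_int c *\<^sub>R x \<in> L" if "x \<in> L" for c x
  proof (cases "c \<ge> 0")
    case True then show ?thesis using s[OF that, of "nat c"] by simp
  next
    case False then show ?thesis using n[OF s[OF that, of "nat (- c)"]] by simp
  qed
  then show ?thesis using assms(1) a by (auto simp: int_module.subspace_def)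
qed

lemma lbasis_subspace: "lbasis bs L \<Longrightarrow> int_module.subspace L"
  by (auto simp: lbasis_def int_module.subspace_span simp flip: int_span_eq_lcomb)

lemma is_lattice_subspace: "is_lattice L \<Longrightarrow> int_module.subspace L"
  by (auto simp: is_lattice_def int_module.subspace_span)

lemma lcomb_int_mem:
  "int_module.subspace L \<Longrightarrow> set bs \<subseteq> L \<Longrightarrow> lcomb bs (\<lambda>j. of_int (c j)) \<in> L"
  unfolding lcomb_def by (auto intro!: int_module.subspace_sum int_module.subspace_scale)

lemma lbasis_subset: "lbasis bs L \<Longrightarrow> set bs \<subseteq> L"
  by (metis lbasis_imp_int_basis int_basis_def int_module.span_superset)

lemma lbasis_coords:
  assumes "lbasis bs L" "x \<in> L" obtains c :: "nat \<Rightarrow> int" where "x = lcomb bs (\<lambda>j. of_int (c j))"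
  using assms unfolding lbasis_def by blast

lemma lbasis_span: "lbasis bs L \<Longrightarrow> span L = span (set bs)"
proof -
  assume b: "lbasis bs L"
  have "L \<subseteq> span (set bs)"
    using b unfolding lbasis_def span_eq_lcomb by blast
  with lbasis_subset[OF b] show ?thesis by (meson span_mono span_minimal subspace_span subset_antisym)
qed

lemma lbasis_length: "lbasis bs L \<Longrightarrow> length bs = dim L"
  by (metis distinct_card dim_span dim_span_eq_card_independent free_list_iff lbasis_def lbasis_span)

lemma lbasisI:
  assumes "free_list bs" "int_module.subspace L" "set bs \<subseteq> L"
    and "\<And>x. x \<in> L \<Longrightarrow> \<exists>c::nat \<Rightarrow> int. x = lcomb bs (\<lambda>j. of_int (c j))"
  shows "lbasis bs L"
  using assms lcomb_int_mem[OF assms(2,3)] unfolding lbasis_def by blast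

subsection \<open>Splitting off a sublattice\<close>

lemma free_list_lift:
  assumes p: "linear p" and fc: "free_list (map p cs)" and fb: "free_list bs" and b0: "\<And>b. b \<in> set bs \<Longrightarrow> p b = 0"
  shows "free_list (bs @ cs)"
  unfolding free_list_def
proof (intro allI impI)
  fix c j assume z: "lcomb (bs @ cs) c = 0" and j: "j < length (bs @ cs)"
  have "p (lcomb bs c) = 0"
    using b0 by (simp add: lcomb_def linear_sum[OF p] linear_cmul[OF p])
  then have "lcomb (map p cs) (\<lambda>j. c (length bs + j)) = 0"
    using z linear_lcomb[OF p, of cs "\<lambda>j. c (length bs + j)"]
    by (metis add.left_neutral lcomb_append linear_0 linear_add p)
  then have c2: "\<forall>j<length cs. c (length bs + j) = 0"
    using fc unfolding free_list_def by auto
  then have "lcomb cs (\<lambda>j. c (length bs + j)) = 0" by (simp add: lcomb_def)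
  then have "lcomb bs c = 0" using z by (simp add: lcomb_append)
  then have c1: "\<forall>j<length bs. c j = 0" using fb unfolding free_list_def by auto
  show "c j = 0"
  proof (cases "j < length bs")
    case False then show ?thesis using c2[rule_format, of "j - length bs"] j by simp
  qed (use c1 in blast)
qed

lemma free_list_unlift:
  assumes p: "linear p" and f: "free_list (bs @ cs)" and k: "\<And>y. p y = 0 \<Longrightarrow> y \<in> span (set bs)"
  shows "free_list (map p cs)"
  unfolding free_list_def
proof (intro allI impI)
  fix c j assume z: "lcomb (map p cs) c = 0" and j: "j < length (map p cs)"
  then have "p (lcomb cs c) = 0" by (simp add: linear_lcomb[OF p])
  then obtain d where d: "lcomb cs c = lcomb bs d" using k unfolding span_eq_lcomb by blast
  let ?e = "\<lambda>i. if i < length bs then - d i else c (i - length bs)"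
  have "lcomb bs ?e = lcomb bs (\<lambda>j. - 1 * d j)" by (intro lcomb_cong) simp
  also have "\<dots> = - lcomb bs d" unfolding lcomb_scale[symmetric] by simp
  finally have "lcomb (bs @ cs) ?e = 0" using d by (simp add: lcomb_append)
  then have "\<forall>i<length (bs @ cs). ?e i = 0" using f unfolding free_list_def by blast
  from this[rule_format, of "length bs + j"] show "c j = 0" using j by simp
qed

text \<open>Subtracting from x the lift of p x leaves an element of the kernel. Reduced bases,
  indices and determinants of sections are all built on this splitting.\<close>

lemma lbasis_lift:
  assumes p: "linear p" and L: "int_module.subspace L"
    and bs: "lbasis bs (L \<inter> {y. p y = 0})" and cs: "lbasis (map p cs) (p ` L)" "set cs \<subseteq> L"
  shows "lbasis (bs @ cs) L"
proof (rule lbasisI[OF _ L])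
  show "free_list (bs @ cs)"
    using bs cs lbasis_subset[OF bs] by (intro free_list_lift[OF p]) (auto simp: lbasis_def)
  show "set (bs @ cs) \<subseteq> L" using lbasis_subset[OF bs] cs by auto
  fix x assume x: "x \<in> L"
  then obtain c :: "nat \<Rightarrow> int" where c: "p x = lcomb (map p cs) (\<lambda>j. of_int (c j))"
    using lbasis_coords[OF cs(1)] by (metis imageI)
  let ?y = "x - lcomb cs (\<lambda>j. of_int (c j))"
  have "?y \<in> L \<inter> {y. p y = 0}"
    using x c lcomb_int_mem[OF L cs(2)] by (auto simp: linear_diff[OF p] linear_lcomb[OF p] intro: int_module.subspace_diff[OF L])
  then obtain d :: "nat \<Rightarrow> int" where d: "?y = lcomb bs (\<lambda>j. of_int (d j))"
    using lbasis_coords[OF bs] by metis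
  have "lcomb (bs @ cs) (\<lambda>j. of_int (if j < length bs then d j else c (j - length bs))) = x"
    using d unfolding lcomb_append by (simp add: lcomb_def algebra_simps)
  then show "\<exists>c::nat \<Rightarrow> int. x = lcomb (bs @ cs) (\<lambda>j. of_int (c j))" by metis
qed

text \<open>The Gram-Schmidt step: the component of y orthogonal to v. For v = 0 the quotient is 0
  and \<open>rej v\<close> is the identity.\<close>

definition rej :: "'v::real_inner \<Rightarrow> 'v \<Rightarrow> 'v" where
  "rej v y = y - ((y \<bullet> v) / (v \<bullet> v)) *\<^sub>R v"

lemma linear_rej: "linear (rej v)"
  by (rule linearI) (simp_all add: rej_def algebra_simps inner_add_left add_divide_distrib)

lemma rej_eq_0: "rej v y = 0 \<Longrightarrow> y \<in> span {v}"
  unfolding span_singleton rej_def by auto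

lemma rej_orth: "v \<bullet> rej v y = 0"
  by (cases "v = 0") (simp_all add: rej_def inner_diff_right inner_commute)

lemma rej_self: "rej v (c *\<^sub>R v) = 0"
  by (cases "v = 0") (simp_all add: rej_def)

lemma gdet_Nil [simp]: "gdet [] = 1"
  by (simp add: gdet_def)

lemma gdet_Cons: "gdet (v # cs) = (v \<bullet> v) * gdet (map (rej v) cs)"
proof -
  have "gdet ([v] @ cs) = gdet [v] * gdet (map (rej v) cs)"
    by (rule gdet_append) (auto simp: rej_orth, auto simp: rej_def span_singleton)
  moreover have "gdet [v] = v \<bullet> v"
    unfolding gdet_def by (subst det_single) auto
  ultimately show ?thesis by simp
qed

lemma gdet_pos: "free_list bs \<Longrightarrow> gdet bs > 0"
proof (induction bs rule: length_induct)
  case (1 bs)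
  show ?case
  proof (cases bs)
    case (Cons v cs)
    have f: "free_list ([v] @ cs)" using 1 Cons by simp
    have "free_list (map (rej v) cs)"
      by (rule free_list_unlift[OF linear_rej f]) (simp add: rej_eq_0)
    moreover have "v \<noteq> 0" using f dependent_zero[of "set ([v] @ cs)"] by (auto simp: free_list_iff)
    ultimately show ?thesis using 1(1) Cons by (simp add: gdet_Cons)
  qed simp
qed

subsection \<open>Minimal vectors and reduced bases\<close>

text \<open>Each coordinate functional extends linearly to the whole space, and its adjoint at 1 is
  the vector representing it.\<close>

lemma dual_list:
  fixes bs :: "'v::euclidean_space list"
  assumes "free_list bs"
  shows "\<exists>ds. length ds = length bs \<and> (\<forall>i<length bs. \<forall>j<length bs. bs ! i \<bullet> ds ! j = (if i = j then 1 else 0))"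
proof -
  have "\<exists>y. \<forall>i<length bs. bs ! i \<bullet> y = (if i = j then 1 else 0)" if j: "j < length bs" for j
  proof -
    have i: "independent (set bs)" and d: "distinct bs" using assms by (auto simp: free_list_iff)
    obtain g :: "'v \<Rightarrow> real" where g: "linear g" "\<forall>x\<in>set bs. g x = (if x = bs ! j then 1 else 0)"
      using linear_independent_extend[OF i, of "\<lambda>x. if x = bs ! j then 1 else (0::real)"] by blast
    have "bs ! i \<bullet> adjoint g 1 = (if i = j then 1 else 0)" if "i < length bs" for i
      using g(2) that j d by (simp add: adjoint_works[OF g(1)] nth_eq_iff_index_eq)
    then show ?thesis by blast
  qed
  then have "\<forall>j. \<exists>y. j < length bs \<longrightarrow> (\<forall>i<length bs. bs ! i \<bullet> y = (if i = j then 1 else 0))" by blast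
  from choice[OF this] obtain y where
    "\<And>i j. i < length bs \<Longrightarrow> j < length bs \<Longrightarrow> bs ! i \<bullet> y j = (if i = j then 1 else 0)" by auto
  then show ?thesis by (intro exI[of _ "map y [0..<length bs]"]) auto
qed

lemma lcomb_inner_dual:
  assumes "length ds = length bs" "\<And>i j. i < length bs \<Longrightarrow> j < length bs \<Longrightarrow> bs ! i \<bullet> ds ! j = (if i = j then 1 else 0)"
    "j < length bs"
  shows "lcomb bs c \<bullet> ds ! j = c j"
proof -
  have "lcomb bs c \<bullet> ds ! j = (\<Sum>i<length bs. if i = j then c i else 0)"
    unfolding inner_lcomb by (rule sum.cong) (use assms in auto)
  then show ?thesis using assms(3) by simp
qed

text \<open>A nonzero x has a nonzero integral coordinate, of absolute value at least 1. This
  coordinate is the inner product of x with a dual vector of length at most S, so Cauchy-Schwarz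
  bounds x from below.\<close>

lemma lbasis_discrete:
  fixes L :: "'v::euclidean_space set"
  assumes "lbasis bs L" shows "\<exists>a>0. \<forall>x\<in>L - {0}. a \<le> x \<bullet> x"
proof -
  obtain ds where ds: "length ds = length bs" "\<And>i j. i < length bs \<Longrightarrow> j < length bs \<Longrightarrow> bs ! i \<bullet> ds ! j = (if i = j then 1 else 0)"
    using dual_list[of bs] assms unfolding lbasis_def by blast
  \<comment> \<open>The summand 1 keeps S positive even for the empty basis.\<close>
  define S where "S = 1 + (\<Sum>j<length bs. norm (ds ! j))"
  have S: "S \<ge> 1" "j < length bs \<Longrightarrow> norm (ds ! j) \<le> S" for j
    using sum_nonneg[of "{..<length bs}" "\<lambda>j. norm (ds ! j)"] member_le_sum[of j "{..<length bs}" "\<lambda>j. norm (ds ! j)"]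
    unfolding S_def by auto
  have "1 / S\<^sup>2 \<le> x \<bullet> x" if x: "x \<in> L - {0}" for x
  proof -
    obtain c :: "nat \<Rightarrow> int" where c: "x = lcomb bs (\<lambda>j. of_int (c j))" using lbasis_coords[OF assms] x by blast
    have "\<exists>j<length bs. c j \<noteq> 0"
    proof (rule ccontr)
      assume "\<not> (\<exists>j<length bs. c j \<noteq> 0)"
      then have "x = 0" unfolding c by (simp add: lcomb_def)
      with x show False by simp
    qed
    then obtain j where j: "j < length bs" "c j \<noteq> 0" by blast
    have "1 \<le> \<bar>of_int (c j) :: real\<bar>" using j(2) by (simp flip: of_int_abs)
    also have "of_int (c j) = x \<bullet> ds ! j" unfolding c using lcomb_inner_dual[OF ds j(1)] by simp
    also have "\<bar>x \<bullet> ds ! j\<bar> \<le> norm x * norm (ds ! j)" by (rule Cauchy_Schwarz_ineq2)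
    also have "\<dots> \<le> norm x * S" using S(2)[OF j(1)] by (intro mult_left_mono) auto
    finally have "1 / S \<le> norm x" using S(1) by (simp add: field_simps)
    then have "(1 / S)\<^sup>2 \<le> (norm x)\<^sup>2" using S(1) by (intro power_mono) auto
    then show ?thesis by (simp add: power2_norm_eq_inner power_divide)
  qed
  moreover have "1 / S\<^sup>2 > 0" using S(1) by simp
  ultimately show ?thesis by blast
qed

lemma finite_bounded_part:
  fixes L :: "'v::euclidean_space set"
  assumes "int_module.subspace L" "a > 0" "\<forall>x\<in>L - {0}. a \<le> x \<bullet> x"
  shows "finite {x \<in> L. x \<bullet> x \<le> R}"
proof -
  have "uniform_discrete {x \<in> L. x \<bullet> x \<le> R}"
    unfolding uniform_discrete_def
  proof (intro exI[of _ "sqrt a"] conjI ballI impI)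
    show "0 < sqrt a" using assms by simp
    fix x y assume xy: "x \<in> {x \<in> L. x \<bullet> x \<le> R}" "y \<in> {x \<in> L. x \<bullet> x \<le> R}" "dist x y < sqrt a"
    then have "(norm (x - y))\<^sup>2 < a"
      using assms(2) by (metis dist_norm norm_ge_zero real_sqrt_less_iff real_sqrt_abs abs_norm_cancel)
    then show "x = y" using assms(3) int_module.subspace_diff[OF assms(1), of x y] xy
      by (force simp: power2_norm_eq_inner)
  qed
  moreover have "bounded {x \<in> L. x \<bullet> x \<le> R}"
    unfolding bounded_iff by (intro exI[of _ "sqrt R"]) (auto simp: norm_eq_sqrt_inner)
  ultimately show ?thesis using uniform_discrete_finite_iff by blast
qed

lemma minimal_vector_exists:
  fixes L :: "'v::euclidean_space set"
  assumes L: "int_module.subspace L" "a > 0" "\<forall>x\<in>L - {0}. a \<le> x \<bullet> x" and ne: "L \<noteq> {0}"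
  obtains v where "v \<in> L" "v \<noteq> 0" "\<And>x. x \<in> L \<Longrightarrow> x \<noteq> 0 \<Longrightarrow> v \<bullet> v \<le> x \<bullet> x"
proof -
  obtain w where w: "w \<in> L" "w \<noteq> 0" using ne int_module.subspace_0[OF L(1)] by blast
  define F where "F = {x \<in> L. x \<bullet> x \<le> w \<bullet> w} - {0}"
  have F: "finite F" "F \<noteq> {}" using finite_bounded_part[OF L] w unfolding F_def by auto
  obtain v where v: "v \<in> F" "\<And>x. x \<in> F \<Longrightarrow> v \<bullet> v \<le> x \<bullet> x"
    using ex_is_arg_min_if_finite[OF F, of "\<lambda>x. x \<bullet> x"] unfolding is_arg_min_def by (metis not_le)
  show ?thesis
  proof (rule that)
    show "v \<in> L" "v \<noteq> 0" using v(1) by (auto simp: F_def)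
    show "v \<bullet> v \<le> x \<bullet> x" if "x \<in> L" "x \<noteq> 0" for x
      using v(2)[of x] v(1) that by (cases "x \<bullet> x \<le> w \<bullet> w") (auto simp: F_def)
  qed
qed

lemma int_subspace_image: "linear p \<Longrightarrow> int_module.subspace L \<Longrightarrow> int_module.subspace (p ` L)"
  by (rule int_subspaceI)
    (auto simp: linear_0 int_module.subspace_0 simp flip: linear_diff
      intro: int_module.subspace_diff intro!: image_eqI[of 0 p 0])

text \<open>Shifting any lift by the nearest integral multiple of v leaves a component along v of at
  most half of v, whence the quarter.\<close>

lemma rej_lift:
  assumes L: "int_module.subspace L" and v: "v \<in> L" and y: "y \<in> rej v ` L"
  obtains x where "x \<in> L" "rej v x = y" "x \<bullet> x \<le> y \<bullet> y + (v \<bullet> v) / 4"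
proof -
  obtain z where z: "z \<in> L" "y = rej v z" using y by blast
  define t where "t = (z \<bullet> v) / (v \<bullet> v)"
  define x where "x = z - of_int (round t) *\<^sub>R v"
  have "x \<in> L" unfolding x_def by (intro int_module.subspace_diff int_module.subspace_scale L z v)
  moreover have e: "rej v x = y" using rej_self[of v "of_int (round t)"] unfolding x_def z(2) linear_diff[OF linear_rej] by simp
  moreover have "x \<bullet> x \<le> y \<bullet> y + (v \<bullet> v) / 4"
  proof -
    have x: "x = y + (t - of_int (round t)) *\<^sub>R v" unfolding x_def z(2) rej_def t_def by (simp add: algebra_simps)
    have "v \<bullet> y = 0" unfolding z(2) by (rule rej_orth)
    then have "x \<bullet> x = y \<bullet> y + (t - of_int (round t))\<^sup>2 * (v \<bullet> v)"
      unfolding x by (simp add: inner_add_left inner_add_right inner_commute power2_eq_square)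
    moreover have "\<bar>t - of_int (round t)\<bar>\<^sup>2 \<le> (1/2)\<^sup>2"
      using of_int_round_abs_le[of t] by (intro power_mono) (auto simp: abs_minus_commute)
    then have "(t - of_int (round t))\<^sup>2 * (v \<bullet> v) \<le> 1/4 * (v \<bullet> v)"
      by (intro mult_right_mono) (simp_all add: power2_eq_square)
    ultimately show ?thesis by simp
  qed
  ultimately show ?thesis by (rule that)
qed

text \<open>Origin of the factor 3/4: the lift of y found by \<open>rej_lift\<close> has norm at
  least that of v and exceeds the norm of y by at most a quarter of it.\<close>

lemma rej_min:
  assumes L: "int_module.subspace L" and v: "v \<in> L" and m: "\<And>x. x \<in> L \<Longrightarrow> x \<noteq> 0 \<Longrightarrow> v \<bullet> v \<le> x \<bullet> x"
    and y: "y \<in> rej v ` L" "y \<noteq> 0"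
  shows "3/4 * (v \<bullet> v) \<le> y \<bullet> y"
proof -
  obtain x where x: "x \<in> L" "rej v x = y" "x \<bullet> x \<le> y \<bullet> y + (v \<bullet> v) / 4"
    using rej_lift[OF L v y(1)] .
  have "x \<noteq> 0" using x(2) y(2) linear_0[OF linear_rej[of v]] by auto
  from m[OF x(1) this] x(3) show ?thesis by simp
qed

text \<open>If t v lies in L, so does its difference to the nearest integral multiple of v; unless
  zero, it would be shorter than v.\<close>

lemma lbasis_line:
  assumes L: "int_module.subspace L" and v: "v \<in> L" "v \<noteq> 0" and m: "\<And>x. x \<in> L \<Longrightarrow> x \<noteq> 0 \<Longrightarrow> v \<bullet> v \<le> x \<bullet> x"
  shows "lbasis [v] (L \<inter> {y. rej v y = 0})"
proof (rule lbasisI)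
  show "free_list [v]" using v by (simp add: free_list_def)
  show "int_module.subspace (L \<inter> {y. rej v y = 0})"
    by (rule int_subspaceI) (auto simp: linear_0 linear_diff linear_rej int_module.subspace_0[OF L] intro: int_module.subspace_diff[OF L])
  show "set [v] \<subseteq> L \<inter> {y. rej v y = 0}" using v rej_self[of v 1] by simp
  fix x assume x: "x \<in> L \<inter> {y. rej v y = 0}"
  then obtain t where t: "x = t *\<^sub>R v" using rej_eq_0[of v x] by (auto simp: span_singleton)
  have "x - of_int (round t) *\<^sub>R v \<in> L" using x v by (intro int_module.subspace_diff int_module.subspace_scale L) auto
  then have i: "(t - of_int (round t)) *\<^sub>R v \<in> L" by (simp add: t algebra_simps)
  have "t - of_int (round t) = 0"
  proof (rule ccontr)
    assume "t - of_int (round t) \<noteq> 0"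
    with m[OF i] v(2) have "1 * (v \<bullet> v) \<le> (t - of_int (round t))\<^sup>2 * (v \<bullet> v)" by (simp add: power2_eq_square mult.assoc)
    then have "1 \<le> (t - of_int (round t))\<^sup>2" using v(2) by (meson inner_gt_zero_iff mult_le_cancel_right_pos)
    moreover have "\<bar>t - of_int (round t)\<bar>\<^sup>2 \<le> (1/2)\<^sup>2"
      using of_int_round_abs_le[of t] by (intro power_mono) (auto simp: abs_minus_commute)
    ultimately show False by (simp add: power2_eq_square)
  qed
  then have "x = lcomb [v] (\<lambda>j. of_int (round t))" using t by simp
  then show "\<exists>c::nat\<Rightarrow>int. x = lcomb [v] (\<lambda>j. of_int (c j))"
    by (rule exI[of _ "\<lambda>j. round t"])
qed

lemma dim_rej_less:
  fixes L :: "'v::euclidean_space set"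
  assumes v: "v \<in> L" "v \<noteq> 0" shows "dim (rej v ` L) < dim L"
proof -
  have sub: "span (rej v ` L) \<subseteq> span L"
  proof (rule span_minimal)
    show "rej v ` L \<subseteq> span L" using v unfolding rej_def by (auto intro: span_diff[OF span_base span_scale[OF span_base]])
  qed simp
  have "v \<notin> span (rej v ` L)"
  proof
    assume "v \<in> span (rej v ` L)"
    moreover have "span (rej v ` L) \<subseteq> {y. v \<bullet> y = 0}"
      by (rule span_minimal[OF _ subspace_hyperplane]) (auto simp: rej_orth)
    ultimately have "v \<bullet> v = 0" by blast
    then show False using v(2) by simp
  qed
  then have "span (rej v ` L) \<subset> span L" using sub v(1) span_base by blast
  then show ?thesis by (rule dim_psubset)
qed

text \<open>Lower bound for the determinant of an n-dimensional lattice with minimum at least a: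
  projecting along a minimal vector leaves dimension n - 1 and minimum at least 3/4 a. In closed
  form this is Hermite's a^n (3/4)^(n(n-1)/2).\<close>

primrec hermite_lower :: "nat \<Rightarrow> real \<Rightarrow> real" where
  "hermite_lower 0 a = 1"
| "hermite_lower (Suc n) a = a * hermite_lower n (3/4 * a)"

text \<open>Bound for the norms of a reduced basis, for determinant d. The norm of the minimal
  vector v is d divided by the determinant of the projected lattice, which gives the first summand.
  The second bounds the projected basis, whose determinant is at most d / a. Lifting adds a quarter
  of the norm of v, which the first summand absorbs.\<close>

primrec reduced_bound :: "nat \<Rightarrow> real \<Rightarrow> real \<Rightarrow> real" where
  "reduced_bound 0 a d = 0"
| "reduced_bound (Suc n) a d = d / hermite_lower n (3/4 * a) + reduced_bound n (3/4 * a) (d / a)"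

lemma hermite_lower_eq: "hermite_lower n a = a ^ n * hermite_lower n 1"
proof (induction n arbitrary: a)
  case (Suc n)
  have "hermite_lower (Suc n) a = a ^ Suc n * ((3/4) ^ n * hermite_lower n 1)"
    using Suc[of "3/4 * a"] by (simp only: hermite_lower.simps power_mult_distrib power_Suc mult_ac)
  also have "(3/4) ^ n * hermite_lower n 1 = hermite_lower (Suc n) 1"
    using Suc[of "3/4"] by simp
  finally show ?case .
qed simp

lemma hermite_lower_pos: "a > 0 \<Longrightarrow> hermite_lower n a > 0"
  by (induction n arbitrary: a) auto


lemma reduced_bound_mono: "a > 0 \<Longrightarrow> d \<le> d' \<Longrightarrow> reduced_bound n a d \<le> reduced_bound n a d'"
proof (induction n arbitrary: a d d')
  case (Suc n)
  have "d / hermite_lower n (3/4 * a) \<le> d' / hermite_lower n (3/4 * a)"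
    using hermite_lower_pos[of "3/4 * a" n] Suc.prems by (intro divide_right_mono) auto
  moreover have "reduced_bound n (3/4 * a) (d / a) \<le> reduced_bound n (3/4 * a) (d' / a)"
    using Suc.prems by (intro Suc.IH divide_right_mono) auto
  ultimately show ?case by simp
qed simp

lemma reduced_bound_nonneg: "a > 0 \<Longrightarrow> d \<ge> 0 \<Longrightarrow> 0 \<le> reduced_bound n a d"
proof (induction n arbitrary: a d)
  case (Suc n)
  then have "0 \<le> reduced_bound n (3/4 * a) (d / a)" by simp
  moreover have "0 \<le> d / hermite_lower n (3/4 * a)"
    using Suc.prems hermite_lower_pos[of "3/4 * a" n] by simp
  ultimately show ?case by simp
qed simp

text \<open>Hermite's reduction: a minimal vector, followed by short lifts of a reduced basis of the
  projection along it. The bounds depend only on the dimension, the minimum and the determinant, as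
  the later compactness argument requires.\<close>

lemma reduced_basis:
  fixes L :: "'v::euclidean_space set"
  assumes "int_module.subspace L" "a > 0" "\<forall>x\<in>L - {0}. a \<le> x \<bullet> x"
  shows "\<exists>bs. lbasis bs L \<and> hermite_lower (length bs) a \<le> gdet bs
    \<and> (\<forall>b\<in>set bs. b \<bullet> b \<le> reduced_bound (length bs) a (gdet bs))"
  using assms
proof (induction "dim L" arbitrary: L a rule: less_induct)
  case (less L a)
  show ?case
  proof (cases "L = {0}")
    case True
    then have "lbasis [] L" by (auto simp: lbasis_def free_list_def)
    then show ?thesis by (intro exI[of _ "[]"]) simp
  next
    case False
    obtain v where v: "v \<in> L" "v \<noteq> 0" and m: "\<And>x. x \<in> L \<Longrightarrow> x \<noteq> 0 \<Longrightarrow> v \<bullet> v \<le> x \<bullet> x"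
      using minimal_vector_exists[OF less.prems False] by metis
    have av: "a \<le> v \<bullet> v" using less.prems(3) v by blast
    let ?L = "rej v ` L" and ?a = "3/4 * a"
    have sub: "int_module.subspace ?L" by (rule int_subspace_image[OF linear_rej less.prems(1)])
    have min: "\<forall>y\<in>?L - {0}. ?a \<le> y \<bullet> y" using rej_min[OF less.prems(1) v(1) m] av by fastforce
    obtain cs' where cs': "lbasis cs' ?L" "hermite_lower (length cs') ?a \<le> gdet cs'"
      "\<forall>b\<in>set cs'. b \<bullet> b \<le> reduced_bound (length cs') ?a (gdet cs')"
      using less.hyps[OF dim_rej_less[OF v] sub _ min] less.prems(2) by auto
    have "\<forall>y. \<exists>x. y \<in> ?L \<longrightarrow> x \<in> L \<and> rej v x = y \<and> x \<bullet> x \<le> y \<bullet> y + (v \<bullet> v) / 4"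
      using rej_lift[OF less.prems(1) v(1)] by metis
    then obtain s where s: "\<And>y. y \<in> ?L \<Longrightarrow> s y \<in> L \<and> rej v (s y) = y \<and> s y \<bullet> s y \<le> y \<bullet> y + (v \<bullet> v) / 4" by metis
    define cs where "cs = map s cs'"
    have sL: "y \<in> ?L" if "y \<in> set cs'" for y using lbasis_subset[OF cs'(1)] that by blast
    have ms: "map (rej v) cs = cs'" unfolding cs_def using s[OF sL] by (simp add: map_idI)
    have b: "lbasis ([v] @ cs) L"
      using lbasis_line[OF less.prems(1) v m] cs'(1) s sL ms
      by (intro lbasis_lift[OF linear_rej less.prems(1)]) (auto simp: cs_def)
    have g: "gdet ([v] @ cs) = (v \<bullet> v) * gdet cs'" by (simp add: gdet_Cons ms)
    have len: "length ([v] @ cs) = Suc (length cs')" by (simp add: cs_def)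
    have hp: "hermite_lower (length cs') ?a > 0" using less.prems(2) by (intro hermite_lower_pos) simp
    have vp: "v \<bullet> v > 0" using v by simp
    have gp: "gdet cs' > 0" using hp cs'(2) by linarith
    have "hermite_lower (Suc (length cs')) a \<le> (v \<bullet> v) * gdet cs'"
      using av cs'(2) hp vp by (simp, intro mult_mono) auto
    moreover have "b \<bullet> b \<le> reduced_bound (Suc (length cs')) a ((v \<bullet> v) * gdet cs')" if bs: "b \<in> set ([v] @ cs)" for b
    proof -
      have V: "v \<bullet> v \<le> (v \<bullet> v) * gdet cs' / hermite_lower (length cs') ?a"
        using cs'(2) hp vp by (simp add: pos_le_divide_eq)
      have "gdet cs' \<le> (v \<bullet> v) * gdet cs' / a"
        using av less.prems(2) gp by (simp add: pos_le_divide_eq mult.commute)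
      then have B: "reduced_bound (length cs') ?a (gdet cs') \<le> reduced_bound (length cs') ?a ((v \<bullet> v) * gdet cs' / a)"
        using less.prems(2) by (intro reduced_bound_mono) auto
      show ?thesis
      proof (cases "b = v")
        case True
        then show ?thesis using V reduced_bound_nonneg[of ?a "(v \<bullet> v) * gdet cs' / a" "length cs'"] vp gp less.prems(2) by simp
      next
        case False
        then obtain y where y: "y \<in> set cs'" "b = s y" using bs by (auto simp: cs_def)
        have "b \<bullet> b \<le> y \<bullet> y + (v \<bullet> v) / 4" using s[OF sL[OF y(1)]] y(2) by simp
        moreover have "y \<bullet> y \<le> reduced_bound (length cs') ?a (gdet cs')" using cs'(3) y(1) by blast
        ultimately show ?thesis using V B vp unfolding reduced_bound.simps by linarith
      qed
    qed
    ultimately show ?thesis using b g len by (intro exI[of _ "[v] @ cs"]) simp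
  qed
qed

section \<open>Lattices as discrete subgroups and their determinants\<close>

lemma discrete_imp_is_lattice:
  fixes L :: "'v::euclidean_space set"
  assumes "int_module.subspace L" "a > 0" "\<forall>x\<in>L - {0}. a \<le> x \<bullet> x"
  shows "is_lattice L"
  using reduced_basis[OF assms] lbasis_imp_is_lattice by blast

lemma is_lattice_discrete:
  fixes L :: "'v::euclidean_space set"
  assumes "is_lattice L" obtains a where "a > 0" "\<forall>x\<in>L - {0}. a \<le> x \<bullet> x"
  using is_lattice_imp_lbasis[OF assms] lbasis_discrete by metis

lemma is_lattice_subset:
  fixes L :: "'v::euclidean_space set"
  assumes "is_lattice L" "int_module.subspace M" "M \<subseteq> L" shows "is_lattice M"
proof -
  obtain a where a: "a > 0" "\<forall>x\<in>L - {0}. a \<le> x \<bullet> x" by (rule is_lattice_discrete[OF assms(1)])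
  show ?thesis by (rule discrete_imp_is_lattice[OF assms(2) a(1)]) (use a(2) assms(3) in blast)
qed

text \<open>The transition matrix is integral with nonzero determinant, whose square is at least 1.
  Applied in both directions, this makes the Gram determinant independent of the basis.\<close>

lemma sublattice_gdet:
  assumes L: "lbasis bs L" and M: "lbasis cs M" and sub: "M \<subseteq> L" and len: "length cs = length bs"
  shows "gdet bs \<le> gdet cs"
proof -
  have "\<forall>i. \<exists>u::nat \<Rightarrow> int. i < length bs \<longrightarrow> cs ! i = lcomb bs (\<lambda>j. of_int (u j))"
    using L sub lbasis_subset[OF M] len unfolding lbasis_def by (auto simp: subset_iff)
  from choice[OF this] obtain U :: "nat \<Rightarrow> nat \<Rightarrow> int" where
    U: "\<And>i. i < length bs \<Longrightarrow> cs ! i = lcomb bs (\<lambda>j. of_int (U i j))" by auto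
  let ?n = "length bs"
  have "mat ?n ?n (\<lambda>(i, j). real_of_int (U i j)) = map_mat of_int (mat ?n ?n (\<lambda>(i, j). U i j))"
    by (rule eq_matI) auto
  then have g: "gdet cs = (of_int (Determinant.det (mat ?n ?n (\<lambda>(i, j). U i j))))\<^sup>2 * gdet bs" (is "_ = (of_int ?d)\<^sup>2 * _")
    using gdet_change[OF len U] by (simp add: of_int_hom.hom_det)
  have p: "gdet bs > 0" "gdet cs > 0" using L M by (auto simp: lbasis_def gdet_pos)
  then have "?d \<noteq> 0" using g by auto
  then have "1 \<le> ?d\<^sup>2" by (smt (verit) zero_less_power2)
  then have "1 \<le> (of_int ?d :: real)\<^sup>2" by (metis of_int_1 of_int_le_iff of_int_power)
  then show ?thesis using g p by (simp add: mult_le_cancel_right1)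
qed

lemma lattice_det_eq:
  fixes L :: "'v::euclidean_space set"
  assumes "lbasis bs L" shows "lattice_det L = gdet bs"
  unfolding lattice_det_def gdet_def[symmetric]
proof (rule the_equality)
  show "\<exists>bs'. int_basis bs' L \<and> gdet bs = gdet bs'" using lbasis_imp_int_basis[OF assms] by blast
  fix d assume "\<exists>cs. int_basis cs L \<and> d = gdet cs"
  then obtain cs where cs: "lbasis cs L" "d = gdet cs"
    using int_basis_imp_lbasis[OF lbasis_imp_is_lattice[OF assms]] by blast
  have "length cs = length bs" using lbasis_length[OF assms] lbasis_length[OF cs(1)] by simp
  then show "d = gdet bs"
    using sublattice_gdet[OF assms cs(1)] sublattice_gdet[OF cs(1) assms] cs(2) by simp
qed

lemma lattice_det_pos:
  fixes L :: "'v::euclidean_space set"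
  assumes "is_lattice L" shows "0 < lattice_det L"
  using is_lattice_imp_lbasis[OF assms] lattice_det_eq gdet_pos unfolding lbasis_def by metis

lemma lift_list:
  assumes "set cs' \<subseteq> p ` L" obtains cs where "set cs \<subseteq> L" "map p cs = cs'"
proof (rule that[of "map (inv_into L p) cs'"])
  show "set (map (inv_into L p) cs') \<subseteq> L" using assms by (auto intro: inv_into_into)
  show "map p (map (inv_into L p) cs') = cs'" using assms by (auto simp: subset_iff f_inv_into_f intro!: map_idI)
qed

text \<open>The hypotheses on S make p the orthogonal projection with kernel S. The determinant
  formula requires L to meet S in a lattice of full rank there.\<close>

lemma split_lattice:
  fixes L :: "'v::euclidean_space set"
  assumes L: "is_lattice L" and p: "linear p" and S: "subspace S" "\<And>y. y - p y \<in> S" "\<And>s y. s \<in> S \<Longrightarrow> s \<bullet> p y = 0"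
    and pL: "is_lattice (p ` L)"
  shows "dim L = dim (L \<inter> S) + dim (p ` L)"
    and "S \<subseteq> span (L \<inter> S) \<Longrightarrow> lattice_det L = lattice_det (L \<inter> S) * lattice_det (p ` L)"
proof -
  have subL: "int_module.subspace L" using L by (rule is_lattice_subspace)
  have "p y = 0 \<longleftrightarrow> y \<in> S" for y
  proof
    assume "y \<in> S"
    then have "y - (y - p y) \<in> S" by (intro subspace_diff S)
    then have "p y \<bullet> p y = 0" using S(3) by simp
    then show "p y = 0" by simp
  qed (use S(2)[of y] in simp)
  then have ker: "L \<inter> S = L \<inter> {y. p y = 0}" by blast
  have "int_module.subspace (L \<inter> S)"
    by (rule int_subspaceI) (auto intro: int_module.subspace_diff[OF subL] subspace_diff[OF S(1)]
        int_module.subspace_0[OF subL] subspace_0[OF S(1)])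
  then have "is_lattice (L \<inter> S)" by (rule is_lattice_subset[OF L]) blast
  then obtain bs where bs: "lbasis bs (L \<inter> S)" by (rule is_lattice_imp_lbasis)
  obtain cs' where cs': "lbasis cs' (p ` L)" using pL by (rule is_lattice_imp_lbasis)
  obtain cs where cs: "set cs \<subseteq> L" "map p cs = cs'" using lift_list[OF lbasis_subset[OF cs']] .
  have b: "lbasis (bs @ cs) L"
    using lbasis_lift[OF p subL] bs cs cs' unfolding ker by blast
  show "dim L = dim (L \<inter> S) + dim (p ` L)"
    using lbasis_length[OF b] lbasis_length[OF bs] lbasis_length[OF cs'] cs(2) by (metis length_append length_map)
  assume sp: "S \<subseteq> span (L \<inter> S)"
  have "gdet (bs @ cs) = gdet bs * gdet (map p cs)"
  proof (rule gdet_append)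
    show "cs ! j - p (cs ! j) \<in> span (set bs)" for j using S(2) sp lbasis_span[OF bs] by blast
    show "bs ! i \<bullet> p (cs ! j) = 0" if "i < length bs" for i j
      using S(3) lbasis_subset[OF bs] nth_mem[OF that] by blast
  qed
  then show "lattice_det L = lattice_det (L \<inter> S) * lattice_det (p ` L)"
    using lattice_det_eq[OF b] lattice_det_eq[OF bs] lattice_det_eq[OF cs'] cs(2) by simp
qed

subsection \<open>The Euclidean dual\<close>

lemma full_lbasis_iff:
  fixes L :: "'v::euclidean_space set"
  shows "is_lattice L \<and> span L = UNIV \<longleftrightarrow> (\<exists>bs. lbasis bs L \<and> length bs = DIM('v))"
proof
  assume a: "is_lattice L \<and> span L = UNIV"
  then obtain bs where bs: "lbasis bs L" using is_lattice_imp_lbasis by blast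
  have "dim L = DIM('v)" using a by (metis dim_UNIV dim_span)
  then show "\<exists>bs. lbasis bs L \<and> length bs = DIM('v)" using bs lbasis_length[OF bs] by auto
next
  assume "\<exists>bs. lbasis bs L \<and> length bs = DIM('v)"
  then obtain bs where bs: "lbasis bs L" "length bs = DIM('v)" by blast
  have "dim (span L) = DIM('v)" using lbasis_length[OF bs(1)] bs(2) by simp
  then have "span L = UNIV" by (metis dim_eq_full span_span)
  then show "is_lattice L \<and> span L = UNIV" using lbasis_imp_is_lattice[OF bs(1)] by blast
qed

lemma full_lattice_dim:
  fixes L :: "'v::euclidean_space set"
  shows "span L = UNIV \<Longrightarrow> dim L = DIM('v)"
  by (metis dim_UNIV dim_span)

definition zdual :: "'v::real_inner set \<Rightarrow> 'v set" where
  "zdual L = {y. \<forall>x\<in>L. y \<bullet> x \<in> \<int>}"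

lemma zdual_subspace: "int_module.subspace (zdual L)"
  by (rule int_subspaceI) (auto simp: zdual_def inner_diff_left)

lemma zdual_antimono: "L \<subseteq> M \<Longrightarrow> zdual M \<subseteq> zdual L"
  by (auto simp: zdual_def)

lemma zdual_lbasis:
  fixes L :: "'v::euclidean_space set"
  assumes b: "lbasis bs L" and len: "length bs = DIM('v)"
  obtains ds where "lbasis ds (zdual L)" "length ds = DIM('v)"
    "\<And>i j. i < length bs \<Longrightarrow> j < length bs \<Longrightarrow> bs ! i \<bullet> ds ! j = (if i = j then 1 else 0)"
proof -
  have f: "free_list bs" using b by (simp add: lbasis_def)
  obtain ds where l: "length ds = length bs" and
    ds: "\<And>i j. i < length bs \<Longrightarrow> j < length bs \<Longrightarrow> bs ! i \<bullet> ds ! j = (if i = j then 1 else 0)"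
    using dual_list[OF f] by blast
  have UNIV_bs: "range (lcomb bs) = UNIV"
    using full_lbasis_iff[of L] b len lbasis_span[OF b] span_eq_lcomb[of bs] by metis
  have ds': "ds ! i \<bullet> bs ! j = (if i = j then 1 else 0)" if "i < length bs" "j < length bs" for i j
    using ds[OF that(2,1)] by (auto simp: inner_commute)
  have dsb: "lcomb ds c \<bullet> bs ! j = c j" if "j < length bs" for c j
    using lcomb_inner_dual[of bs ds j c] ds' l that by simp
  have rep: "y = lcomb ds (\<lambda>j. y \<bullet> bs ! j)" for y
  proof -
    let ?z = "y - lcomb ds (\<lambda>j. y \<bullet> bs ! j)"
    obtain c where c: "?z = lcomb bs c" using UNIV_bs by blast
    have "bs ! j \<bullet> ?z = 0" if "j < length bs" for j
      using dsb[OF that] by (simp add: inner_diff_right inner_commute[of "bs ! j"])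
    then have "lcomb bs c \<bullet> ?z = 0" unfolding inner_lcomb by simp
    then have "?z \<bullet> ?z = 0" using c by simp
    then show ?thesis by simp
  qed
  have "lbasis ds (zdual L)"
  proof (rule lbasisI)
    show "free_list ds"
      unfolding free_list_def
    proof (intro allI impI)
      fix c j assume "lcomb ds c = 0" "j < length ds"
      with dsb[of j c] l show "c j = 0" by simp
    qed
    show "int_module.subspace (zdual L)" by (rule zdual_subspace)
    show "set ds \<subseteq> zdual L"
    proof
      fix d assume "d \<in> set ds"
      then obtain j where j: "j < length bs" "d = ds ! j" by (auto simp: in_set_conv_nth l)
      have "d \<bullet> x \<in> \<int>" if x: "x \<in> L" for x
      proof -
        obtain c :: "nat \<Rightarrow> int" where c: "x = lcomb bs (\<lambda>j. of_int (c j))" using lbasis_coords[OF b x] .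
        have "x \<bullet> ds ! j = of_int (c j)" unfolding c by (rule lcomb_inner_dual[OF l ds j(1)])
        then show ?thesis using j(2) by (simp add: inner_commute)
      qed
      then show "d \<in> zdual L" by (simp add: zdual_def)
    qed
    fix x assume x: "x \<in> zdual L"
    have "x \<bullet> bs ! j = of_int \<lfloor>x \<bullet> bs ! j\<rfloor>" if "j < length bs" for j
      using x lbasis_subset[OF b] nth_mem[OF that] unfolding zdual_def by (auto simp: subset_iff elim!: Ints_cases)
    then have "x = lcomb ds (\<lambda>j. of_int \<lfloor>x \<bullet> bs ! j\<rfloor>)"
      using rep[of x] l lcomb_cong[of ds "\<lambda>j. x \<bullet> bs ! j" "\<lambda>j. of_int \<lfloor>x \<bullet> bs ! j\<rfloor>"] by simp
    then show "\<exists>c::nat \<Rightarrow> int. x = lcomb ds (\<lambda>j. of_int (c j))"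
      by (rule exI[of _ "\<lambda>j. \<lfloor>x \<bullet> bs ! j\<rfloor>"])
  qed
  then show ?thesis using that l len ds by simp
qed

lemma zdual_full:
  fixes L :: "'v::euclidean_space set"
  assumes "is_lattice L" "span L = UNIV"
  shows "is_lattice (zdual L)" "span (zdual L) = UNIV" "lattice_det L * lattice_det (zdual L) = 1" "zdual (zdual L) = L"
proof -
  obtain bs where bs: "lbasis bs L" "length bs = DIM('v)" using full_lbasis_iff assms by blast
  obtain ds where ds: "lbasis ds (zdual L)" "length ds = DIM('v)" and
    d: "\<And>i j. i < length bs \<Longrightarrow> j < length bs \<Longrightarrow> bs ! i \<bullet> ds ! j = (if i = j then 1 else 0)"
    using zdual_lbasis[OF bs] by metis
  show "is_lattice (zdual L)" "span (zdual L) = UNIV"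
    using full_lbasis_iff[of "zdual L"] ds by auto
  obtain es where es: "lbasis es (zdual (zdual L))" "length es = DIM('v)" and
    e: "\<And>i j. i < length ds \<Longrightarrow> j < length ds \<Longrightarrow> ds ! i \<bullet> es ! j = (if i = j then 1 else 0)"
    using zdual_lbasis[OF ds] by metis
  have UNIV_ds: "range (lcomb ds) = UNIV"
    using full_lbasis_iff[of "zdual L"] ds lbasis_span[OF ds(1)] span_eq_lcomb[of ds] by metis
  have "es ! j = bs ! j" if j: "j < DIM('v)" for j
  proof -
    obtain c where c: "es ! j - bs ! j = lcomb ds c" using UNIV_ds by blast
    have "ds ! i \<bullet> (es ! j - bs ! j) = 0" if "i < length ds" for i
      using e[of i j] d[of j i] that j bs ds by (simp add: inner_diff_right inner_commute)
    then have "lcomb ds c \<bullet> (es ! j - bs ! j) = 0" unfolding inner_lcomb by simp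
    then have "(es ! j - bs ! j) \<bullet> (es ! j - bs ! j) = 0" using c by simp
    then show ?thesis by simp
  qed
  then have "es = bs" using bs es by (simp add: list_eq_iff_nth_eq)
  then show "zdual (zdual L) = L" using es bs by (simp add: lbasis_def)
  \<comment> \<open>The Gram matrix of bs is also the transition matrix from the dual basis to bs,
    so \<open>gdet_change\<close> relates the two determinants.\<close>
  have "bs ! i = lcomb ds (\<lambda>j. bs ! i \<bullet> bs ! j)" if "i < length ds" for i
  proof -
    obtain c where c: "bs ! i = lcomb ds c" using UNIV_ds by blast
    have "lcomb ds c \<bullet> bs ! j = c j" if "j < length ds" for j
      using lcomb_inner_dual[of bs ds j c] d bs ds that by (simp add: inner_commute eq_commute)
    then show ?thesis using c lcomb_cong[of ds c "\<lambda>j. bs ! i \<bullet> bs ! j"] by simp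
  qed
  then have "gdet bs = (gdet bs)\<^sup>2 * gdet ds"
    using gdet_change[of bs ds "\<lambda>i j. bs ! i \<bullet> bs ! j"] bs ds by (simp add: gdet_def[of bs])
  moreover have "gdet bs > 0" using bs by (simp add: lbasis_def gdet_pos)
  ultimately have "1 = gdet bs * gdet ds" by (simp add: power2_eq_square)
  then show "lattice_det L * lattice_det (zdual L) = 1"
    using lattice_det_eq[OF bs(1)] lattice_det_eq[OF ds(1)] by simp
qed

subsection \<open>Indices\<close>

text \<open>The group index, as a relation witnessed by a transversal; an infinite index needs no
  default value.\<close>

definition has_index :: "'v::real_vector set \<Rightarrow> 'v set \<Rightarrow> nat \<Rightarrow> bool" where
  "has_index L M k \<longleftrightarrow> (\<exists>T. finite T \<and> card T = k \<and> T \<subseteq> L \<and>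
     (\<forall>x\<in>L. \<exists>t\<in>T. x - t \<in> M) \<and> (\<forall>s\<in>T. \<forall>t\<in>T. s - t \<in> M \<longrightarrow> s = t))"

lemma has_indexE:
  assumes "has_index L M k"
  obtains T where "finite T" "card T = k" "T \<subseteq> L" "\<forall>x\<in>L. \<exists>t\<in>T. x - t \<in> M"
    "\<forall>s\<in>T. \<forall>t\<in>T. s - t \<in> M \<longrightarrow> s = t"
  using assms unfolding has_index_def by blast

lemma has_index_le:
  assumes M: "int_module.subspace M" and k: "has_index L M k" and l: "has_index L M l"
  shows "k \<le> l"
proof -
  obtain T where T': "finite T" "card T = k" "T \<subseteq> L" "\<forall>x\<in>L. \<exists>t\<in>T. x - t \<in> M"
    "\<forall>s\<in>T. \<forall>t\<in>T. s - t \<in> M \<longrightarrow> s = t"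
    using k by (rule has_indexE)
  note T = T'(1-3) T'(4,5)[rule_format]
  obtain U where U': "finite U" "card U = l" "U \<subseteq> L" "\<forall>x\<in>L. \<exists>t\<in>U. x - t \<in> M"
    "\<forall>s\<in>U. \<forall>t\<in>U. s - t \<in> M \<longrightarrow> s = t"
    using l by (rule has_indexE)
  note U = U'(1-3) U'(4,5)[rule_format]
  have "\<forall>t. \<exists>u. t \<in> T \<longrightarrow> u \<in> U \<and> t - u \<in> M" using U(4) T(3) by blast
  from choice[OF this] obtain f where f: "\<And>t. t \<in> T \<Longrightarrow> f t \<in> U \<and> t - f t \<in> M" by blast
  have "inj_on f T"
  proof (rule inj_onI)
    fix s t assume st: "s \<in> T" "t \<in> T" "f s = f t"
    have "(s - f s) - (t - f t) \<in> M" using f[OF st(1)] f[OF st(2)] int_module.subspace_diff[OF M] by blast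
    then have "s - t \<in> M" using st by simp
    then show "s = t" by (rule T(5)[OF st(1,2)])
  qed
  then have "card T \<le> card U" using f U(1) by (intro card_inj_on_le[of f]) auto
  then show ?thesis using T U by simp
qed

lemma has_index_unique:
  "int_module.subspace M \<Longrightarrow> has_index L M k \<Longrightarrow> has_index L M l \<Longrightarrow> k = l"
  by (intro le_antisym has_index_le)

lemma has_index_1_eq:
  assumes M: "int_module.subspace M" "M \<subseteq> L" and L: "int_module.subspace L" and "has_index L M 1"
  shows "M = L"
proof -
  obtain T where T': "finite T" "card T = 1" "T \<subseteq> L" "\<forall>x\<in>L. \<exists>t\<in>T. x - t \<in> M"
    "\<forall>s\<in>T. \<forall>t\<in>T. s - t \<in> M \<longrightarrow> s = t"
    using assms(4) by (rule has_indexE)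
  note T = T'(1-3) T'(4,5)[rule_format]
  obtain t where t: "T = {t}" using T(2) by (auto simp: card_1_singleton_iff)
  have "0 - t \<in> M" using T(4)[of 0] int_module.subspace_0[OF L] t by auto
  have "x \<in> M" if "x \<in> L" for x
  proof -
    have "x - t \<in> M" using T(4)[OF that] t by auto
    then have "(x - t) - (0 - t) \<in> M" using \<open>0 - t \<in> M\<close> int_module.subspace_diff[OF M(1)] by blast
    then show ?thesis by simp
  qed
  then show ?thesis using M(2) by blast
qed

lemma det_rej:
  fixes L :: "'v::euclidean_space set"
  assumes L: "is_lattice L" and w: "lbasis [c *\<^sub>R v] (L \<inter> {y. rej v y = 0})" and r: "is_lattice (rej v ` L)"
  shows "lattice_det L = c\<^sup>2 * (v \<bullet> v) * lattice_det (rej v ` L)"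
proof -
  obtain cs' where cs': "lbasis cs' (rej v ` L)" using r by (rule is_lattice_imp_lbasis)
  obtain cs where cs: "set cs \<subseteq> L" "map (rej v) cs = cs'" using lift_list[OF lbasis_subset[OF cs']] .
  have b: "lbasis ([c *\<^sub>R v] @ cs) L"
    using lbasis_lift[OF linear_rej is_lattice_subspace[OF L] w] cs cs' by blast
  have "c \<noteq> 0" using w unfolding lbasis_def free_list_def by fastforce
  have "gdet ([c *\<^sub>R v] @ cs) = gdet [c *\<^sub>R v] * gdet (map (rej v) cs)"
  proof (rule gdet_append)
    fix j
    have "cs ! j - rej v (cs ! j) = ((cs ! j \<bullet> v) / (v \<bullet> v) / c) *\<^sub>R (c *\<^sub>R v)"
      using \<open>c \<noteq> 0\<close> by (simp add: rej_def)
    then show "cs ! j - rej v (cs ! j) \<in> span (set [c *\<^sub>R v])"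
      by (metis list.set_intros(1) span_base span_scale)
  qed (simp add: rej_orth)
  moreover have "gdet [c *\<^sub>R v] = c\<^sup>2 * (v \<bullet> v)" by (simp add: gdet_Cons power2_eq_square)
  ultimately show ?thesis using lattice_det_eq[OF b] lattice_det_eq[OF cs'] cs(2) by simp
qed

text \<open>Induction along a minimal vector v of L. The multiples of v in M are those of k v, which
  contributes k to the index and k^2 to the ratio of determinants; the projections along v fall
  under the induction hypothesis.\<close>

lemma index_det:
  fixes L M :: "'v::euclidean_space set"
  assumes "is_lattice L" "int_module.subspace M" "M \<subseteq> L" "d \<ge> 1" "\<And>x. x \<in> L \<Longrightarrow> real d *\<^sub>R x \<in> M"
  shows "\<exists>k\<ge>1. has_index L M k \<and> lattice_det M = (real k)\<^sup>2 * lattice_det L"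
  using assms
proof (induction "dim L" arbitrary: L M rule: less_induct)
  case (less L M)
  have L: "int_module.subspace L" by (rule is_lattice_subspace[OF less.prems(1)])
  note M = less.prems(2)
  show ?case
  proof (cases "L = {0}")
    case True
    then have "M = {0}" using less.prems(3) int_module.subspace_0[OF M] by blast
    then have "has_index L M 1" unfolding has_index_def using True by (intro exI[of _ "{0}"]) auto
    then show ?thesis using True \<open>M = {0}\<close> by (intro exI[of _ 1]) simp
  next
    case False
    obtain a where a: "a > 0" "\<forall>x\<in>L - {0}. a \<le> x \<bullet> x" by (rule is_lattice_discrete[OF less.prems(1)])
    obtain v where v: "v \<in> L" "v \<noteq> 0" and m: "\<And>x. x \<in> L \<Longrightarrow> x \<noteq> 0 \<Longrightarrow> v \<bullet> v \<le> x \<bullet> x"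
      using minimal_vector_exists[OF L a False] by metis
    let ?p = "rej v"
    have pL: "is_lattice (?p ` L)"
    proof (rule discrete_imp_is_lattice)
      show "int_module.subspace (?p ` L)" by (rule int_subspace_image[OF linear_rej L])
      show "0 < 3/4 * (v \<bullet> v)" using v by simp
      show "\<forall>x\<in>?p ` L - {0}. 3/4 * (v \<bullet> v) \<le> x \<bullet> x" using rej_min[OF L v(1) m] by blast
    qed
    have pM: "int_module.subspace (?p ` M)" by (rule int_subspace_image[OF linear_rej M])
    have pML: "?p ` M \<subseteq> ?p ` L" using less.prems(3) by blast
    have pd: "real d *\<^sub>R y \<in> ?p ` M" if y: "y \<in> ?p ` L" for y
    proof -
      obtain x where x: "x \<in> L" "y = ?p x" using y by blast
      then have "real d *\<^sub>R y = ?p (real d *\<^sub>R x)" by (simp add: linear_cmul[OF linear_rej])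
      then show ?thesis using less.prems(5)[OF x(1)] by blast
    qed
    obtain l where l: "l \<ge> 1" "has_index (?p ` L) (?p ` M) l" "lattice_det (?p ` M) = (real l)\<^sup>2 * lattice_det (?p ` L)"
      using less.hyps[OF dim_rej_less[OF v] pL pM pML less.prems(4) pd] by blast
    obtain T where T': "finite T" "card T = l" "T \<subseteq> ?p ` L" "\<forall>x\<in>?p ` L. \<exists>t\<in>T. x - t \<in> ?p ` M"
      "\<forall>s\<in>T. \<forall>t\<in>T. s - t \<in> ?p ` M \<longrightarrow> s = t"
      using l(2) by (rule has_indexE)
    note T = T'(1-3) T'(4,5)[rule_format]
    define k where "k = (LEAST k. k \<ge> 1 \<and> real k *\<^sub>R v \<in> M)"
    have "\<exists>k. k \<ge> 1 \<and> real k *\<^sub>R v \<in> M" using less.prems(4,5) v(1) by blast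
    from LeastI_ex[OF this] have k: "k \<ge> 1" "real k *\<^sub>R v \<in> M" unfolding k_def by auto
    have kleast: "j = 0" if "real j *\<^sub>R v \<in> M" "j < k" for j
      using not_less_Least[of j "\<lambda>k. k \<ge> 1 \<and> real k *\<^sub>R v \<in> M"] that unfolding k_def by (cases j) auto
    have kdvd: "int k dvd i" if "of_int i *\<^sub>R v \<in> M" for i
    proof -
      have "of_int i *\<^sub>R v - of_int (i div int k) *\<^sub>R (real k *\<^sub>R v) \<in> M"
        by (intro int_module.subspace_diff int_module.subspace_scale M that k)
      moreover have "of_int i = of_int (i div int k) * real k + of_int (i mod int k)"
        by (metis div_mult_mod_eq of_int_add of_int_mult of_int_of_nat_eq)
      ultimately have "real (nat (i mod int k)) *\<^sub>R v \<in> M" using k(1) by (simp add: algebra_simps)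
      moreover have "nat (i mod int k) < k" using k(1) by (simp add: nat_less_iff)
      ultimately have "nat (i mod int k) = 0" by (rule kleast)
      moreover have "0 \<le> i mod int k" using k(1) by simp
      ultimately have "i mod int k = 0" by linarith
      then show ?thesis by (simp add: dvd_eq_mod_eq_0)
    qed
    have line: "\<exists>i::int. x = of_int i *\<^sub>R v" if x: "x \<in> L" "?p x = 0" for x
    proof -
      obtain c :: "nat \<Rightarrow> int" where "x = lcomb [v] (\<lambda>j. of_int (c j))"
        using lbasis_coords[OF lbasis_line[OF L v m], of x] x by blast
      then show ?thesis by auto
    qed
    have lineM: "lbasis [real k *\<^sub>R v] (M \<inter> {y. ?p y = 0})"
    proof (rule lbasisI)
      show "free_list [real k *\<^sub>R v]" using v k by (simp add: free_list_def)
      show "int_module.subspace (M \<inter> {y. ?p y = 0})"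
        by (rule int_subspaceI) (auto simp: linear_0 linear_diff linear_rej int_module.subspace_0[OF M] intro: int_module.subspace_diff[OF M])
      show "set [real k *\<^sub>R v] \<subseteq> M \<inter> {y. ?p y = 0}" using k rej_self by simp
      fix x assume x: "x \<in> M \<inter> {y. ?p y = 0}"
      then obtain i where i: "x = of_int i *\<^sub>R v" using line less.prems(3) by blast
      then obtain j where "i = int k * j" using kdvd x by blast
      then have "x = lcomb [real k *\<^sub>R v] (\<lambda>_. of_int j)" using i by (simp add: mult.commute)
      then show "\<exists>c::nat\<Rightarrow>int. x = lcomb [real k *\<^sub>R v] (\<lambda>j. of_int (c j))" by (rule exI[of _ "\<lambda>_. j"])
    qed
    have dL: "lattice_det L = 1\<^sup>2 * (v \<bullet> v) * lattice_det (?p ` L)"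
      using lbasis_line[OF L v m] by (intro det_rej less.prems(1) pL) simp
    have dM: "lattice_det M = (real k)\<^sup>2 * (v \<bullet> v) * lattice_det (?p ` M)"
      by (rule det_rej[OF is_lattice_subset[OF less.prems(1-3)] lineM is_lattice_subset[OF pL pM pML]])
    have "\<forall>t. \<exists>x. t \<in> T \<longrightarrow> x \<in> L \<and> ?p x = t" using T(3) by blast
    from choice[OF this] obtain s where s: "\<And>t. t \<in> T \<Longrightarrow> s t \<in> L \<and> ?p (s t) = t" by blast
    \<comment> \<open>Representatives of L modulo M: a lift of each representative of the
      projection, shifted by j v with j < k.\<close>
    define f where "f = (\<lambda>(t, j). s t + real j *\<^sub>R v)"
    have pf: "?p (f (t, j)) = t" if "t \<in> T" for t j
      using s[OF that] rej_self by (simp add: f_def linear_add[OF linear_rej])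
    have fL: "f (t, j) \<in> L" if "t \<in> T" for t j
      using s[OF that] int_module.subspace_scale[OF L v(1), of "int j"] unfolding f_def
      by (auto intro: int_module.subspace_add[OF L])
    have uniq: "t = t' \<and> i = j" if "t \<in> T" "t' \<in> T" "i < k" "j < k" "f (t, i) - f (t', j) \<in> M" for t t' i j
    proof -
      have "?p (f (t, i) - f (t', j)) \<in> ?p ` M" using that(5) by blast
      then have "t - t' \<in> ?p ` M" using pf that(1,2) by (simp add: linear_diff[OF linear_rej])
      then have tt: "t = t'" by (rule T(5)[OF that(1,2)])
      have "of_int (int i - int j) *\<^sub>R v \<in> M" using that(5) tt by (simp add: f_def algebra_simps)
      then have "int k dvd int i - int j" by (rule kdvd)
      then have "int i mod int k = int j mod int k" by (simp add: mod_eq_dvd_iff)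
      then have "i = j" using that(3,4) by simp
      with tt show ?thesis by simp
    qed
    have inj: "inj_on f (T \<times> {..<k})"
    proof (rule inj_onI)
      fix x y assume xy: "x \<in> T \<times> {..<k}" "y \<in> T \<times> {..<k}" "f x = f y"
      have "f x - f y \<in> M" using int_module.subspace_0[OF M] xy(3) by simp
      then show "x = y" using uniq[of "fst x" "fst y" "snd x" "snd y"] xy by auto
    qed
    have "has_index L M (l * k)"
      unfolding has_index_def
    proof (intro exI[of _ "f ` (T \<times> {..<k})"] conjI ballI)
      show "finite (f ` (T \<times> {..<k}))" using T(1) by simp
      show "card (f ` (T \<times> {..<k})) = l * k" using T(2) by (simp add: card_image[OF inj] card_cartesian_product)
      show "f ` (T \<times> {..<k}) \<subseteq> L" using fL by auto
      fix x assume x: "x \<in> L"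
      obtain t where t: "t \<in> T" "?p x - t \<in> ?p ` M" using T(4) x by blast
      then obtain y where y: "y \<in> M" "?p x - t = ?p y" by blast
      have "x - s t - y \<in> L" using x s[OF t(1)] y(1) less.prems(3) by (auto intro!: int_module.subspace_diff[OF L])
      moreover have "?p (x - s t - y) = 0" using y(2) s[OF t(1)] by (simp add: linear_diff[OF linear_rej])
      ultimately obtain i where i: "x - s t - y = of_int i *\<^sub>R v" using line by blast
      define j where "j = nat (i mod int k)"
      have j: "j < k" "int j = i mod int k" using k(1) by (simp_all add: j_def nat_less_iff)
      have ij: "of_int i = real j + of_int (i div int k) * real k"
        by (metis j(2) add.commute div_mult_mod_eq of_int_add of_int_mult of_int_of_nat_eq)
      have "x - f (t, j) = y + of_int (i div int k) *\<^sub>R (real k *\<^sub>R v)"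
        using i unfolding ij by (simp add: f_def algebra_simps)
      also have "\<dots> \<in> M" by (intro int_module.subspace_add int_module.subspace_scale M y k)
      finally have xM: "x - f (t, j) \<in> M" .
      show "\<exists>z\<in>f ` (T \<times> {..<k}). x - z \<in> M"
        using t(1) j(1) xM by (intro bexI[of _ "f (t, j)"]) auto
    next
      fix x y assume "x \<in> f ` (T \<times> {..<k})" "y \<in> f ` (T \<times> {..<k})"
      then show "x - y \<in> M \<longrightarrow> x = y" using uniq by auto
    qed
    moreover have "lattice_det M = (real (l * k))\<^sup>2 * lattice_det L"
      unfolding dM dL l(3) by (simp add: power_mult_distrib mult_ac)
    moreover have "l * k \<ge> 1" using l(1) k(1) by simp
    ultimately show ?thesis by blast
  qed
qed

text \<open>Pigeonhole: reducing the multiples n x modulo a basis of M leaves remainders in a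
  bounded, hence finite, part of L. Two of them coincide, and the difference of the two multiples of
  x lies in M.\<close>

lemma commensurable:
  fixes L M :: "'v::euclidean_space set"
  assumes L: "is_lattice L" and M: "is_lattice M" and sub: "M \<subseteq> L" and sp: "span M = span L"
  obtains d where "d \<ge> 1" "\<And>x. x \<in> L \<Longrightarrow> real d *\<^sub>R x \<in> M"
proof -
  have sL: "int_module.subspace L" and sM: "int_module.subspace M" using L M by (auto intro: is_lattice_subspace)
  obtain bs where bs: "lbasis bs M" using M by (rule is_lattice_imp_lbasis)
  obtain a where a: "a > 0" "\<forall>x\<in>L - {0}. a \<le> x \<bullet> x" by (rule is_lattice_discrete[OF L])
  have one: "\<exists>d\<ge>1. real d *\<^sub>R x \<in> M" if x: "x \<in> L" for x
  proof -
    have "x \<in> span (set bs)" using x sp lbasis_span[OF bs] span_base by blast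
    then obtain c where c: "x = lcomb bs c" unfolding span_eq_lcomb by blast
    define R where "R = (\<Sum>j<length bs. norm (bs ! j))"
    define g where "g n = real n *\<^sub>R x - lcomb bs (\<lambda>j. of_int \<lfloor>real n * c j\<rfloor>)" for n :: nat
    have gL: "g n \<in> L" for n
    proof -
      have "of_int (int n) *\<^sub>R x \<in> L" by (rule int_module.subspace_scale[OF sL x])
      moreover have "lcomb bs (\<lambda>j. of_int \<lfloor>real n * c j\<rfloor>) \<in> M" by (rule lcomb_int_mem[OF sM lbasis_subset[OF bs]])
      ultimately show ?thesis unfolding g_def using sub by (auto intro!: int_module.subspace_diff[OF sL])
    qed
    have gn: "norm (g n) \<le> R" for n
    proof -
      have "g n = lcomb bs (\<lambda>j. real n * c j - of_int \<lfloor>real n * c j\<rfloor>)" unfolding g_def c lcomb_scale lcomb_diff ..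
      also have "norm \<dots> \<le> (\<Sum>j<length bs. norm ((real n * c j - of_int \<lfloor>real n * c j\<rfloor>) *\<^sub>R bs ! j))"
        unfolding lcomb_def by (rule norm_sum)
      also have "\<dots> \<le> R"
        unfolding R_def
      proof (rule sum_mono)
        fix j
        have "\<bar>real n * c j - of_int \<lfloor>real n * c j\<rfloor>\<bar> \<le> 1" by linarith
        then show "norm ((real n * c j - of_int \<lfloor>real n * c j\<rfloor>) *\<^sub>R bs ! j) \<le> norm (bs ! j)"
          by (simp add: mult_left_le_one_le)
      qed
      finally show ?thesis .
    qed
    have "g n \<in> {x \<in> L. x \<bullet> x \<le> R\<^sup>2}" for n
      using gL gn[of n] power_mono[OF gn[of n], of 2] by (simp add: power2_norm_eq_inner)
    then have "finite (range g)"
      using finite_bounded_part[OF sL a, of "R\<^sup>2"] by (meson finite_subset image_subsetI)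
    then have "\<not> inj g" using finite_imageD[of g UNIV] by auto
    then obtain i j where ij: "i \<noteq> j" "g i = g j" unfolding inj_def by blast
    define A where "A = max i j" define B where "B = min i j"
    have AB: "A > B" "g A = g B" using ij by (auto simp: A_def B_def max_def min_def)
    have "real (A - B) *\<^sub>R x = lcomb bs (\<lambda>j. of_int \<lfloor>real A * c j\<rfloor>) - lcomb bs (\<lambda>j. of_int \<lfloor>real B * c j\<rfloor>)"
      using AB unfolding g_def by (simp add: of_nat_diff algebra_simps)
    also have "\<dots> \<in> M" by (intro int_module.subspace_diff lcomb_int_mem sM lbasis_subset[OF bs])
    finally show ?thesis using AB(1) by (intro exI[of _ "A - B"]) auto
  qed
  obtain cs where cs: "lbasis cs L" using L by (rule is_lattice_imp_lbasis)
  have "\<forall>x. \<exists>d. x \<in> L \<longrightarrow> d \<ge> 1 \<and> real d *\<^sub>R x \<in> M" using one by blast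
  from choice[OF this] obtain D where D: "\<And>x. x \<in> L \<Longrightarrow> D x \<ge> 1 \<and> real (D x) *\<^sub>R x \<in> M" by blast
  \<comment> \<open>A product of denominators of the basis vectors serves all of L.\<close>
  define d where "d = (\<Prod>j<length cs. D (cs ! j))"
  have csL: "cs ! j \<in> L" if "j < length cs" for j using lbasis_subset[OF cs] nth_mem[OF that] by blast
  have "d \<ge> 1" using D[OF csL] by (simp add: d_def Suc_le_eq prod_pos)
  moreover have "real d *\<^sub>R x \<in> M" if x: "x \<in> L" for x
  proof -
    obtain c :: "nat \<Rightarrow> int" where c: "x = lcomb cs (\<lambda>j. of_int (c j))" using lbasis_coords[OF cs x] .
    have "(real d * of_int (c j)) *\<^sub>R cs ! j \<in> M" if j: "j < length cs" for j
    proof -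
      have "D (cs ! j) dvd d" unfolding d_def using j by (intro dvd_prodI) auto
      then obtain e where e: "d = D (cs ! j) * e" by blast
      have "of_int (int e * c j) *\<^sub>R (real (D (cs ! j)) *\<^sub>R cs ! j) \<in> M"
        using D[OF csL[OF j]] by (intro int_module.subspace_scale[OF sM]) auto
      then show ?thesis by (simp add: e mult_ac)
    qed
    then show ?thesis unfolding c lcomb_scale unfolding lcomb_def by (intro int_module.subspace_sum[OF sM]) auto
  qed
  ultimately show ?thesis by (rule that)
qed

subsection \<open>Isometries and homotheties\<close>

lemma lbasis_image:
  assumes g: "linear g" "inj g" and b: "lbasis bs L" shows "lbasis (map g bs) (g ` L)"
  unfolding lbasis_def
proof
  show "free_list (map g bs)"
    unfolding free_list_def
  proof (intro allI impI)
    fix c j assume z: "lcomb (map g bs) c = 0" and j: "j < length (map g bs)"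
    have "g (lcomb bs c) = g 0" using z by (simp add: linear_lcomb[OF g(1)] linear_0[OF g(1)])
    then have "lcomb bs c = 0" using g(2) by (simp add: inj_eq)
    then show "c j = 0" using b j unfolding lbasis_def free_list_def by simp
  qed
  show "g ` L = range (\<lambda>c::nat \<Rightarrow> int. lcomb (map g bs) (\<lambda>j. of_int (c j)))"
    using b unfolding lbasis_def linear_lcomb[OF g(1), symmetric] by (simp add: image_image)
qed

lemma gdet_isometry: "(\<And>x y. g x \<bullet> g y = x \<bullet> y) \<Longrightarrow> gdet (map g bs) = gdet bs"
  unfolding gdet_def by (rule arg_cong[of _ _ Determinant.det], rule eq_matI) auto

lemma isometry_inj:
  fixes g :: "'v::real_inner \<Rightarrow> 'w::real_inner"
  assumes "linear g" "\<And>x y. g x \<bullet> g y = x \<bullet> y" shows "inj g"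
proof (rule injI)
  fix x y assume "g x = g y"
  then have "g (x - y) \<bullet> g (x - y) = 0" by (simp add: linear_diff[OF assms(1)])
  then show "x = y" by (simp add: assms(2))
qed

context
  fixes g :: "'v::euclidean_space \<Rightarrow> 'w::euclidean_space"
  assumes lin: "linear g" and iso: "\<And>x y. g x \<bullet> g y = x \<bullet> y"
begin

lemma is_lattice_isometry_image: "is_lattice L \<Longrightarrow> is_lattice (g ` L)"
  by (meson is_lattice_imp_lbasis lbasis_image[OF lin isometry_inj[OF lin iso]] lbasis_imp_is_lattice)

lemma lattice_det_isometry_image: "is_lattice L \<Longrightarrow> lattice_det (g ` L) = lattice_det L"
  by (metis is_lattice_imp_lbasis lattice_det_eq lbasis_image[OF lin isometry_inj[OF lin iso]] gdet_isometry[of g, OF iso])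

lemma dim_isometry_image: "dim (g ` L) = dim L"
  by (rule dim_image_eq[OF lin]) (use isometry_inj[OF lin iso] in \<open>auto intro: inj_on_subset\<close>)

lemma min_norm_isometry_image: "min_norm (g ` L) = min_norm L"
proof -
  have "g ` L - {0} = g ` (L - {0})"
    using isometry_inj[OF lin iso] linear_0[OF lin] by (auto simp: inj_eq) (metis inj_eq)
  then show ?thesis unfolding min_norm_def by (simp add: image_image iso)
qed

lemma hermite_invariant_isometry_image: "is_lattice L \<Longrightarrow> hermite_invariant (g ` L) = hermite_invariant L"
  by (simp add: hermite_invariant_def min_norm_isometry_image lattice_det_isometry_image dim_isometry_image)

end

lemma is_lattice_isometry_vimage:
  fixes g :: "'v::euclidean_space \<Rightarrow> 'w::euclidean_space"
  assumes lin: "linear g" and iso: "\<And>x y. g x \<bullet> g y = x \<bullet> y" and L: "is_lattice L"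
  shows "is_lattice (g -` L)"
proof -
  obtain a where a: "a > 0" "\<forall>x\<in>L - {0}. a \<le> x \<bullet> x" by (rule is_lattice_discrete[OF L])
  note sL = is_lattice_subspace[OF L]
  show ?thesis
  proof (rule discrete_imp_is_lattice[OF _ a(1)])
    show "int_module.subspace (g -` L)"
      by (rule int_subspaceI) (auto simp: linear_0[OF lin] linear_diff[OF lin] int_module.subspace_0[OF sL] int_module.subspace_diff[OF sL])
    show "\<forall>x\<in>g -` L - {0}. a \<le> x \<bullet> x"
    proof
      fix x assume x: "x \<in> g -` L - {0}"
      then have "g x \<bullet> g x \<noteq> 0" by (simp add: iso)
      then have "g x \<in> L - {0}" using x by auto
      then have "a \<le> g x \<bullet> g x" using a(2) by blast
      then show "a \<le> x \<bullet> x" by (simp add: iso)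
    qed
  qed
qed

lemma
  fixes L :: "'v::euclidean_space set"
  assumes t: "t \<noteq> 0" and L: "is_lattice L"
  shows is_lattice_scale: "is_lattice ((*\<^sub>R) t ` L)"
    and lattice_det_scale: "lattice_det ((*\<^sub>R) t ` L) = (t\<^sup>2) ^ dim L * lattice_det L"
    and dim_scale: "dim ((*\<^sub>R) t ` L) = dim L"
proof -
  have inj: "inj ((*\<^sub>R) t :: 'v \<Rightarrow> 'v)" using t by (simp add: inj_def)
  obtain bs where bs: "lbasis bs L" using L by (rule is_lattice_imp_lbasis)
  let ?n = "length bs"
  have b: "lbasis (map ((*\<^sub>R) t) bs) ((*\<^sub>R) t ` L)"
    by (rule lbasis_image[OF linear_scale_self inj bs])
  then show "is_lattice ((*\<^sub>R) t ` L)" by (rule lbasis_imp_is_lattice)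
  show "dim ((*\<^sub>R) t ` L) = dim L" using lbasis_length[OF b] lbasis_length[OF bs] by simp
  have "gdet (map ((*\<^sub>R) t) bs) = (Determinant.det (mat ?n ?n (\<lambda>(i, j). if j = i then t else 0)))\<^sup>2 * gdet bs"
  proof (rule gdet_change)
    fix i assume i: "i < ?n"
    have "lcomb bs (\<lambda>j. if j = i then t else 0) = lcomb bs (\<lambda>j. t * (if j = i then 1 else 0))"
      by (intro lcomb_cong) simp
    then show "map ((*\<^sub>R) t) bs ! i = lcomb bs (\<lambda>j. if j = i then t else 0)"
      unfolding lcomb_scale[symmetric] lcomb_unit[OF i] using i by simp
  qed simp
  also have "mat ?n ?n (\<lambda>(i, j). if j = i then t else 0) = t \<cdot>\<^sub>m 1\<^sub>m ?n" by (rule eq_matI) auto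
  also have "Determinant.det \<dots> = t ^ ?n" by simp
  finally show "lattice_det ((*\<^sub>R) t ` L) = (t\<^sup>2) ^ dim L * lattice_det L"
    using lattice_det_eq[OF b] lattice_det_eq[OF bs] lbasis_length[OF bs]
    by (simp add: power_mult[symmetric] mult.commute)
qed

subsection \<open>Minimum and Hermite invariant\<close>

lemma min_norm_le: "x \<in> L \<Longrightarrow> x \<noteq> 0 \<Longrightarrow> min_norm L \<le> x \<bullet> x"
  unfolding min_norm_def by (rule cINF_lower) (auto intro!: bdd_belowI2[of _ 0])

lemma min_norm_ge: "L - {0} \<noteq> {} \<Longrightarrow> (\<And>x. x \<in> L \<Longrightarrow> x \<noteq> 0 \<Longrightarrow> a \<le> x \<bullet> x) \<Longrightarrow> a \<le> min_norm L"
  unfolding min_norm_def by (rule cINF_greatest) auto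

lemma minimal_vectors_nonempty:
  fixes L :: "'v::euclidean_space set"
  assumes "is_lattice L" "L \<noteq> {0}" obtains v where "v \<in> minimal_vectors L"
proof -
  note s = is_lattice_subspace[OF assms(1)]
  obtain a where a: "a > 0" "\<forall>x\<in>L - {0}. a \<le> x \<bullet> x" by (rule is_lattice_discrete[OF assms(1)])
  obtain v where v: "v \<in> L" "v \<noteq> 0" "\<And>x. x \<in> L \<Longrightarrow> x \<noteq> 0 \<Longrightarrow> v \<bullet> v \<le> x \<bullet> x"
    using minimal_vector_exists[OF s a assms(2)] by metis
  have "v \<bullet> v = min_norm L"
    by (rule antisym[OF min_norm_ge min_norm_le]) (use v in auto)
  then show ?thesis using v that[of v] by (simp add: minimal_vectors_def)
qed

lemma min_norm_pos:
  fixes L :: "'v::euclidean_space set"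
  assumes "is_lattice L" "L \<noteq> {0}" shows "0 < min_norm L"
  using minimal_vectors_nonempty[OF assms] unfolding minimal_vectors_def by (metis (mono_tags, lifting) DiffE inner_gt_zero_iff insertCI mem_Collect_eq)

lemma min_norm_antimono:
  assumes "M \<subseteq> L" "M - {0} \<noteq> {}" shows "min_norm L \<le> min_norm M"
  using assms by (intro min_norm_ge) (auto intro: min_norm_le)

lemma min_norm_scale:
  fixes L :: "'v::euclidean_space set"
  assumes t: "t \<noteq> 0" and L: "is_lattice L" "L \<noteq> {0}" shows "min_norm ((*\<^sub>R) t ` L) = t\<^sup>2 * min_norm L"
proof (rule antisym)
  obtain v where v: "v \<in> minimal_vectors L" using minimal_vectors_nonempty[OF L] .
  then have v: "v \<in> L" "v \<noteq> 0" "v \<bullet> v = min_norm L" by (auto simp: minimal_vectors_def)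
  have "min_norm ((*\<^sub>R) t ` L) \<le> (t *\<^sub>R v) \<bullet> (t *\<^sub>R v)" using v t by (intro min_norm_le) auto
  then show "min_norm ((*\<^sub>R) t ` L) \<le> t\<^sup>2 * min_norm L" using v by (simp add: power2_eq_square mult.assoc)
  show "t\<^sup>2 * min_norm L \<le> min_norm ((*\<^sub>R) t ` L)"
  proof (rule min_norm_ge)
    show "(*\<^sub>R) t ` L - {0} \<noteq> {}" using v t by auto
    fix x assume "x \<in> (*\<^sub>R) t ` L" "x \<noteq> 0"
    then obtain y where y: "y \<in> L" "y \<noteq> 0" "x = t *\<^sub>R y" by auto
    have "t\<^sup>2 * min_norm L \<le> t\<^sup>2 * (y \<bullet> y)" using y by (intro mult_left_mono min_norm_le) auto
    then show "t\<^sup>2 * min_norm L \<le> x \<bullet> x" using y by (simp add: power2_eq_square mult.assoc)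
  qed
qed

lemma hermite_invariant_power:
  fixes L :: "'v::euclidean_space set"
  assumes "is_lattice L" "dim L > 0"
  shows "hermite_invariant L ^ dim L = min_norm L ^ dim L / lattice_det L"
proof -
  have "(D powr (1 / real n)) ^ n = D" if "D > 0" "n > 0" for D :: real and n :: nat
    using that by (simp add: powr_powr flip: powr_realpow)
  from this[OF lattice_det_pos[OF assms(1)] assms(2)]
  have "(lattice_det L powr (1 / real (dim L))) ^ dim L = lattice_det L" .
  then show ?thesis by (simp add: hermite_invariant_def power_divide)
qed

lemma lattice_dim_pos: "dim (L::'v::euclidean_space set) > 0 \<Longrightarrow> L \<noteq> {0}"
  by auto

lemma hermite_invariant_pos:
  fixes L :: "'v::euclidean_space set"
  assumes "is_lattice L" "dim L > 0" shows "0 < hermite_invariant L"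
  using min_norm_pos[OF assms(1) lattice_dim_pos[OF assms(2)]] lattice_det_pos[OF assms(1)]
  by (simp add: hermite_invariant_def)

lemma hermite_invariant_scale:
  fixes L :: "'v::euclidean_space set"
  assumes t: "t \<noteq> 0" and L: "is_lattice L" "dim L > 0"
  shows "hermite_invariant ((*\<^sub>R) t ` L) = hermite_invariant L"
proof (rule power_eq_imp_eq_base)
  note d = dim_scale[OF t L(1)] and l = is_lattice_scale[OF t L(1)]
  show "hermite_invariant ((*\<^sub>R) t ` L) ^ dim L = hermite_invariant L ^ dim L"
    using hermite_invariant_power[OF l] hermite_invariant_power[OF L] d L(2) t
    by (simp add: min_norm_scale[OF t L(1) lattice_dim_pos[OF L(2)]] lattice_det_scale[OF t L(1)] power_mult_distrib)
  show "0 \<le> hermite_invariant ((*\<^sub>R) t ` L)" "0 \<le> hermite_invariant L"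
    using hermite_invariant_pos[OF l] hermite_invariant_pos[OF L] d L(2) by simp_all
qed (rule L(2))

lemma hermite_inequality:
  fixes L :: "'v::euclidean_space set"
  assumes L: "is_lattice L" "dim L > 0"
  shows "hermite_lower (dim L) (min_norm L) \<le> lattice_det L"
proof -
  have "min_norm L > 0" by (rule min_norm_pos[OF L(1) lattice_dim_pos[OF L(2)]])
  moreover have "\<forall>x\<in>L - {0}. min_norm L \<le> x \<bullet> x" by (auto intro: min_norm_le)
  ultimately obtain bs where "lbasis bs L" "hermite_lower (length bs) (min_norm L) \<le> gdet bs"
    using reduced_basis[OF is_lattice_subspace[OF L(1)]] by blast
  then show ?thesis by (simp add: lattice_det_eq lbasis_length)
qed

lemma hermite_invariant_bound:
  fixes L :: "'v::euclidean_space set"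
  assumes L: "is_lattice L" "dim L > 0"
  shows "hermite_invariant L ^ dim L \<le> 1 / hermite_lower (dim L) 1"
proof -
  let ?n = "dim L"
  have p: "hermite_lower ?n 1 > 0" "lattice_det L > 0" by (auto intro: hermite_lower_pos lattice_det_pos L)
  have "min_norm L ^ ?n * hermite_lower ?n 1 \<le> lattice_det L"
    using hermite_inequality[OF L] by (subst (asm) hermite_lower_eq)
  then show ?thesis unfolding hermite_invariant_power[OF L] using p by (simp add: field_simps)
qed

section \<open>Conjugation\<close>

lemma kcnj_1 [simp]: "kcnj 1 = (1::'k::conj_div_algebra)"
  using kcnj_scaleR_1[of 1] by simp

lemma kcnj_of_real [simp]: "kcnj (of_real t) = (of_real t::'k::conj_div_algebra)"
  unfolding of_real_def by (rule kcnj_scaleR_1)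

lemma kcnj_0 [simp]: "kcnj 0 = (0::'k::conj_div_algebra)"
  using kcnj_of_real[of 0] by simp

lemma kcnj_scaleR: "kcnj (t *\<^sub>R x) = t *\<^sub>R kcnj (x::'k::conj_div_algebra)"
  using kcnj_mult[of "of_real t" x] by (simp add: of_real_def kcnj_scaleR_1)

lemma kcnj_minus: "kcnj (- x) = - kcnj (x::'k::conj_div_algebra)"
  using kcnj_scaleR[of "-1" x] by simp

lemma kcnj_diff: "kcnj (x - y) = kcnj x - kcnj (y::'k::conj_div_algebra)"
  using kcnj_add[of x "- y"] by (simp add: kcnj_minus)

lemma mult_kcnj: "x * kcnj x = of_real (x \<bullet> (x::'k::conj_div_algebra))"
  unfolding of_real_inner by (rule scaleR_half_double[symmetric])

text \<open>The norm x kcnj x is real, hence central, so kcnj x is a real multiple of the inverse of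
  x and commutes with x.\<close>

lemma kcnj_mult_self: "kcnj x * x = of_real (x \<bullet> (x::'k::conj_div_algebra))"
proof (cases "x = 0")
  case False
  have "kcnj x = inverse x * (x * kcnj x)" using False by (simp flip: mult.assoc)
  also have "\<dots> = of_real (x \<bullet> x) * inverse x" unfolding mult_kcnj by (simp add: of_real_def)
  finally have "kcnj x = of_real (x \<bullet> x) * inverse x" .
  then have "kcnj x * x = of_real (x \<bullet> x) * inverse x * x" by simp
  then show ?thesis using False by (simp add: mult.assoc)
qed simp

text \<open>Both orders of the product of z and its conjugate give the norm, so conjugation
  preserves norms; the rest is polarization.\<close>

lemma inner_kcnj: "kcnj x \<bullet> kcnj y = x \<bullet> (y::'k::conj_div_algebra)"
proof -
  have self: "kcnj z \<bullet> kcnj z = z \<bullet> z" for z :: 'k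
    using mult_kcnj[of "kcnj z"] kcnj_mult_self[of z] by (simp add: kcnj_kcnj)
  show ?thesis
    using self[of "x + y"] self[of x] self[of y]
    by (simp add: kcnj_add inner_add_left inner_add_right inner_commute)
qed

lemma add_kcnj: "x + kcnj x = of_real (2 * (x \<bullet> (1::'k::conj_div_algebra)))"
proof -
  have "of_real (2 * (x \<bullet> 1)) = 2 *\<^sub>R (of_real (x \<bullet> 1) :: 'k)" by (simp add: of_real_def)
  also have "\<dots> = x + kcnj x" unfolding of_real_inner by simp
  finally show ?thesis ..
qed

lemma inner_eq_mult_1: "x \<bullet> y = (x * kcnj y) \<bullet> (1::'k::conj_div_algebra)"
proof -
  have "(of_real (x \<bullet> y) :: 'k) = of_real ((x * kcnj y) \<bullet> 1)"
    unfolding of_real_inner by (simp add: kcnj_mult kcnj_kcnj)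
  then show ?thesis by simp
qed

lemma inner_mult_1_commute: "(a * b) \<bullet> 1 = (b * a) \<bullet> (1::'k::conj_div_algebra)"
  using inner_eq_mult_1[of a "kcnj b"] inner_eq_mult_1[of b "kcnj a"] inner_kcnj[of "kcnj a" b]
  by (simp add: kcnj_kcnj inner_commute)

lemma inner_mult_left: "(a * x) \<bullet> y = x \<bullet> (kcnj a * (y::'k::conj_div_algebra))"
proof -
  have "(a * x) \<bullet> y = (a * (x * kcnj y)) \<bullet> 1" by (subst inner_eq_mult_1) (simp add: mult.assoc)
  also have "\<dots> = (x * kcnj y * a) \<bullet> 1" by (rule inner_mult_1_commute)
  also have "\<dots> = x \<bullet> (kcnj a * y)" by (subst inner_eq_mult_1) (simp add: kcnj_mult kcnj_kcnj mult.assoc)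
  finally show ?thesis .
qed

lemma inner_mult_right: "(x * a) \<bullet> y = x \<bullet> (y * kcnj (a::'k::conj_div_algebra))"
  by (subst (1 2) inner_eq_mult_1) (simp add: kcnj_mult kcnj_kcnj mult.assoc)

lemma inner_mult_self: "(x * y) \<bullet> (x * y) = (x \<bullet> x) * (y \<bullet> (y::'k::conj_div_algebra))"
proof -
  have "(x * y) \<bullet> (x * y) = y \<bullet> (kcnj x * x * y)" by (simp add: inner_mult_left mult.assoc)
  then show ?thesis by (simp add: kcnj_mult_self flip: scaleR_conv_of_real)
qed

text \<open>The real part of the Cayley-Hamilton relation x^2 = Tr(x) x - N(x), with reduced trace
  Tr(x) = 2 (x \<bullet> 1).\<close>

lemma square_inner_1: "(x * x) \<bullet> 1 = 2 * (x \<bullet> 1)\<^sup>2 - x \<bullet> (x::'k::conj_div_algebra)"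
proof -
  have "kcnj x = of_real (2 * (x \<bullet> 1)) - x" using add_kcnj[of x] by (simp add: algebra_simps)
  then have "of_real (x \<bullet> x) = x * (of_real (2 * (x \<bullet> 1)) - x)" using mult_kcnj[of x] by simp
  also have "\<dots> = (2 * (x \<bullet> 1)) *\<^sub>R x - x * x" by (simp add: algebra_simps of_real_def)
  finally have "x * x = (2 * (x \<bullet> 1)) *\<^sub>R x - (x \<bullet> x) *\<^sub>R 1" by (simp add: of_real_def)
  then have "(x * x) \<bullet> 1 = ((2 * (x \<bullet> 1)) *\<^sub>R x - (x \<bullet> x) *\<^sub>R 1) \<bullet> 1" by (rule arg_cong)
  then show ?thesis by (simp add: inner_diff_left power2_eq_square flip: power2_norm_eq_inner)
qed

section \<open>Two-sided ideals of a maximal order\<close>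

text \<open>Treats both cases at once: the two kinds of algebra enter through
  \<open>span A = UNIV\<close> and through their real dimension, 2 or 4, which bounds the
  denominators of traces.\<close>

locale maximal_order =
  fixes A R :: "'k::conj_div_algebra set"
  assumes maximal: "is_maximal_order A R" and span_A: "span A = UNIV" and dim_dvd_4: "DIM('k) dvd 4"
begin

lemma order: "is_order A R"
  using maximal by (simp add: is_maximal_order_def)

lemma R_1: "1 \<in> R" and R_diff: "x \<in> R \<Longrightarrow> y \<in> R \<Longrightarrow> x - y \<in> R" and R_mult: "x \<in> R \<Longrightarrow> y \<in> R \<Longrightarrow> x * y \<in> R"
  and A_eq: "A = {of_rat q *\<^sub>R x | q x. x \<in> R}"
  using order by (auto simp: is_order_def)

lemma R_0: "0 \<in> R"
  using R_diff[OF R_1 R_1] by simp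

lemma R_subspace: "int_module.subspace R"
  by (rule int_subspaceI[OF R_0 R_diff])

lemma R_add: "x \<in> R \<Longrightarrow> y \<in> R \<Longrightarrow> x + y \<in> R"
  by (rule int_module.subspace_add[OF R_subspace])

lemma R_scale: "x \<in> R \<Longrightarrow> of_int c *\<^sub>R x \<in> R"
  by (rule int_module.subspace_scale[OF R_subspace])

lemma R_scale_nat: "x \<in> R \<Longrightarrow> real n *\<^sub>R x \<in> R"
  using R_scale[of x "int n"] by simp

lemma R_of_int: "of_int c \<in> R"
  using R_scale[OF R_1, of c] by (simp add: scaleR_conv_of_real)

lemma R_of_nat: "of_nat c \<in> R"
  using R_of_int[of "int c"] by simp

text \<open>An \<open>int_basis\<close> is independent over the integers only; having
  \<open>DIM('k)\<close> elements and spanning over the reals, it is independent over the reals as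
  well.\<close>

lemma R_full: "is_lattice R" "span R = UNIV"
proof -
  obtain bs where bs: "length bs = DIM('k)" "int_basis bs R"
    using order by (auto simp: is_order_def)
  have R: "R = range (\<lambda>c::nat \<Rightarrow> int. lcomb bs (\<lambda>j. of_int (c j)))" and d: "distinct bs"
    using bs(2) by (auto simp: int_basis_def int_span_eq_lcomb)
  have sub: "R \<subseteq> span (set bs)" unfolding R span_eq_lcomb by blast
  have "A \<subseteq> span R" unfolding A_eq by (auto intro: span_scale span_base)
  then have sR: "span R = UNIV" using span_A by (metis span_minimal subspace_span top.extremum_uniqueI)
  then have "span (set bs) = UNIV" using sub by (metis span_minimal subspace_span top.extremum_uniqueI)
  then have "independent (set bs)"
    using card_eq_dim[of "set bs" UNIV] bs(1) d by (simp add: distinct_card)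
  then have "lbasis bs R" using d R by (simp add: lbasis_def free_list_iff)
  then show "is_lattice R" "span R = UNIV" using sR by (auto intro: lbasis_imp_is_lattice)
qed

section \<open>Integrality of traces and closure under conjugation\<close>

text \<open>Both sides are the trace of left multiplication by x, computed on bs and on the
  orthonormal basis. On the latter every diagonal entry is x \<bullet> 1, because e kcnj e =
  1.\<close>

lemma trace_formula:
  fixes x :: 'k
  assumes bs: "lbasis bs L" "length bs = DIM('k)" and ds: "length ds = length bs"
    "\<And>i j. i < length bs \<Longrightarrow> j < length bs \<Longrightarrow> bs ! i \<bullet> ds ! j = (if i = j then 1 else 0)"
  shows "(\<Sum>i<length bs. (x * bs ! i) \<bullet> ds ! i) = DIM('k) * (x \<bullet> 1)"
proof -
  have "span (set bs) = UNIV" using full_lbasis_iff[of L] bs lbasis_span[OF bs(1)] by auto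
  then have UNIV_bs: "range (lcomb bs) = UNIV" unfolding span_eq_lcomb .
  have rep: "e = (\<Sum>i<length bs. (e \<bullet> ds ! i) *\<^sub>R bs ! i)" for e
  proof -
    obtain c where c: "e = lcomb bs c" using UNIV_bs by blast
    have "e \<bullet> ds ! i = c i" if "i < length bs" for i unfolding c by (rule lcomb_inner_dual[OF ds that])
    then show ?thesis by (subst c) (simp add: lcomb_def)
  qed
  have "(\<Sum>i<length bs. (x * bs ! i) \<bullet> ds ! i) = (\<Sum>i<length bs. \<Sum>e\<in>Basis. ((x * bs ! i) \<bullet> e) * (ds ! i \<bullet> e))"
    by (subst euclidean_inner) simp
  also have "\<dots> = (\<Sum>e\<in>Basis. \<Sum>i<length bs. (e \<bullet> ds ! i) * ((x * bs ! i) \<bullet> e))"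
    by (subst sum.swap) (simp add: inner_commute mult.commute)
  also have "\<dots> = (\<Sum>e\<in>Basis. (x * e) \<bullet> e)"
  proof (rule sum.cong[OF refl])
    fix e :: 'k
    have "(x * e) \<bullet> e = (x * (\<Sum>i<length bs. (e \<bullet> ds ! i) *\<^sub>R bs ! i)) \<bullet> e"
      by (subst (2) rep) simp
    then show "(\<Sum>i<length bs. (e \<bullet> ds ! i) * ((x * bs ! i) \<bullet> e)) = (x * e) \<bullet> e"
      by (simp add: sum_distrib_left inner_sum_left)
  qed
  also have "\<dots> = (\<Sum>e\<in>(Basis::'k set). x \<bullet> 1)"
  proof (rule sum.cong[OF refl])
    fix e :: 'k assume "e \<in> Basis"
    then have "e * kcnj e = 1" by (simp add: mult_kcnj)
    then show "(x * e) \<bullet> e = x \<bullet> 1" by (simp add: inner_eq_mult_1[of "x * e" e] mult.assoc)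
  qed
  finally show ?thesis by simp
qed

text \<open>Left multiplication by x maps R to itself, so its matrix in a basis of R is integral,
  and the trace is \<open>DIM('k)\<close> times the real part.\<close>

lemma four_Re: assumes x: "x \<in> R" shows "4 * (x \<bullet> 1) \<in> \<int>"
proof -
  obtain bs where bs: "lbasis bs R" "length bs = DIM('k)" using full_lbasis_iff R_full by blast
  obtain ds where ds: "lbasis ds (zdual R)" "length ds = DIM('k)"
    "\<And>i j. i < length bs \<Longrightarrow> j < length bs \<Longrightarrow> bs ! i \<bullet> ds ! j = (if i = j then 1 else 0)"
    using zdual_lbasis[OF bs] by metis
  have "(x * bs ! i) \<bullet> ds ! i \<in> \<int>" if i: "i < length bs" for i
  proof -
    have "x * bs ! i \<in> R" using lbasis_subset[OF bs(1)] nth_mem[OF i] by (intro R_mult x) auto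
    moreover have "ds ! i \<in> zdual R" using lbasis_subset[OF ds(1)] nth_mem[of i ds] i bs(2) ds(2) by auto
    ultimately show ?thesis unfolding zdual_def by (auto simp: inner_commute)
  qed
  then have "(\<Sum>i<length bs. (x * bs ! i) \<bullet> ds ! i) \<in> \<int>" by (intro Ints_sum) auto
  then have "DIM('k) * (x \<bullet> 1) \<in> \<int>" using trace_formula[OF bs _ ds(3)] bs(2) ds(2) by simp
  moreover obtain e where "4 = DIM('k) * e" using dim_dvd_4 by blast
  then have "(4::real) = real e * DIM('k)" by (metis mult.commute of_nat_mult of_nat_numeral)
  then have "4 * (x \<bullet> 1) = real e * (DIM('k) * (x \<bullet> 1))" by simp
  ultimately show ?thesis by (simp only: Ints_mult Ints_of_nat)
qed

text \<open>The trace of multiplication by \<open>x\<close> only shows that twice the reduced trace is integral;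
  an odd value would give the powers of \<open>x\<close> traces with unbounded denominators.\<close>

lemma two_Re: assumes x: "x \<in> R" shows "2 * (x \<bullet> 1) \<in> \<int>"
proof -
  obtain t where t: "4 * (x \<bullet> 1) = of_int t" using four_Re[OF x] by (auto elim: Ints_cases)
  obtain s where s: "4 * ((x * x) \<bullet> 1) = of_int s" using four_Re[OF R_mult[OF x x]] by (auto elim: Ints_cases)
  obtain u where u: "4 * ((x * x * (x * x)) \<bullet> 1) = of_int u"
    using four_Re[OF R_mult[OF R_mult[OF x x] R_mult[OF x x]]] by (auto elim: Ints_cases)
  have e1: "(of_int s :: real) = 8 * (x \<bullet> 1)\<^sup>2 - 4 * (x \<bullet> x)" using s square_inner_1[of x] by simp
  have e2: "(of_int u :: real) = 8 * ((x * x) \<bullet> 1)\<^sup>2 - 4 * (x \<bullet> x)\<^sup>2"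
    using u square_inner_1[of "x * x"] by (simp add: inner_mult_self power2_eq_square)
  have x1: "x \<bullet> 1 = of_int t / 4" and x2: "(x * x) \<bullet> 1 = of_int s / 4" using t s by simp_all
  have n: "x \<bullet> x = of_int (t\<^sup>2 - 2 * s) / 8" using e1 unfolding x1 by (simp add: power2_eq_square field_simps)
  \<comment> \<open>Eliminating the norm of x from the trace relations for the squares of x and of
    x^2 leaves an equation between integers; modulo 2 it forces t to be even.\<close>
  have "(of_int (16 * u) :: real) = of_int (8 * s\<^sup>2 - (t\<^sup>2 - 2 * s)\<^sup>2)"
    using e2 unfolding n x2 by (simp add: power2_eq_square field_simps)
  then have "16 * u = 8 * s\<^sup>2 - (t\<^sup>2 - 2 * s)\<^sup>2" by (simp only: of_int_eq_iff)
  then have "(t\<^sup>2 - 2 * s)\<^sup>2 = 2 * (4 * s\<^sup>2 - 8 * u)" by simp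
  then have "even ((t\<^sup>2 - 2 * s)\<^sup>2)" by simp
  then have "even t" by simp
  then obtain k where "t = 2 * k" by blast
  then have "2 * (x \<bullet> 1) = of_int k" using t by simp
  then show ?thesis by simp
qed

text \<open>The conjugate is Tr(x) - x with an integral trace. Every later exchange of left and
  right rests on this.\<close>

lemma kcnj_R: assumes x: "x \<in> R" shows "kcnj x \<in> R"
proof -
  obtain k where "2 * (x \<bullet> 1) = of_int k" using two_Re[OF x] by (auto elim: Ints_cases)
  then have "kcnj x = of_int k - x" using add_kcnj[of x] by (simp add: algebra_simps)
  then show ?thesis using x R_of_int R_diff by simp
qed

lemma two_inner: "x \<in> R \<Longrightarrow> y \<in> R \<Longrightarrow> 2 * (x \<bullet> y) \<in> \<int>"
  using two_Re[OF R_mult[OF _ kcnj_R]] inner_eq_mult_1[of x y] by simp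

section \<open>Two-sided fractional ideals and their multiplier rings\<close>

text \<open>Full two-sided fractional ideals. Full rank is expressed by a positive integer in B,
  finite generation by a common denominator.\<close>

definition frac :: "'k set \<Rightarrow> bool" where
  "frac B \<longleftrightarrow> int_module.subspace B \<and> (\<forall>a\<in>R. \<forall>b\<in>B. a * b \<in> B \<and> b * a \<in> B) \<and>
     (\<exists>d::nat. d \<ge> 1 \<and> of_nat d \<in> B) \<and> (\<exists>e::nat. e \<ge> 1 \<and> (\<forall>b\<in>B. real e *\<^sub>R b \<in> R))"

text \<open>The elements y with y B inside B form a ring containing R and, because of d and e,
  contained in R / (e d). It is therefore an order, and maximality makes it equal to R.\<close>

lemma left_multiplier:
  assumes B: "int_module.subspace B" "\<And>a b. a \<in> R \<Longrightarrow> b \<in> B \<Longrightarrow> a * b \<in> B"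
    and d: "d \<ge> 1" "of_nat d \<in> B" and e: "e \<ge> 1" "\<And>b. b \<in> B \<Longrightarrow> real e *\<^sub>R b \<in> R"
    and y: "\<And>b. b \<in> B \<Longrightarrow> y * b \<in> B"
  shows "y \<in> R"
proof -
  define S where "S = {y. \<forall>b\<in>B. y * b \<in> B}"
  have RS: "R \<subseteq> S" using B(2) by (auto simp: S_def)
  have scale: "real (e * d) *\<^sub>R z \<in> R" if "z \<in> S" for z
  proof -
    have "real e *\<^sub>R (z * of_nat d) \<in> R" by (rule e(2)) (use that d(2) in \<open>simp add: S_def\<close>)
    moreover have "(of_nat d :: 'k) = real d *\<^sub>R 1" by (simp add: scaleR_conv_of_real)
    ultimately show ?thesis by simp
  qed
  have subS: "int_module.subspace S"
    using B(1) by (intro int_subspaceI) (auto simp: S_def left_diff_distrib int_module.subspace_0 intro: int_module.subspace_diff)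
  have t: "1 / real (e * d) \<noteq> 0" using d e by simp
  have "S \<subseteq> (*\<^sub>R) (1 / real (e * d)) ` R"
  proof
    fix z assume "z \<in> S"
    then show "z \<in> (*\<^sub>R) (1 / real (e * d)) ` R"
      using scale d e by (intro image_eqI[of _ _ "real (e * d) *\<^sub>R z"]) auto
  qed
  then have latS: "is_lattice S" using is_lattice_subset[OF is_lattice_scale[OF t R_full(1)] subS] by blast
  have "span S = UNIV" using RS R_full(2) span_mono[of R S] by blast
  then obtain bs where "lbasis bs S" "length bs = DIM('k)" using full_lbasis_iff latS by blast
  moreover have "1 \<in> S" by (simp add: S_def)
  moreover have "x - y \<in> S \<and> x * y \<in> S" if "x \<in> S" "y \<in> S" for x y
    using that int_module.subspace_diff[OF subS] by (auto simp: S_def mult.assoc)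
  moreover have "A = {of_rat q *\<^sub>R x | q x. x \<in> S}"
  proof
    show "A \<subseteq> {of_rat q *\<^sub>R x | q x. x \<in> S}" unfolding A_eq using RS by blast
    show "{of_rat q *\<^sub>R x | q x. x \<in> S} \<subseteq> A"
    proof
      fix z assume "z \<in> {of_rat q *\<^sub>R x | q x. x \<in> S}"
      then obtain q x where x: "z = of_rat q *\<^sub>R x" "x \<in> S" by blast
      have "of_rat (q / of_nat k) * real k = of_rat q" if "k > 0" for k
        using that by (simp add: of_rat_divide)
      from this[of "e * d"] have "z = of_rat (q / of_nat (e * d)) *\<^sub>R (real (e * d) *\<^sub>R x)"
        using x(1) d(1) e(1) by (simp only: scaleR_scaleR) simp
      then show "z \<in> A" unfolding A_eq using scale[OF x(2)] by blast
    qed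
  qed
  ultimately have "is_order A S" unfolding is_order_def using lbasis_imp_int_basis by blast
  then have "S = R" using maximal RS unfolding is_maximal_order_def by blast
  then show ?thesis using y by (auto simp: S_def)
qed

text \<open>Conjugation preserves R and reverses products, which turns the right multiplier ring of
  B into the left one of the conjugate of B.\<close>

lemma right_multiplier:
  assumes B: "int_module.subspace B" "\<And>a b. a \<in> R \<Longrightarrow> b \<in> B \<Longrightarrow> b * a \<in> B"
    and d: "d \<ge> 1" "of_nat d \<in> B" and e: "e \<ge> 1" "\<And>b. b \<in> B \<Longrightarrow> real e *\<^sub>R b \<in> R"
    and y: "\<And>b. b \<in> B \<Longrightarrow> b * y \<in> B"
  shows "y \<in> R"
proof -
  have "kcnj y \<in> R"
  proof (rule left_multiplier[of "{b. kcnj b \<in> B}" d e])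
    show "int_module.subspace {b. kcnj b \<in> B}"
      using B(1) by (intro int_subspaceI) (auto simp: kcnj_diff int_module.subspace_0 intro: int_module.subspace_diff)
    show "a * b \<in> {b. kcnj b \<in> B}" if "a \<in> R" "b \<in> {b. kcnj b \<in> B}" for a b
      using that B(2)[OF kcnj_R] by (simp add: kcnj_mult)
    show "of_nat d \<in> {b. kcnj b \<in> B}" using d kcnj_of_real[of "real d", where 'k = 'k] unfolding of_real_of_nat_eq by simp
    show "real e *\<^sub>R b \<in> R" if "b \<in> {b. kcnj b \<in> B}" for b
      using kcnj_R[OF e(2)[of "kcnj b"]] that by (simp add: kcnj_scaleR kcnj_kcnj)
    show "kcnj y * b \<in> {b. kcnj b \<in> B}" if "b \<in> {b. kcnj b \<in> B}" for b
      using y that by (simp add: kcnj_mult kcnj_kcnj)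
  qed (use d e in auto)
  then show ?thesis using kcnj_R[of "kcnj y"] by (simp add: kcnj_kcnj)
qed

text \<open>Either condition implies that B y B lies in B. Hence b y is a left multiplier of B and y
  b a right multiplier, and both belong to R.\<close>

lemma frac_inv_sym:
  assumes "frac B" shows "(\<forall>b\<in>B. y * b \<in> R) \<longleftrightarrow> (\<forall>b\<in>B. b * y \<in> R)"
proof -
  obtain d e :: nat where B: "int_module.subspace B" "\<And>a b. a \<in> R \<Longrightarrow> b \<in> B \<Longrightarrow> a * b \<in> B"
    "\<And>a b. a \<in> R \<Longrightarrow> b \<in> B \<Longrightarrow> b * a \<in> B" and d: "d \<ge> 1" "of_nat d \<in> B" and
    e: "e \<ge> 1" "\<And>b. b \<in> B \<Longrightarrow> real e *\<^sub>R b \<in> R"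
    using assms unfolding frac_def by blast
  show ?thesis
  proof (intro iffI ballI)
    fix b assume y: "\<forall>b\<in>B. y * b \<in> R" and b: "b \<in> B"
    show "b * y \<in> R"
    proof (rule left_multiplier[OF B(1,2) d e])
      show "b * y * z \<in> B" if "z \<in> B" for z
        using B(3)[OF _ b, of "y * z"] y that by (simp add: mult.assoc)
    qed
  next
    fix b assume y: "\<forall>b\<in>B. b * y \<in> R" and b: "b \<in> B"
    show "y * b \<in> R"
    proof (rule right_multiplier[OF B(1,3) d e])
      show "z * (y * b) \<in> B" if "z \<in> B" for z
        using B(2)[OF _ b, of "z * y"] y that by (simp add: mult.assoc)
    qed
  qed
qed

end

text \<open>\<open>T0\<close> is a set of representatives of \<open>R/nR\<close>. Below, \<open>lid\<close>, \<open>tid\<close> and \<open>pid\<close> are the left,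
  two-sided and prime ideals containing \<open>n\<close>. A set with \<open>mclosed\<close> need not be closed under addition,
  so that products of ideals can be taken elementwise.\<close>

locale order_mod = maximal_order +
  fixes n :: nat and T0
  assumes n: "n \<ge> 1" and T0: "finite T0" "T0 \<subseteq> R" "\<And>x. x \<in> R \<Longrightarrow> \<exists>t\<in>T0. (1 / real n) *\<^sub>R (x - t) \<in> R"
begin

definition NR where "NR = {z. (1 / real n) *\<^sub>R z \<in> R}"

definition lid where
  "lid L \<longleftrightarrow> int_module.subspace L \<and> L \<subseteq> R \<and> (\<forall>a\<in>R. \<forall>b\<in>L. a * b \<in> L) \<and> NR \<subseteq> L"

definition tid where
  "tid X \<longleftrightarrow> lid X \<and> (\<forall>a\<in>R. \<forall>b\<in>X. b * a \<in> X)"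

definition mclosed where
  "mclosed V \<longleftrightarrow> V \<subseteq> R \<and> (\<forall>a\<in>R. \<forall>v\<in>V. a * v \<in> V \<and> v * a \<in> V)"

definition pid where
  "pid X \<longleftrightarrow> tid X \<and> 1 \<notin> X \<and> (\<forall>a\<in>R. \<forall>b\<in>R. (\<forall>r\<in>R. a * r * b \<in> X) \<longrightarrow> a \<in> X \<or> b \<in> X)"

lemma NR_iff: "z \<in> NR \<longleftrightarrow> (\<exists>r\<in>R. z = real n *\<^sub>R r)"
  using n by (auto simp: NR_def intro!: bexI[of _ "(1 / real n) *\<^sub>R z"])

lemma NR_mult: "a \<in> R \<Longrightarrow> z \<in> NR \<Longrightarrow> a * z \<in> NR" "a \<in> R \<Longrightarrow> z \<in> NR \<Longrightarrow> z * a \<in> NR"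
  using R_mult[of a "(1 / real n) *\<^sub>R z"] R_mult[of "(1 / real n) *\<^sub>R z" a] by (auto simp: NR_def)

lemma NR_diff: "x \<in> NR \<Longrightarrow> y \<in> NR \<Longrightarrow> x - y \<in> NR"
  by (simp add: NR_def scaleR_diff_right R_diff)

lemma NR_0: "0 \<in> NR"
  by (simp add: NR_def R_0)

lemma NR_subset: "NR \<subseteq> R"
  by (auto simp: NR_iff R_scale_nat)

lemma of_nat_NR: "of_nat n \<in> NR"
  unfolding NR_iff using R_1 by (auto intro!: bexI[of _ 1] simp: scaleR_conv_of_real)

lemma lidI:
  assumes "L \<subseteq> R" "NR \<subseteq> L" "\<And>x y. x \<in> L \<Longrightarrow> y \<in> L \<Longrightarrow> x - y \<in> L" "\<And>a b. a \<in> R \<Longrightarrow> b \<in> L \<Longrightarrow> a * b \<in> L"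
  shows "lid L"
  unfolding lid_def using assms NR_0 by (auto intro!: int_subspaceI)

lemma lid_diff: "lid L \<Longrightarrow> x \<in> L \<Longrightarrow> y \<in> L \<Longrightarrow> x - y \<in> L"
  unfolding lid_def by (auto intro: int_module.subspace_diff)

lemma lid_add: "lid L \<Longrightarrow> x \<in> L \<Longrightarrow> y \<in> L \<Longrightarrow> x + y \<in> L"
  unfolding lid_def by (auto intro: int_module.subspace_add)

lemma lid_mult: "lid L \<Longrightarrow> a \<in> R \<Longrightarrow> x \<in> L \<Longrightarrow> a * x \<in> L"
  unfolding lid_def by auto

lemma lid_subset: "lid L \<Longrightarrow> L \<subseteq> R" and lid_NR: "lid L \<Longrightarrow> NR \<subseteq> L"
  unfolding lid_def by auto

lemma tid_lid: "tid X \<Longrightarrow> lid X" and tid_mult: "tid X \<Longrightarrow> a \<in> R \<Longrightarrow> x \<in> X \<Longrightarrow> x * a \<in> X"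
  unfolding tid_def by auto

lemma tid_frac: "tid X \<Longrightarrow> frac X"
proof -
  assume X: "tid X"
  then have "\<exists>d::nat. d \<ge> 1 \<and> of_nat d \<in> X"
    unfolding tid_def lid_def using n of_nat_NR by blast
  moreover have "\<exists>e::nat. e \<ge> 1 \<and> (\<forall>b\<in>X. real e *\<^sub>R b \<in> R)"
    using X by (intro exI[of _ 1]) (auto simp: tid_def lid_def)
  ultimately show ?thesis using X unfolding tid_def lid_def frac_def by blast
qed

lemma lid_R: "lid R" and tid_NR: "tid NR"
  unfolding tid_def using NR_subset R_diff R_mult NR_diff NR_mult by (auto intro!: lidI)


text \<open>An ideal containing nR is a union of classes modulo nR, so its representatives determine
  it. The number of representatives is the measure for choosing extremal ideals and for
  induction.\<close>

lemma lid_transversal: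
  assumes "lid X" "lid Y" "X \<inter> T0 \<subseteq> Y" shows "X \<subseteq> Y"
proof
  fix x assume x: "x \<in> X"
  then obtain t where t: "t \<in> T0" "x - t \<in> NR" using T0(3) lid_subset[OF assms(1)] unfolding NR_def by blast
  have "x - (x - t) \<in> X" by (rule lid_diff[OF assms(1) x]) (use lid_NR[OF assms(1)] t in blast)
  then have "t \<in> Y" using t assms(3) by auto
  moreover have "x - t \<in> Y" using t lid_NR[OF assms(2)] by blast
  ultimately have "(x - t) + t \<in> Y" by (intro lid_add[OF assms(2)])
  then show "x \<in> Y" by simp
qed

lemma lid_card_less:
  assumes "lid X" "lid Y" "X \<subset> Y" shows "card (X \<inter> T0) < card (Y \<inter> T0)"
proof (rule psubset_card_mono)
  show "X \<inter> T0 \<subset> Y \<inter> T0" using lid_transversal[OF assms(2,1)] assms(3) by blast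
qed (use T0 in simp)

text \<open>If W V lies in nR, so does V W: apply \<open>frac_inv_sym\<close> to the ideal of all b
  with b V inside nR, and to y = v / n. This substitutes for commutativity of the product of
  ideals.\<close>

lemma mclosed_commute:
  assumes W: "mclosed W" and V: "mclosed V" and WV: "\<And>a v. a \<in> W \<Longrightarrow> v \<in> V \<Longrightarrow> a * v \<in> NR"
    and a: "a \<in> W" and v: "v \<in> V"
  shows "v * a \<in> NR"
proof -
  define B where "B = {b \<in> R. \<forall>v\<in>V. b * v \<in> NR}"
  have VR: "V \<subseteq> R" "\<And>a v. a \<in> R \<Longrightarrow> v \<in> V \<Longrightarrow> a * v \<in> V" using V by (auto simp: mclosed_def)
  have "tid B"
    unfolding tid_def
  proof
    show "lid B"
      by (rule lidI)
        (use VR NR_subset NR_mult NR_diff in \<open>auto simp: B_def R_diff R_mult left_diff_distrib mult.assoc\<close>)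
    show "\<forall>a\<in>R. \<forall>b\<in>B. b * a \<in> B" using VR by (auto simp: B_def R_mult mult.assoc)
  qed
  then have f: "frac B" by (rule tid_frac)
  have "\<forall>b\<in>B. b * ((1 / real n) *\<^sub>R v) \<in> R" using v by (auto simp: B_def NR_def)
  then have "\<forall>b\<in>B. ((1 / real n) *\<^sub>R v) * b \<in> R" using frac_inv_sym[OF f] by blast
  moreover have "a \<in> B" using a W WV by (auto simp: B_def mclosed_def)
  ultimately show ?thesis by (auto simp: NR_def)
qed

text \<open>Jacobson density for a minimal left ideal \<open>L/X\<close> of the prime ring \<open>R/X\<close>: modulo \<open>U\<close>, every
  element of \<open>R\<close> annihilates any given finite part of \<open>L\<close>, hence all of \<open>L\<close>.\<close>

lemma pid_imp_maximal:
  assumes X: "pid X" and U: "tid U" and XU: "X \<subset> U" shows "1 \<in> U"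
proof -
  have tX: "tid X" and prime: "\<And>a b. a \<in> R \<Longrightarrow> b \<in> R \<Longrightarrow> (\<forall>r\<in>R. a * r * b \<in> X) \<Longrightarrow> a \<in> X \<or> b \<in> X"
    using X by (auto simp: pid_def)
  note lX = tid_lid[OF tX] and lU = tid_lid[OF U]
  have "X \<subset> R" using X lid_subset[OF lX] R_1 by (auto simp: pid_def)
  then have "lid R \<and> X \<subset> R" using lid_R by simp
  from ex_has_least_nat[of "\<lambda>L. lid L \<and> X \<subset> L", OF this, of "\<lambda>L. card (L \<inter> T0)"]
  obtain L where L': "(lid L \<and> X \<subset> L) \<and> (\<forall>M. lid M \<and> X \<subset> M \<longrightarrow> card (L \<inter> T0) \<le> card (M \<inter> T0))" ..
  then have L: "lid L" "X \<subset> L" by simp_all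
  have min: "card (L \<inter> T0) \<le> card (M \<inter> T0)" if "lid M" "X \<subset> M" for M using L' that by simp
  \<comment> \<open>Those elements of R that annihilate F modulo X.\<close>
  define K where "K F = {b \<in> R. \<forall>l\<in>F. b * l \<in> X}" for F
  \<comment> \<open>The density statement: every y agrees on F, modulo X, with some u in U. The
    induction adjoins one l at a time and corrects u by an element that already kills F.\<close>
  have cover: "\<exists>u\<in>U. y - u \<in> K F" if "finite F" "F \<subseteq> L" "y \<in> R" for F y
    using that
  proof (induction F arbitrary: y rule: finite_induct)
    case empty
    have "0 \<in> U" using NR_0 lid_NR[OF lU] by blast
    then show ?case using empty by (intro bexI[of _ 0]) (auto simp: K_def)
  next
    case (insert l F)
    then have l: "l \<in> L" "l \<in> R" using lid_subset[OF L(1)] by auto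
    obtain u1 where u1: "u1 \<in> U" "y - u1 \<in> K F" using insert by blast
    show ?case
    proof (cases "\<forall>k\<in>K F. k * l \<in> X")
      case True
      then have "y - u1 \<in> K (insert l F)" using u1 by (auto simp: K_def)
      then show ?thesis using u1(1) by blast
    next
      case False
      then obtain k where k: "k \<in> K F" "k * l \<notin> X" by blast
      have Kd: "x - z \<in> K F" if "x \<in> K F" "z \<in> K F" for x z
        using that lid_diff[OF lX] by (auto simp: K_def R_diff left_diff_distrib)
      have Km: "a * x \<in> K F" if "a \<in> R" "x \<in> K F" for x a
        using that lid_mult[OF lX] by (auto simp: K_def R_mult mult.assoc)
      \<comment> \<open>A left ideal between X and L. Once it is seen to be larger than X,
        minimality of L makes it equal to L, so the error (y - u1) l can be corrected inside U
        without disturbing F.\<close>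
      define M where "M = {u * l + x | u x. u \<in> U \<inter> K F \<and> x \<in> X}"
      have z: "0 \<in> U \<inter> K F"
        using NR_0 lid_NR[OF lU] lid_NR[OF lX] R_0 by (auto simp: K_def)
      have lM: "lid M"
      proof (rule lidI)
        show "M \<subseteq> R" unfolding M_def using lid_subset[OF lX] l by (auto simp: K_def intro!: R_add R_mult)
        have "X \<subseteq> M" unfolding M_def using z by force
        then show "NR \<subseteq> M" using lid_NR[OF lX] by blast
        fix p q assume "p \<in> M" "q \<in> M"
        then obtain u x v w where pq: "p = u * l + x" "q = v * l + w" "u \<in> U \<inter> K F" "v \<in> U \<inter> K F" "x \<in> X" "w \<in> X"
          unfolding M_def by blast
        then have "p - q = (u - v) * l + (x - w)" by (simp add: algebra_simps)
        then show "p - q \<in> M" unfolding M_def using pq Kd lid_diff[OF lU] lid_diff[OF lX] by blast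
      next
        fix a p assume a: "a \<in> R" "p \<in> M"
        then obtain u x where pq: "p = u * l + x" "u \<in> U \<inter> K F" "x \<in> X" unfolding M_def by blast
        then have "a * p = (a * u) * l + a * x" by (simp add: algebra_simps)
        then show "a * p \<in> M" unfolding M_def using pq a Km lid_mult[OF lU] lid_mult[OF lX] by blast
      qed
      have XM: "X \<subseteq> M" unfolding M_def using z by force
      have M_L: "M \<subseteq> L" unfolding M_def using L l by (auto simp: K_def intro!: lid_add[OF L(1)] lid_mult[OF L(1)])
      obtain u where u: "u \<in> U" "u \<notin> X" using XU by blast
      have kR: "k \<in> R" using k by (simp add: K_def)
      \<comment> \<open>Primeness of X supplies an element of M outside X.\<close>
      have "\<exists>r\<in>R. u * r * (k * l) \<notin> X"
        using prime[of u "k * l"] u(2) k(2) lid_subset[OF lU] u(1) R_mult[OF kR l(2)] by blast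
      then obtain r where r: "r \<in> R" "u * r * (k * l) \<notin> X" by blast
      have "u * (r * k) \<in> U" by (rule tid_mult[OF U R_mult[OF r(1) kR] u(1)])
      moreover have "u * (r * k) \<in> K F" using Km[OF R_mult[OF _ r(1)] k(1), of u] lid_subset[OF lU] u(1) by (auto simp: mult.assoc)
      ultimately have "u * (r * k) * l + 0 \<in> M" unfolding M_def using NR_0 lid_NR[OF lX] by blast
      then have "u * r * (k * l) \<in> M" by (simp add: mult.assoc)
      then have "X \<subset> M" using XM r(2) by blast
      then have "M = L" using min[OF lM] lid_card_less[OF lM L(1)] M_L by fastforce
      then have "(y - u1) * l \<in> M" using lid_mult[OF L(1) _ l(1)] u1(2) by (auto simp: K_def)
      then obtain u2 x where x: "(y - u1) * l = u2 * l + x" "u2 \<in> U \<inter> K F" "x \<in> X" unfolding M_def by blast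
      have "(y - u1 - u2) * l \<in> X" using x(1,3) by (simp add: left_diff_distrib)
      moreover have "y - u1 - u2 \<in> K F" using Kd u1(2) x(2) by blast
      ultimately have "y - (u1 + u2) \<in> K (insert l F)" by (simp add: K_def diff_diff_eq)
      moreover have "u1 + u2 \<in> U" using lid_add[OF lU u1(1)] x(2) by blast
      ultimately show ?thesis by blast
    qed
  qed
  have "finite (L \<inter> T0)" using T0(1) by simp
  \<comment> \<open>Density applied to 1 yields u in U such that 1 - u kills L modulo X. As L is
    larger than X, primeness puts 1 - u into X and hence into U.\<close>
  from cover[OF this _ R_1] obtain u where u: "u \<in> U" "1 - u \<in> K (L \<inter> T0)" by blast
  have uR: "1 - u \<in> R" using u(2) by (simp add: K_def)
  have all: "(1 - u) * l \<in> X" if l: "l \<in> L" for l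
  proof -
    obtain t where t: "t \<in> T0" "l - t \<in> NR" using T0(3) lid_subset[OF L(1)] l unfolding NR_def by blast
    have "l - (l - t) \<in> L" by (rule lid_diff[OF L(1) l]) (use lid_NR[OF L(1)] t in blast)
    then have "(1 - u) * t \<in> X" using t u(2) by (auto simp: K_def)
    moreover have "(1 - u) * (l - t) \<in> X" using NR_mult(1)[OF uR t(2)] lid_NR[OF lX] by blast
    ultimately have "(1 - u) * (l - t) + (1 - u) * t \<in> X" by (intro lid_add[OF lX])
    then show ?thesis by (simp add: algebra_simps)
  qed
  obtain l where l: "l \<in> L" "l \<notin> X" using L(2) by blast
  have "(1 - u) * r * l \<in> X" if "r \<in> R" for r
    using all[OF lid_mult[OF L(1) that l(1)]] by (simp add: mult.assoc)
  then have "1 - u \<in> X" using prime[OF uR, of l] l lid_subset[OF L(1)] by blast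
  then have "u + (1 - u) \<in> U" using u(1) XU by (intro lid_add[OF lU]) auto
  then show ?thesis by simp
qed

end

context order_mod
begin

text \<open>If a R b lies in P, the ideal of all x with x R b inside P contains P and a. Either it
  equals P, so a is in P, or it contains 1, so b is in P.\<close>

lemma maximal_imp_pid:
  assumes P: "tid P" "1 \<notin> P" and max: "\<And>Y. tid Y \<Longrightarrow> P \<subseteq> Y \<Longrightarrow> 1 \<notin> Y \<Longrightarrow> Y = P"
  shows "pid P"
  unfolding pid_def
proof (intro conjI ballI impI)
  note lP = tid_lid[OF P(1)]
  fix a b assume ab: "a \<in> R" "b \<in> R" "\<forall>r\<in>R. a * r * b \<in> P"
  define J where "J = {x \<in> R. \<forall>r\<in>R. x * r * b \<in> P}"
  have "tid J"
    unfolding tid_def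
  proof
    show "lid J"
    proof (rule lidI)
      show "NR \<subseteq> J" using NR_subset NR_mult ab(2) lid_NR[OF lP] by (auto simp: J_def)
      show "x - y \<in> J" if "x \<in> J" "y \<in> J" for x y
        using that lid_diff[OF lP] by (auto simp: J_def R_diff left_diff_distrib)
      show "c * x \<in> J" if "c \<in> R" "x \<in> J" for c x
        using that lid_mult[OF lP that(1)] by (auto simp: J_def R_mult mult.assoc)
    qed (auto simp: J_def)
    show "\<forall>a\<in>R. \<forall>x\<in>J. x * a \<in> J"
    proof (intro ballI)
      fix r x assume r: "r \<in> R" and x: "x \<in> J"
      have "x * r * s * b \<in> P" if s: "s \<in> R" for s
      proof -
        have "x * (r * s) * b \<in> P" using x R_mult[OF r s] unfolding J_def by blast
        then show ?thesis by (simp add: mult.assoc)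
      qed
      then show "x * r \<in> J" using r x R_mult unfolding J_def by blast
    qed
  qed
  moreover have "P \<subseteq> J"
    using lid_subset[OF lP] tid_mult[OF P(1)] ab(2) by (auto simp: J_def)
  ultimately have "J = P \<or> 1 \<in> J" using max by blast
  then show "a \<in> P \<or> b \<in> P"
  proof
    assume "1 \<in> J"
    then have "1 * 1 * b \<in> P" using R_1 unfolding J_def by blast
    then show ?thesis by simp
  qed (use ab in \<open>auto simp: J_def\<close>)
qed (rule P)+

text \<open>If \<open>P\<close> had trivial inverse, then in products of ideals contained in \<open>nR\<close> the factor \<open>P\<close> could be
  cancelled. As every ideal contains a product of primes, it could be replaced in such products by
  some \<open>V\<close> outside \<open>P\<close>; for the ideal \<open>nR\<close> itself this is absurd.\<close>

definition good where
  "good P X \<longleftrightarrow> (\<exists>V. mclosed V \<and> \<not> V \<subseteq> P \<and>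
     (\<forall>W. mclosed W \<longrightarrow> (\<forall>a\<in>W. \<forall>x\<in>X. a * x \<in> NR) \<longrightarrow> (\<forall>a\<in>W. \<forall>v\<in>V. a * v \<in> NR)))"

lemma mclosed_tid: "tid X \<Longrightarrow> mclosed X"
  unfolding mclosed_def using lid_subset[OF tid_lid] lid_mult[OF tid_lid] tid_mult by blast

lemma mclosed_prod:
  assumes "mclosed V" "mclosed W" shows "mclosed {v * w | v w. v \<in> V \<and> w \<in> W}"
  unfolding mclosed_def
proof (intro conjI ballI)
  show "{v * w | v w. v \<in> V \<and> w \<in> W} \<subseteq> R" using assms R_mult unfolding mclosed_def by blast
  fix a x assume a: "a \<in> R" and "x \<in> {v * w | v w. v \<in> V \<and> w \<in> W}"
  then obtain v w where x: "x = v * w" "v \<in> V" "w \<in> W" by blast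
  have "a * v \<in> V" "w * a \<in> W" using a x assms unfolding mclosed_def by blast+
  moreover have "a * x = (a * v) * w" "x * a = v * (w * a)" using x by (simp_all add: mult.assoc)
  ultimately show "a * x \<in> {v * w | v w. v \<in> V \<and> w \<in> W}" "x * a \<in> {v * w | v w. v \<in> V \<and> w \<in> W}"
    using x by blast+
qed

text \<open>Induction from larger ideals to smaller ones. An ideal not contained in P is its own V;
  by maximality of primes this covers every prime other than P. A proper ideal that is not prime
  contains a product of two strictly larger ideals, whose sets V are multiplied.\<close>

lemma good_all:
  assumes P: "pid P" and inv: "\<And>y. (\<forall>b\<in>P. y * b \<in> R) \<Longrightarrow> y \<in> R" and X: "tid X"
  shows "good P X"
  using X
proof (induction "card T0 - card (X \<inter> T0)" arbitrary: X rule: less_induct)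
  case less
  have tP: "tid P" "1 \<notin> P" and prime: "\<And>a b. a \<in> R \<Longrightarrow> b \<in> R \<Longrightarrow> (\<forall>r\<in>R. a * r * b \<in> P) \<Longrightarrow> a \<in> P \<or> b \<in> P"
    using P by (auto simp: pid_def)
  note lX = tid_lid[OF less.prems] and lP = tid_lid[OF tP(1)]
  have self: "good P X" if "\<not> X \<subseteq> P"
    unfolding good_def using mclosed_tid[OF less.prems] that by blast
  consider "1 \<in> X" | "X = P" | "pid X" "X \<noteq> P" | "1 \<notin> X" "\<not> pid X" by blast
  then show ?case
  proof cases
    case 1 then show ?thesis using self tP(2) by blast
  next
    case 2
    \<comment> \<open>Cancellation of P: a / n maps P into R, so it lies in R by \<open>inv\<close>,
      and V = R can be taken.\<close>
    have "a \<in> NR" if "\<forall>x\<in>P. a * x \<in> NR" for a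
      using inv[of "(1 / real n) *\<^sub>R a"] that by (simp add: NR_def)
    then have "\<forall>W. mclosed W \<longrightarrow> (\<forall>a\<in>W. \<forall>x\<in>X. a * x \<in> NR) \<longrightarrow> (\<forall>a\<in>W. \<forall>v\<in>R. a * v \<in> NR)"
      using 2 NR_mult(2) by blast
    moreover have "mclosed R" "\<not> R \<subseteq> P" using R_mult R_1 tP(2) by (auto simp: mclosed_def)
    ultimately show ?thesis unfolding good_def by blast
  next
    case 3
    then have "\<not> X \<subset> P" using pid_imp_maximal[OF 3(1) tP(1)] tP(2) by blast
    then show ?thesis using self 3(2) by blast
  next
    case 4
    then obtain a b where ab: "a \<in> R" "b \<in> R" "\<And>r. r \<in> R \<Longrightarrow> a * r * b \<in> X" "a \<notin> X" "b \<notin> X"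
      using less.prems unfolding pid_def by blast
    \<comment> \<open>With a R b inside X, the ideal \<open>X1\<close> contains a and its right
      annihilator \<open>X2\<close> modulo X contains b; both are strictly larger than X, and their
      product lies in X.\<close>
    define X1 where "X1 = {x \<in> R. \<forall>r\<in>R. x * r * b \<in> X}"
    define X2 where "X2 = {y \<in> R. \<forall>x\<in>X1. x * y \<in> X}"
    have X1r: "x * r \<in> X1" if "x \<in> X1" "r \<in> R" for x r
    proof -
      have "x * r * s * b \<in> X" if s: "s \<in> R" for s
      proof -
        have "x * (r * s) * b \<in> X" using \<open>x \<in> X1\<close> R_mult[OF \<open>r \<in> R\<close> s] unfolding X1_def by blast
        then show ?thesis by (simp add: mult.assoc)
      qed
      then show ?thesis using that R_mult unfolding X1_def by blast
    qed
    have t1: "tid X1"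
      unfolding tid_def
    proof
      show "lid X1"
      proof (rule lidI)
        show "NR \<subseteq> X1" using NR_subset NR_mult ab(2) lid_NR[OF lX] by (auto simp: X1_def)
        show "x - y \<in> X1" if "x \<in> X1" "y \<in> X1" for x y
          using that lid_diff[OF lX] by (auto simp: X1_def R_diff left_diff_distrib)
        show "c * x \<in> X1" if "c \<in> R" "x \<in> X1" for c x
          using that lid_mult[OF lX that(1)] by (auto simp: X1_def R_mult mult.assoc)
      qed (auto simp: X1_def)
    qed (use X1r in blast)
    have t2: "tid X2"
      unfolding tid_def
    proof
      show "lid X2"
      proof (rule lidI)
        show "NR \<subseteq> X2" using NR_subset NR_mult(1) lid_NR[OF lX] by (auto simp: X2_def X1_def)
        show "x - y \<in> X2" if "x \<in> X2" "y \<in> X2" for x y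
          using that lid_diff[OF lX] by (auto simp: X2_def R_diff right_diff_distrib)
        show "c * x \<in> X2" if "c \<in> R" "x \<in> X2" for c x
          using that X1r[OF _ that(1)] by (auto simp: X2_def R_mult mult.assoc[symmetric])
      qed (auto simp: X2_def)
      show "\<forall>a\<in>R. \<forall>b\<in>X2. b * a \<in> X2"
        using tid_mult[OF less.prems] by (auto simp: X2_def R_mult mult.assoc[symmetric])
    qed
    have "X \<subseteq> X1" using lid_subset[OF lX] tid_mult[OF less.prems] ab(2) by (auto simp: X1_def)
    moreover have "a \<in> X1" using ab by (simp add: X1_def)
    ultimately have X1: "X \<subset> X1" using ab(4) by blast
    have "X \<subseteq> X2" using lid_subset[OF lX] lid_mult[OF lX] by (auto simp: X2_def X1_def)
    moreover have "b \<in> X2"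
    proof -
      have "x * b \<in> X" if "x \<in> X1" for x
      proof -
        have "x * 1 * b \<in> X" using that R_1 unfolding X1_def by blast
        then show ?thesis by simp
      qed
      then show ?thesis using ab(2) by (simp add: X2_def)
    qed
    ultimately have X2: "X \<subset> X2" using ab(5) by blast
    have le: "card (Y \<inter> T0) \<le> card T0" for Y using T0(1) by (intro card_mono) auto
    have "good P X1" "good P X2"
      using less.hyps[OF _ t1] less.hyps[OF _ t2] lid_card_less[OF lX tid_lid[OF t1] X1]
        lid_card_less[OF lX tid_lid[OF t2] X2] le[of X1] le[of X2] by auto
    then obtain V1 V2 where V1: "mclosed V1" "\<not> V1 \<subseteq> P" and V2: "mclosed V2" "\<not> V2 \<subseteq> P"
      and V1X: "\<And>W a v. mclosed W \<Longrightarrow> (\<forall>a\<in>W. \<forall>x\<in>X1. a * x \<in> NR) \<Longrightarrow> a \<in> W \<Longrightarrow> v \<in> V1 \<Longrightarrow> a * v \<in> NR"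
      and V2X: "\<And>W a v. mclosed W \<Longrightarrow> (\<forall>a\<in>W. \<forall>x\<in>X2. a * x \<in> NR) \<Longrightarrow> a \<in> W \<Longrightarrow> v \<in> V2 \<Longrightarrow> a * v \<in> NR"
      unfolding good_def by (elim exE conjE) blast
    define V where "V = {v1 * v2 | v1 v2. v1 \<in> V1 \<and> v2 \<in> V2}"
    have "mclosed V" unfolding V_def by (rule mclosed_prod[OF V1(1) V2(1)])
    moreover have "\<not> V \<subseteq> P"
    proof
      assume VP: "V \<subseteq> P"
      obtain v1 v2 where v: "v1 \<in> V1" "v1 \<notin> P" "v2 \<in> V2" "v2 \<notin> P" using V1(2) V2(2) by blast
      have "v1 * r * v2 \<in> P" if "r \<in> R" for r
      proof -
        have "v1 * r \<in> V1" using V1(1) v(1) that unfolding mclosed_def by blast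
        then show ?thesis using VP v(3) unfolding V_def by blast
      qed
      then show False using prime[of v1 v2] v V1(1) V2(1) unfolding mclosed_def by blast
    qed
    moreover have "a * v \<in> NR" if W: "mclosed W" "\<forall>a\<in>W. \<forall>x\<in>X. a * x \<in> NR" and a: "a \<in> W" and v: "v \<in> V" for W a v
    proof -
      obtain v1 v2 where v12: "v = v1 * v2" "v1 \<in> V1" "v2 \<in> V2" using v unfolding V_def by blast
      have m1: "mclosed X1" by (rule mclosed_tid[OF t1])
      \<comment> \<open>The hypothesis on V2 replaces a right factor only, so products are rotated
        by \<open>mclosed_commute\<close>: from (W X1) X2 to (W X1) V2, then V2 W X1, V2 W V1 and
        finally W V1 V2, each inside nR.\<close>
      have s1: "a * x1 * w2 \<in> NR" if "a \<in> W" "x1 \<in> X1" "w2 \<in> V2" for a x1 w2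
      proof (rule V2X[OF mclosed_prod[OF W(1) m1] _ _ that(3)])
        show "\<forall>a\<in>{v * w | v w. v \<in> W \<and> w \<in> X1}. \<forall>x\<in>X2. a * x \<in> NR"
          using W(2) unfolding X2_def by (auto simp: mult.assoc)
        show "a * x1 \<in> {v * w | v w. v \<in> W \<and> w \<in> X1}" using that by blast
      qed
      have s2: "w2 * (a * x1) \<in> NR" if "a \<in> W" "x1 \<in> X1" "w2 \<in> V2" for a x1 w2
        by (rule mclosed_commute[OF mclosed_prod[OF W(1) m1] V2(1) _ _ that(3)]) (use that s1 in auto)
      have s3: "w2 * a * w1 \<in> NR" if "a \<in> W" "w1 \<in> V1" "w2 \<in> V2" for a w1 w2
      proof (rule V1X[OF mclosed_prod[OF V2(1) W(1)] _ _ that(2)])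
        show "\<forall>a\<in>{v * w | v w. v \<in> V2 \<and> w \<in> W}. \<forall>x\<in>X1. a * x \<in> NR"
          using s2 by (auto simp: mult.assoc)
        show "w2 * a \<in> {v * w | v w. v \<in> V2 \<and> w \<in> W}" using that by blast
      qed
      have "a * v1 * v2 \<in> NR"
        by (rule mclosed_commute[OF V2(1) mclosed_prod[OF W(1) V1(1)] _ v12(3)])
          (use s3 a v12 in \<open>auto simp: mult.assoc\<close>)
      then show ?thesis by (simp add: v12(1) mult.assoc)
    qed
    ultimately show ?thesis unfolding good_def by blast
  qed
qed

text \<open>A proper T lies in an ideal P maximal among the proper ones, which is prime and inherits
  the trivial inverse. Then \<open>good_all\<close> for nR, tested with W = R, gives a set V inside
  nR and hence inside P, a contradiction.\<close>

lemma no_proper_dense_ideal: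
  assumes T: "tid T" and inv: "\<And>y. (\<forall>b\<in>T. y * b \<in> R) \<Longrightarrow> y \<in> R"
  shows "1 \<in> T"
proof (rule ccontr)
  assume "1 \<notin> T"
  let ?Q = "\<lambda>P. tid P \<and> T \<subseteq> P \<and> 1 \<notin> P"
  have QT: "?Q T" using T \<open>1 \<notin> T\<close> by blast
  have Qb: "\<forall>P. ?Q P \<longrightarrow> card (P \<inter> T0) < Suc (card T0)"
    using T0(1) by (auto simp: less_Suc_eq_le intro: card_mono)
  from ex_has_greatest_nat[of ?Q, OF QT Qb]
  obtain P where P': "?Q P \<and> (\<forall>Y. ?Q Y \<longrightarrow> card (Y \<inter> T0) \<le> card (P \<inter> T0))" ..
  then have P: "tid P" "T \<subseteq> P" "1 \<notin> P" and max: "\<And>Y. ?Q Y \<Longrightarrow> card (Y \<inter> T0) \<le> card (P \<inter> T0)" by simp_all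
  have "pid P"
  proof (rule maximal_imp_pid[OF P(1,3)])
    fix Y assume Y: "tid Y" "P \<subseteq> Y" "1 \<notin> Y"
    then have "card (Y \<inter> T0) \<le> card (P \<inter> T0)" using max P(2) by blast
    then show "Y = P" using lid_card_less[OF tid_lid[OF P(1)] tid_lid[OF Y(1)]] Y(2) by fastforce
  qed
  moreover have "y \<in> R" if "\<forall>b\<in>P. y * b \<in> R" for y using inv that P(2) by blast
  ultimately have "good P NR" using good_all tid_NR by blast
  then obtain V where V: "mclosed V" "\<not> V \<subseteq> P" and
    W: "\<And>W. mclosed W \<Longrightarrow> (\<forall>a\<in>W. \<forall>x\<in>NR. a * x \<in> NR) \<Longrightarrow> (\<forall>a\<in>W. \<forall>v\<in>V. a * v \<in> NR)"
    unfolding good_def by blast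
  have "mclosed R" using R_mult by (auto simp: mclosed_def)
  then have "\<forall>a\<in>R. \<forall>v\<in>V. a * v \<in> NR" using W NR_mult(1) by blast
  then have "\<forall>v\<in>V. 1 * v \<in> NR" using R_1 by blast
  then have "V \<subseteq> NR" by auto
  then show False using V(2) lid_NR[OF tid_lid[OF P(1)]] by blast
qed

end

context maximal_order
begin

text \<open>A positive integer n in T puts nR inside T, and R / nR is finite; this provides the
  setting of \<open>order_mod\<close>.\<close>

lemma dense_ideal:
  assumes T: "frac T" "T \<subseteq> R" and inv: "\<And>y. (\<forall>b\<in>T. y * b \<in> R) \<Longrightarrow> y \<in> R"
  shows "1 \<in> T"
proof -
  have T': "int_module.subspace T" "\<And>a b. a \<in> R \<Longrightarrow> b \<in> T \<Longrightarrow> a * b \<in> T" "\<And>a b. a \<in> R \<Longrightarrow> b \<in> T \<Longrightarrow> b * a \<in> T"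
    using T(1) by (auto simp: frac_def)
  obtain n :: nat where n: "n \<ge> 1" "of_nat n \<in> T" using T(1) unfolding frac_def by blast
  let ?M = "(*\<^sub>R) (real n) ` R"
  have mem: "x \<in> ?M \<longleftrightarrow> (1 / real n) *\<^sub>R x \<in> R" for x
    using n(1) by (auto simp: image_iff intro!: bexI[of _ "(1 / real n) *\<^sub>R x"])
  obtain k where "has_index R ?M k"
    using index_det[OF R_full(1) int_subspace_image[OF linear_scale_self R_subspace, of "real n"] _ n(1)] R_scale_nat by auto
  then obtain T0 where T0: "finite T0" "card T0 = k" "T0 \<subseteq> R" "\<forall>x\<in>R. \<exists>t\<in>T0. x - t \<in> ?M"
    "\<forall>s\<in>T0. \<forall>t\<in>T0. s - t \<in> ?M \<longrightarrow> s = t" by (rule has_indexE)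
  interpret om: order_mod A R n T0
    using n(1) T0 by unfold_locales (auto simp: mem)
  have "om.NR \<subseteq> T"
  proof
    fix z assume "z \<in> om.NR"
    then obtain r where r: "r \<in> R" "z = real n *\<^sub>R r" by (auto simp: om.NR_iff)
    then have "z = r * of_nat n" by (simp add: scaleR_conv_of_real mult_of_nat_commute)
    then show "z \<in> T" using T'(2)[OF r(1) n(2)] by simp
  qed
  then have "om.tid T" unfolding om.tid_def om.lid_def using T' T(2) by blast
  then show ?thesis using om.no_proper_dense_ideal inv by blast
qed

section \<open>The codifferent and its inverse\<close>

text \<open>The Euclidean product is half the reduced trace form, so this is twice the usual inverse
  different.\<close>

definition codiff :: "'k set" where "codiff = zdual R"

lemma codiff_subspace: "int_module.subspace codiff"
  unfolding codiff_def by (rule zdual_subspace)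

lemma codiff_mult: "a \<in> R \<Longrightarrow> z \<in> codiff \<Longrightarrow> a * z \<in> codiff" "a \<in> R \<Longrightarrow> z \<in> codiff \<Longrightarrow> z * a \<in> codiff"
proof -
  assume a: "a \<in> R" and z: "z \<in> codiff"
  have "(a * z) \<bullet> x \<in> \<int>" "(z * a) \<bullet> x \<in> \<int>" if "x \<in> R" for x
    using z R_mult[OF kcnj_R[OF a] that] R_mult[OF that kcnj_R[OF a]]
    unfolding inner_mult_left[of a z] inner_mult_right[of z a] codiff_def zdual_def by blast+
  then show "a * z \<in> codiff" "z * a \<in> codiff" unfolding codiff_def zdual_def by blast+
qed

lemma codiff_kcnj: "z \<in> codiff \<Longrightarrow> kcnj z \<in> codiff"
proof -
  assume z: "z \<in> codiff"
  have "kcnj z \<bullet> x \<in> \<int>" if "x \<in> R" for x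
    using z kcnj_R[OF that] inner_kcnj[of z "kcnj x"] unfolding codiff_def zdual_def kcnj_kcnj by auto
  then show "kcnj z \<in> codiff" unfolding codiff_def zdual_def by blast
qed

lemma codiff_inner_1: "z \<in> codiff \<Longrightarrow> z \<bullet> 1 \<in> \<int>"
  unfolding codiff_def zdual_def using R_1 by blast

lemma two_R_codiff: "x \<in> R \<Longrightarrow> 2 *\<^sub>R x \<in> codiff"
  unfolding codiff_def zdual_def using two_inner by simp

lemma codiff_full: "is_lattice codiff" "span codiff = UNIV" "lattice_det R * lattice_det codiff = 1"
  unfolding codiff_def by (rule zdual_full[OF R_full])+

lemma codiff_denominator: "\<exists>d::nat. d \<ge> 1 \<and> (\<forall>z\<in>codiff. real d *\<^sub>R z \<in> R)"
proof -
  have l: "is_lattice ((*\<^sub>R) 2 ` R)" using R_full(1) by (intro is_lattice_scale) auto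
  have "span ((*\<^sub>R) 2 ` R) = UNIV"
  proof -
    have "dim ((*\<^sub>R) 2 ` R) = DIM('k)" using dim_scale[OF _ R_full(1), of 2] full_lattice_dim[OF R_full(2)] by simp
    then show ?thesis by (metis dim_eq_full dim_span span_span)
  qed
  then have "span ((*\<^sub>R) 2 ` R) = span codiff" using codiff_full by simp
  then obtain d where d: "d \<ge> 1" "\<And>z. z \<in> codiff \<Longrightarrow> real d *\<^sub>R z \<in> (*\<^sub>R) 2 ` R"
    using commensurable[OF codiff_full(1) l] two_R_codiff by blast
  have "real d *\<^sub>R z \<in> R" if "z \<in> codiff" for z
    using d(2)[OF that] R_scale[of _ 2] by auto
  with d(1) show ?thesis by blast
qed

lemma frac_codiff: "frac codiff"
proof -
  obtain d :: nat where "d \<ge> 1" "\<And>z. z \<in> codiff \<Longrightarrow> real d *\<^sub>R z \<in> R" using codiff_denominator by blast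
  moreover have "of_nat 2 \<in> codiff" using two_R_codiff[OF R_1] by (simp add: scaleR_conv_of_real)
  ultimately show ?thesis unfolding frac_def using codiff_subspace codiff_mult by (metis one_le_numeral)
qed

definition diff_ideal :: "'k set" where "diff_ideal = {y. \<forall>b\<in>codiff. y * b \<in> R}"

lemma diff_ideal_iff: "y \<in> diff_ideal \<longleftrightarrow> (\<forall>b\<in>codiff. b * y \<in> R)"
  unfolding diff_ideal_def using frac_inv_sym[OF frac_codiff] by simp

lemma frac_diff_ideal: "frac diff_ideal"
proof -
  obtain d :: nat where d: "d \<ge> 1" "\<And>z. z \<in> codiff \<Longrightarrow> real d *\<^sub>R z \<in> R" using codiff_denominator by blast
  have "of_nat d \<in> diff_ideal" using d(2) by (simp add: diff_ideal_def scaleR_conv_of_real)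
  moreover have "real 2 *\<^sub>R y \<in> R" if "y \<in> diff_ideal" for y
  proof -
    have "y * (2 *\<^sub>R 1) \<in> R" using two_R_codiff[OF R_1] that unfolding diff_ideal_def by blast
    then show ?thesis by simp
  qed
  moreover have "a * y \<in> diff_ideal" "y * a \<in> diff_ideal" if "a \<in> R" "y \<in> diff_ideal" for a y
  proof -
    show "a * y \<in> diff_ideal" using that R_mult by (auto simp: diff_ideal_def mult.assoc)
    show "y * a \<in> diff_ideal" using that R_mult by (auto simp: diff_ideal_iff mult.assoc[symmetric])
  qed
  moreover have "int_module.subspace diff_ideal"
    by (rule int_subspaceI) (auto simp: diff_ideal_def R_0 left_diff_distrib R_diff)
  ultimately show ?thesis unfolding frac_def using d(1) by (metis one_le_numeral)
qed

text \<open>Let T be the product of \<open>codiff\<close> with its inverse ideal. If y T lies in R,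
  so does T y; then \<open>diff_ideal\<close> y lies in \<open>diff_ideal\<close>, and y is a right
  multiplier, hence in R. Thus T has trivial inverse and \<open>dense_ideal\<close> applies.\<close>

lemma codiff_invertible: "1 \<in> int_module.span {a * b | a b. a \<in> codiff \<and> b \<in> diff_ideal}" (is "_ \<in> int_module.span ?S")
proof (rule dense_ideal)
  let ?T = "int_module.span ?S"
  show TR: "?T \<subseteq> R"
    by (rule int_module.span_minimal[OF _ R_subspace]) (auto simp: diff_ideal_iff)
  have two: "a * x \<in> ?T \<and> x * a \<in> ?T" if a: "a \<in> R" and x: "x \<in> ?T" for a x
    using x
  proof (induction rule: int_module.span_induct_alt)
    case base show ?case by (simp add: int_module.span_zero)
  next
    case (step c x y)
    obtain u v where uv: "x = u * v" "u \<in> codiff" "v \<in> diff_ideal" using step(1) by blast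
    have m: "a * u \<in> codiff" "v * a \<in> diff_ideal"
      using codiff_mult(1)[OF a uv(2)] frac_diff_ideal uv(3) a by (auto simp: frac_def)
    have "a * x = (a * u) * v" "x * a = u * (v * a)" using uv by (simp_all add: mult.assoc)
    then have "a * x \<in> ?T" "x * a \<in> ?T" using m uv by (blast intro: int_module.span_base)+
    then show ?case
      using step by (simp add: distrib_left distrib_right int_module.span_add int_module.span_scale)
  qed
  obtain d :: nat where d: "d \<ge> 1" "\<And>z. z \<in> codiff \<Longrightarrow> real d *\<^sub>R z \<in> R" using codiff_denominator by blast
  have "of_nat d \<in> diff_ideal" using d(2) by (simp add: diff_ideal_def scaleR_conv_of_real)
  moreover have "(of_nat 2 :: 'k) \<in> codiff" using two_R_codiff[OF R_1] by (simp add: scaleR_conv_of_real)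
  ultimately have "of_nat 2 * of_nat d \<in> ?T" by (blast intro: int_module.span_base)
  then have "of_nat (2 * d) \<in> ?T" by simp
  moreover have "2 * d \<ge> 1" using d(1) by simp
  ultimately have "\<exists>d::nat. d \<ge> 1 \<and> of_nat d \<in> ?T" by blast
  moreover have "\<exists>e::nat. e \<ge> 1 \<and> (\<forall>b\<in>?T. real e *\<^sub>R b \<in> R)" using TR by (intro exI[of _ 1]) auto
  ultimately show fT: "frac ?T" unfolding frac_def using two int_module.subspace_span by blast
  fix y assume "\<forall>b\<in>?T. y * b \<in> R"
  then have y: "\<forall>b\<in>?T. b * y \<in> R" using frac_inv_sym[OF fT] by blast
  have D: "int_module.subspace diff_ideal" "\<And>a b. a \<in> R \<Longrightarrow> b \<in> diff_ideal \<Longrightarrow> b * a \<in> diff_ideal"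
    using frac_diff_ideal by (auto simp: frac_def)
  obtain p q :: nat where pq: "p \<ge> 1" "of_nat p \<in> diff_ideal" "q \<ge> 1" "\<And>b. b \<in> diff_ideal \<Longrightarrow> real q *\<^sub>R b \<in> R"
    using frac_diff_ideal unfolding frac_def by blast
  show "y \<in> R"
  proof (rule right_multiplier[OF D pq])
    fix v assume v: "v \<in> diff_ideal"
    have "u * (v * y) \<in> R" if "u \<in> codiff" for u
    proof -
      have "u * v \<in> ?T" using that v by (blast intro: int_module.span_base)
      then show ?thesis using y by (auto simp: mult.assoc)
    qed
    then show "v * y \<in> diff_ideal" by (simp add: diff_ideal_iff)
  qed
qed

end

section \<open>Hermitian spaces\<close>

context hermitian_space
begin

lemma sc_1 [simp]: "sc 1 x = x"
  using scale_of_real[of 1 x] by simp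

lemma sc_0 [simp]: "sc 0 x = 0"
  using scale_of_real[of 0 x] by simp

lemma sc_scaleR: "sc (t *\<^sub>R a) x = t *\<^sub>R sc a x"
  using scale_scale[of "of_real t" a x] by (simp add: scale_of_real scaleR_conv_of_real)

lemma sc_scaleR_right: "sc a (t *\<^sub>R x) = t *\<^sub>R sc a x"
proof -
  have "sc a (sc (of_real t) x) = sc (of_real t) (sc a x)"
    unfolding scale_scale by (simp add: of_real_def)
  then show ?thesis by (simp only: scale_of_real)
qed

lemma linear_sc: "linear (sc a)"
  by (rule linearI) (simp_all add: scale_add_right sc_scaleR_right)

lemma linear_sc_left: "linear (\<lambda>a. sc a x)"
  by (rule linearI) (simp_all add: scale_add_left sc_scaleR)

lemma sc_zero_right [simp]: "sc a 0 = 0"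
  by (rule linear_0[OF linear_sc])


lemma sc_diff_left: "sc (a - b) x = sc a x - sc b x"
  by (rule linear_diff[OF linear_sc_left])


lemma sc_inverse: "a \<noteq> 0 \<Longrightarrow> sc (inverse a) (sc a x) = x"
  by (simp add: scale_scale)

lemma h_scale_right: "h x (sc a y) = h x y * kcnj a"
  by (subst (1 2) h_sym) (simp add: h_scale_left kcnj_mult)

lemma h_add_right: "h x (y + z) = h x y + h x z"
  by (subst (1 2 3) h_sym) (simp add: h_add_left kcnj_add)

lemma linear_h_left: "linear (\<lambda>x. h x y)"
proof (rule linearI)
  show "h (t *\<^sub>R x) y = t *\<^sub>R h x y" for t x
    using h_scale_left[of "of_real t" x y] by (simp add: scale_of_real scaleR_conv_of_real)
qed (rule h_add_left)

lemma linear_h_right: "linear (\<lambda>y. h x y)"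
proof (rule linearI)
  show "h x (t *\<^sub>R y) = t *\<^sub>R h x y" for t y
  proof -
    have "h x (t *\<^sub>R y) = h x y * of_real t" using h_scale_right[of x "of_real t" y] by (simp add: scale_of_real)
    then show ?thesis by (simp add: of_real_def)
  qed
qed (rule h_add_right)

lemma inner_eq_h: "x \<bullet> y = h x y \<bullet> 1"
proof -
  have "(of_real (x \<bullet> y) :: 'k) = of_real (h x y \<bullet> 1)"
    unfolding inner_h of_real_inner by simp
  then show ?thesis by simp
qed

lemma inner_sc: "sc a x \<bullet> y = x \<bullet> sc (kcnj a) y"
  unfolding inner_eq_h h_scale_left h_scale_right kcnj_kcnj by (rule inner_mult_1_commute)

lemma inner_sc_sc: "sc a x \<bullet> sc b x = (a \<bullet> b) * (x \<bullet> x)"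
proof -
  have "sc a x \<bullet> sc b x = (a * (x \<bullet> x) *\<^sub>R kcnj b) \<bullet> 1"
    unfolding inner_eq_h[of "sc a x"] by (simp add: h_scale_left h_scale_right h_self mult.assoc scaleR_conv_of_real)
  then show ?thesis by (simp add: inner_eq_mult_1[of a b] mult.commute)
qed

text \<open>Testing with a = kcnj (h x y) produces the norm of h x y. Orthogonality of K-subspaces
  is therefore the same for h and for the Euclidean product.\<close>

lemma h_eq_0_iff: "(\<forall>a. sc a x \<bullet> y = 0) \<longleftrightarrow> h x y = 0"
proof
  assume "\<forall>a. sc a x \<bullet> y = 0"
  then have "(kcnj (h x y) * h x y) \<bullet> 1 = 0" by (simp add: inner_eq_h h_scale_left)
  then show "h x y = 0" by (simp add: kcnj_mult_self of_real_def flip: power2_norm_eq_inner)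
qed (simp add: inner_eq_h h_scale_left)

end

text \<open>Multiplicativity of the index, read off from the multiplicativity of ratios of
  determinants.\<close>

lemma index_tower:
  fixes M :: "'v::euclidean_space set"
  assumes M: "is_lattice M" and X: "int_module.subspace X" "X \<subseteq> M" and P: "int_module.subspace P" "P \<subseteq> X"
    and d: "d \<ge> 1" "\<And>x. x \<in> M \<Longrightarrow> real d *\<^sub>R x \<in> P"
  obtains i j where "i \<ge> 1" "j \<ge> 1" "has_index X P i" "has_index M X j" "has_index M P (i * j)"
proof -
  have PM: "P \<subseteq> M" using X P by blast
  have lX: "is_lattice X" by (rule is_lattice_subset[OF M X])
  obtain k where k: "k \<ge> 1" "has_index M P k" "lattice_det P = (real k)\<^sup>2 * lattice_det M"
    using index_det[OF M P(1) PM d] by blast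
  obtain i where i: "i \<ge> 1" "has_index X P i" "lattice_det P = (real i)\<^sup>2 * lattice_det X"
    using index_det[OF lX P d(1)] d(2) X(2) by blast
  obtain j where j: "j \<ge> 1" "has_index M X j" "lattice_det X = (real j)\<^sup>2 * lattice_det M"
    using index_det[OF M X d(1)] d(2) P(2) by blast
  have "(real k)\<^sup>2 * lattice_det M = (real (i * j))\<^sup>2 * lattice_det M"
    using i(3) j(3) k(3) by (simp add: power_mult_distrib)
  then have "(real k)\<^sup>2 = (real (i * j))\<^sup>2" using lattice_det_pos[OF M] by simp
  then have "k = i * j" by (simp only: power2_eq_iff_nonneg of_nat_0_le_iff of_nat_eq_iff)
  then show ?thesis using that i j k by blast
qed

section \<open>Lattices over the order and their two duals\<close>

locale O_hermitian = maximal_order A R + hermitian_space sc h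
  for A R :: "'k::conj_div_algebra set" and sc :: "'k \<Rightarrow> 'v::euclidean_space \<Rightarrow> 'v" and h :: "'v \<Rightarrow> 'v \<Rightarrow> 'k"
begin

abbreviation Olat where "Olat \<equiv> is_O_lattice R sc"
abbreviation dualO where "dualO \<equiv> O_dual R h"

lemma OlatD: "Olat M \<Longrightarrow> is_lattice M" "Olat M \<Longrightarrow> span M = UNIV" "Olat M \<Longrightarrow> a \<in> R \<Longrightarrow> x \<in> M \<Longrightarrow> sc a x \<in> M"
  "Olat M \<Longrightarrow> int_module.subspace M"
  by (auto simp: is_O_lattice_def is_lattice_subspace)

lemma Olat_between:
  assumes N: "Olat N" and M: "Olat M" and X: "N \<subseteq> X" "X \<subseteq> M" "int_module.subspace X"
    "\<And>a x. a \<in> R \<Longrightarrow> x \<in> X \<Longrightarrow> sc a x \<in> X"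
  shows "Olat X"
  unfolding is_O_lattice_def
  using is_lattice_subset[OF OlatD(1)[OF M] X(3,2)] span_mono[OF X(1)] OlatD(2)[OF N] X(4) by blast

lemma Olat_commensurable:
  assumes "Olat N" "Olat M" "N \<subseteq> M" shows "\<exists>d::nat. d \<ge> 1 \<and> (\<forall>x\<in>M. real d *\<^sub>R x \<in> N)"
proof -
  have "span N = span M" using OlatD(2)[OF assms(1)] OlatD(2)[OF assms(2)] by simp
  from commensurable[OF OlatD(1)[OF assms(2)] OlatD(1)[OF assms(1)] assms(3) this]
  show ?thesis by metis
qed

lemma Olat_zdual: assumes M: "Olat M" shows "Olat (zdual M)"
  unfolding is_O_lattice_def
proof (intro conjI ballI)
  show "is_lattice (zdual M)" "span (zdual M) = UNIV" using zdual_full[OF OlatD(1,2)[OF M]] by auto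
  fix a x assume a: "a \<in> R" and x: "x \<in> zdual M"
  show "sc a x \<in> zdual M"
    unfolding zdual_def
  proof (intro CollectI ballI)
    fix y assume "y \<in> M"
    then have "sc (kcnj a) y \<in> M" using OlatD(3)[OF M kcnj_R[OF a]] by blast
    then show "sc a x \<bullet> y \<in> \<int>" using x unfolding inner_sc zdual_def by blast
  qed
qed

lemma dualO_subspace: "int_module.subspace (dualO M)"
  unfolding O_dual_def by (rule int_subspaceI) (auto simp: linear_0[OF linear_h_left] linear_diff[OF linear_h_left] R_0 R_diff)

lemma dualO_mult: "a \<in> R \<Longrightarrow> x \<in> dualO M \<Longrightarrow> sc a x \<in> dualO M"
  unfolding O_dual_def by (auto simp: h_scale_left R_mult)

lemma dualO_antimono: "M \<subseteq> N \<Longrightarrow> dualO N \<subseteq> dualO M"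
  unfolding O_dual_def by blast

lemma zdual_h_codiff:
  assumes M: "Olat M" and y: "y \<in> zdual M" and z: "z \<in> M" shows "h y z \<in> codiff"
  unfolding codiff_def zdual_def
proof (intro CollectI ballI)
  fix r assume r: "r \<in> R"
  have "h y z \<bullet> r = y \<bullet> sc r z" unfolding inner_eq_h[of y] h_scale_right by (rule inner_eq_mult_1)
  also have "\<dots> \<in> \<int>" using y OlatD(3)[OF M r z] unfolding zdual_def by blast
  finally show "h y z \<bullet> r \<in> \<int>" .
qed

text \<open>The O-dual is squeezed between d \<open>zdual M\<close> and half of
  \<open>zdual M\<close>, where d is a common denominator of the codifferent.\<close>

lemma Olat_dualO: assumes M: "Olat M" shows "Olat (dualO M)"
proof -
  note Z = zdual_full[OF OlatD(1,2)[OF M]]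
  have half: "2 *\<^sub>R y \<in> zdual M" if "y \<in> dualO M" for y
    using that two_Re unfolding zdual_def O_dual_def by (auto simp: inner_eq_h[of y])
  have lat: "is_lattice ((*\<^sub>R) (1/2) ` zdual M)" by (rule is_lattice_scale[OF _ Z(1)]) simp
  have "dualO M \<subseteq> (*\<^sub>R) (1/2) ` zdual M"
  proof
    fix y assume "y \<in> dualO M"
    from half[OF this] show "y \<in> (*\<^sub>R) (1/2) ` zdual M" by (intro image_eqI[of _ _ "2 *\<^sub>R y"]) auto
  qed
  then have l: "is_lattice (dualO M)" by (rule is_lattice_subset[OF lat dualO_subspace])
  obtain d :: nat where d: "d \<ge> 1" "\<And>z. z \<in> codiff \<Longrightarrow> real d *\<^sub>R z \<in> R" using codiff_denominator by blast
  have "real d *\<^sub>R y \<in> dualO M" if "y \<in> zdual M" for y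
    using zdual_h_codiff[OF M that] d(2) unfolding O_dual_def by (auto simp: linear_cmul[OF linear_h_left])
  then have "y \<in> span (dualO M)" if "y \<in> zdual M" for y
    using span_scale[OF span_base, of "real d *\<^sub>R y" "dualO M" "1 / real d"] that d(1) by simp
  then have "span (zdual M) \<subseteq> span (dualO M)" by (intro span_minimal) auto
  then have "span (dualO M) = UNIV" using Z(2) by blast
  then show ?thesis using l dualO_mult unfolding is_O_lattice_def by blast
qed

text \<open>For y in \<open>zdual M\<close> the multiples of y by \<open>diff_ideal\<close> lie in
  \<open>dualO M\<close>, so w = h x y multiplied by conjugates of \<open>diff_ideal\<close> stays
  in R. Writing 1 as a sum of products from \<open>codiff\<close> and \<open>diff_ideal\<close> puts
  w into \<open>codiff\<close>. Hence x \<bullet> y is an integer, and x lies in the double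
  Euclidean dual, which is M.\<close>

lemma dualO_dualO: assumes M: "Olat M" shows "dualO (dualO M) = M"
proof
  show "M \<subseteq> dualO (dualO M)"
  proof
    fix x assume x: "x \<in> M"
    have "h x y \<in> R" if "y \<in> dualO M" for y
      using kcnj_R[of "h y x"] that x unfolding O_dual_def by (auto simp: h_sym[of x y])
    then show "x \<in> dualO (dualO M)" unfolding O_dual_def by blast
  qed
  show "dualO (dualO M) \<subseteq> M"
  proof
    fix x assume x: "x \<in> dualO (dualO M)"
    have "x \<bullet> y \<in> \<int>" if y: "y \<in> zdual M" for y
    proof -
      let ?w = "h x y"
      have w: "?w * kcnj a \<in> R" if a: "a \<in> diff_ideal" for a
      proof -
        have "h (sc a y) z \<in> R" if "z \<in> M" for z
          using a zdual_h_codiff[OF M y that] unfolding h_scale_left diff_ideal_def by blast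
        then have "sc a y \<in> dualO M" unfolding O_dual_def by blast
        then have "h x (sc a y) \<in> R" using x unfolding O_dual_def by blast
        then show ?thesis by (simp add: h_scale_right)
      qed
      have "?w * kcnj t \<in> codiff" if "t \<in> int_module.span {a * b | a b. a \<in> codiff \<and> b \<in> diff_ideal}" for t
        using that
      proof (induction rule: int_module.span_induct_alt)
        case base show ?case using int_module.subspace_0[OF codiff_subspace] by simp
      next
        case (step c s t)
        obtain a b where ab: "s = a * b" "a \<in> codiff" "b \<in> diff_ideal" using step(1) by blast
        have "?w * kcnj b * kcnj a \<in> codiff" by (rule codiff_mult(1)[OF w[OF ab(3)] codiff_kcnj[OF ab(2)]])
        then have "of_int c *\<^sub>R (?w * kcnj s) \<in> codiff"
          by (intro int_module.subspace_scale[OF codiff_subspace]) (simp add: ab(1) kcnj_mult mult.assoc)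
        then show ?case
          using int_module.subspace_add[OF codiff_subspace _ step(2)] by (simp add: kcnj_add kcnj_scaleR distrib_left)
      qed
      from this[OF codiff_invertible] show ?thesis using codiff_inner_1 by (simp add: inner_eq_h[of x y])
    qed
    then have "x \<in> zdual (zdual M)" unfolding zdual_def[of "zdual M"] by blast
    then show "x \<in> M" using zdual_full(4)[OF OlatD(1,2)[OF M]] by simp
  qed
qed

subsection \<open>The twist by the codifferent\<close>

text \<open>\<open>twist M\<close> is the product of the codifferent with \<open>M\<close>. It is an automorphism of the lattice of
  \<open>R\<close>-lattices preserving annihilators of quotients, hence also indices.\<close>

definition twist where "twist M = zdual (dualO M)"

lemma Olat_twist: "Olat M \<Longrightarrow> Olat (twist M)"
  unfolding twist_def by (intro Olat_zdual Olat_dualO)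

lemma twist_mono: "M \<subseteq> N \<Longrightarrow> twist M \<subseteq> twist N"
  unfolding twist_def by (intro zdual_antimono dualO_antimono)

lemma untwist:
  assumes "Olat M"
  shows "dualO (zdual (twist M)) = M" "twist (dualO (zdual M)) = M"
proof -
  show "dualO (zdual (twist M)) = M"
    unfolding twist_def using zdual_full(4)[OF OlatD(1,2)[OF Olat_dualO[OF assms]]] dualO_dualO[OF assms] by simp
  show "twist (dualO (zdual M)) = M"
    unfolding twist_def using dualO_dualO[OF Olat_zdual[OF assms]] zdual_full(4)[OF OlatD(1,2)[OF assms]] by simp
qed

lemma untwist_mono: "M \<subseteq> N \<Longrightarrow> dualO (zdual M) \<subseteq> dualO (zdual N)"
  by (intro zdual_antimono dualO_antimono)

section \<open>Annihilators and indices of quotients\<close>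

definition ann where "ann M N = {a \<in> R. \<forall>x\<in>M. sc a x \<in> N}"

lemma ann_subspace: "Olat N \<Longrightarrow> int_module.subspace (ann M N)"
  unfolding ann_def using OlatD(4)[of N]
  by (intro int_subspaceI) (auto simp: R_0 R_diff sc_diff_left int_module.subspace_0 intro: int_module.subspace_diff)

lemma ann_mult: "Olat N \<Longrightarrow> a \<in> R \<Longrightarrow> q \<in> ann M N \<Longrightarrow> a * q \<in> ann M N"
  unfolding ann_def using OlatD(3)[of N a] by (auto simp: R_mult simp flip: scale_scale)

lemma frac_ann:
  assumes N: "Olat N" and M: "Olat M" and NM: "N \<subseteq> M" shows "frac (ann M N)"
proof -
  obtain d where d: "d \<ge> 1" "\<And>x. x \<in> M \<Longrightarrow> real d *\<^sub>R x \<in> N" using Olat_commensurable[OF N M NM] by blast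
  have "of_nat d \<in> ann M N"
    unfolding ann_def using d(2) R_of_nat scale_of_real[of "real d"] by auto
  moreover have "q * a \<in> ann M N" if "a \<in> R" "q \<in> ann M N" for a q
    using that OlatD(3)[OF M that(1)] unfolding ann_def by (auto simp: R_mult simp flip: scale_scale)
  moreover have "\<exists>e::nat. e \<ge> 1 \<and> (\<forall>b\<in>ann M N. real e *\<^sub>R b \<in> R)"
    by (intro exI[of _ 1]) (auto simp: ann_def)
  ultimately show ?thesis
    unfolding frac_def using ann_subspace[OF N] ann_mult[OF N] d(1) by blast
qed

text \<open>For y in \<open>dualO N\<close> and z in M, h y z multiplied on the right by conjugates
  of annihilators lies in R. By \<open>frac_inv_sym\<close> the conjugates may stand on the left,
  where they act on y: kcnj q maps \<open>dualO N\<close> into \<open>dualO M\<close>. Its adjoint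
  is q, which therefore maps \<open>twist M\<close> into \<open>twist N\<close>.\<close>

lemma ann_twist_subset:
  assumes N: "Olat N" and M: "Olat M" and NM: "N \<subseteq> M" shows "ann M N \<subseteq> ann (twist M) (twist N)"
proof
  fix q assume q: "q \<in> ann M N"
  let ?B = "{b. kcnj b \<in> ann M N}"
  have fQ: "frac (ann M N)" by (rule frac_ann[OF N M NM])
  have "frac ?B"
  proof -
    have Q: "int_module.subspace (ann M N)" "\<And>a b. a \<in> R \<Longrightarrow> b \<in> ann M N \<Longrightarrow> a * b \<in> ann M N \<and> b * a \<in> ann M N"
      and d: "\<exists>d::nat. d \<ge> 1 \<and> of_nat d \<in> ann M N"
      using fQ by (auto simp: frac_def)
    have "int_module.subspace ?B"
      by (rule int_subspaceI) (auto simp: kcnj_diff int_module.subspace_0[OF Q(1)] intro: int_module.subspace_diff[OF Q(1)])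
    moreover have "a * b \<in> ?B \<and> b * a \<in> ?B" if "a \<in> R" "b \<in> ?B" for a b
      using Q(2)[OF kcnj_R[OF that(1)]] that(2) by (simp add: kcnj_mult)
    moreover have "\<exists>d::nat. d \<ge> 1 \<and> of_nat d \<in> ?B"
      using d kcnj_of_real[of "real _", where 'k = 'k] unfolding of_real_of_nat_eq by simp
    moreover have "\<exists>e::nat. e \<ge> 1 \<and> (\<forall>b\<in>?B. real e *\<^sub>R b \<in> R)"
    proof (intro exI[of _ 1] conjI ballI)
      fix b assume "b \<in> ?B"
      then have "kcnj b \<in> R" by (simp add: ann_def)
      from kcnj_R[OF this] show "real 1 *\<^sub>R b \<in> R" by (simp add: kcnj_kcnj)
    qed simp
    ultimately show ?thesis unfolding frac_def by blast
  qed
  note sym = frac_inv_sym[OF this]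
  have key: "sc (kcnj q) y \<in> dualO M" if y: "y \<in> dualO N" for y
    unfolding O_dual_def
  proof (intro CollectI ballI)
    fix z assume z: "z \<in> M"
    have "\<forall>b\<in>?B. h y z * b \<in> R"
    proof
      fix b assume "b \<in> ?B"
      then have "sc (kcnj b) z \<in> N" using z by (simp add: ann_def)
      then have "h y (sc (kcnj b) z) \<in> R" using y unfolding O_dual_def by blast
      then show "h y z * b \<in> R" by (simp add: h_scale_right kcnj_kcnj)
    qed
    then have "\<forall>b\<in>?B. b * h y z \<in> R" using sym by blast
    then show "h (sc (kcnj q) y) z \<in> R" using q by (simp add: h_scale_left kcnj_kcnj)
  qed
  have "sc q x \<in> twist N" if x: "x \<in> twist M" for x
    unfolding twist_def zdual_def
  proof (intro CollectI ballI)
    fix y assume "y \<in> dualO N"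
    from key[OF this] show "sc q x \<bullet> y \<in> \<int>"
      using x unfolding inner_sc twist_def zdual_def by blast
  qed
  then show "q \<in> ann (twist M) (twist N)" using q unfolding ann_def by blast
qed

text \<open>The argument of \<open>ann_twist_subset\<close> with the two dualities in the opposite
  order.\<close>

lemma ann_untwist_subset:
  assumes N: "Olat N" and M: "Olat M" and NM: "N \<subseteq> M"
  shows "ann M N \<subseteq> ann (dualO (zdual M)) (dualO (zdual N))"
proof
  fix q assume q: "q \<in> ann M N"
  let ?B = "ann M N"
  have frac: "frac ?B" by (rule frac_ann[OF N M NM])
  have key: "sc (kcnj b) y \<in> zdual M" if y: "y \<in> zdual N" and b: "b \<in> ?B" for y b
    unfolding zdual_def
  proof (intro CollectI ballI)
    fix z assume "z \<in> M"
    then have "sc b z \<in> N" using b by (simp add: ann_def)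
    then show "sc (kcnj b) y \<bullet> z \<in> \<int>" using y unfolding inner_sc kcnj_kcnj zdual_def by blast
  qed
  have "sc q x \<in> dualO (zdual N)" if x: "x \<in> dualO (zdual M)" for x
    unfolding O_dual_def
  proof (intro CollectI ballI)
    fix y assume y: "y \<in> zdual N"
    have "\<forall>b\<in>?B. h x y * b \<in> R"
    proof
      fix b assume "b \<in> ?B"
      from key[OF y this] have "h x (sc (kcnj b) y) \<in> R" using x unfolding O_dual_def by blast
      then show "h x y * b \<in> R" by (simp add: h_scale_right kcnj_kcnj)
    qed
    then have "\<forall>b\<in>?B. b * h x y \<in> R" using frac_inv_sym[OF frac] by blast
    then show "h (sc q x) y \<in> R" using q by (simp add: h_scale_left)
  qed
  then show "q \<in> ann (dualO (zdual M)) (dualO (zdual N))" using q unfolding ann_def by blast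
qed

lemma ann_twist:
  assumes N: "Olat N" and M: "Olat M" and NM: "N \<subseteq> M" shows "ann (twist M) (twist N) = ann M N"
proof
  show "ann M N \<subseteq> ann (twist M) (twist N)" by (rule ann_twist_subset[OF assms])
  show "ann (twist M) (twist N) \<subseteq> ann M N"
    using ann_untwist_subset[OF Olat_twist[OF N] Olat_twist[OF M] twist_mono[OF NM]] untwist(1)[OF M] untwist(1)[OF N] by simp
qed

definition simple_pair where
  "simple_pair N M \<longleftrightarrow> Olat N \<and> Olat M \<and> N \<subset> M \<and> (\<forall>X. Olat X \<longrightarrow> N \<subseteq> X \<longrightarrow> X \<subseteq> M \<longrightarrow> X = N \<or> X = M)"

lemma simple_pair_twist:
  assumes "simple_pair N M" shows "simple_pair (twist N) (twist M)"
  unfolding simple_pair_def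
proof (intro conjI allI impI)
  have N: "Olat N" and M: "Olat M" and NM: "N \<subseteq> M" "N \<noteq> M"
    and s: "\<And>X. Olat X \<Longrightarrow> N \<subseteq> X \<Longrightarrow> X \<subseteq> M \<Longrightarrow> X = N \<or> X = M"
    using assms by (auto simp: simple_pair_def)
  show "Olat (twist N)" "Olat (twist M)" using N M by (simp_all add: Olat_twist)
  have "twist N \<noteq> twist M"
  proof
    assume "twist N = twist M"
    then have "dualO (zdual (twist N)) = dualO (zdual (twist M))" by (rule arg_cong)
    then show False using NM(2) unfolding untwist(1)[OF N] untwist(1)[OF M] by contradiction
  qed
  then show "twist N \<subset> twist M" using twist_mono[OF NM(1)] by blast
  fix X assume X: "Olat X" "twist N \<subseteq> X" "X \<subseteq> twist M"
  let ?Y = "dualO (zdual X)"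
  have "N \<subseteq> ?Y" "?Y \<subseteq> M"
    using untwist_mono[OF X(2)] untwist_mono[OF X(3)] unfolding untwist(1)[OF N] untwist(1)[OF M] by blast+
  then have "?Y = N \<or> ?Y = M" using s[OF Olat_dualO[OF Olat_zdual[OF X(1)]]] by blast
  then have "twist ?Y = twist N \<or> twist ?Y = twist M" by (elim disjE) simp_all
  then show "X = twist N \<or> X = twist M" unfolding untwist(2)[OF X(1)] .
qed

text \<open>L / Q is a minimal left ideal of the ring R / Q.\<close>

definition min_left where
  "min_left Q L \<longleftrightarrow> int_module.subspace L \<and> L \<subseteq> R \<and> (\<forall>a\<in>R. \<forall>b\<in>L. a * b \<in> L) \<and> Q \<subset> L \<and>
     (\<forall>X. int_module.subspace X \<longrightarrow> (\<forall>a\<in>R. \<forall>b\<in>X. a * b \<in> X) \<longrightarrow> Q \<subseteq> X \<longrightarrow> X \<subseteq> L \<longrightarrow> X = Q \<or> X = L)"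

text \<open>R / Q is finite, so a left ideal strictly above Q can be chosen with least index over
  Q.\<close>

lemma min_left_exists:
  assumes Q: "frac Q" "Q \<subset> R" obtains L k where "min_left Q L" "has_index L Q k"
proof -
  have sQ: "int_module.subspace Q" and Qm: "\<And>a b. a \<in> R \<Longrightarrow> b \<in> Q \<Longrightarrow> a * b \<in> Q" using Q by (auto simp: frac_def)
  obtain d :: nat where d: "d \<ge> 1" "of_nat d \<in> Q" using Q unfolding frac_def by blast
  have dR: "real d *\<^sub>R x \<in> Q" if "x \<in> R" for x
    using Qm[OF that d(2)] by (simp add: scaleR_conv_of_real mult_of_nat_commute)
  let ?P = "\<lambda>(L, j). int_module.subspace L \<and> L \<subseteq> R \<and> (\<forall>a\<in>R. \<forall>b\<in>L. a * b \<in> L) \<and> Q \<subset> L \<and> has_index L Q j"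
  obtain k0 where "has_index R Q k0"
    using index_det[OF R_full(1) sQ _ d(1) dR] Q(2) by blast
  then have "?P (R, k0)" using R_subspace R_mult Q(2) by simp
  from ex_has_least_nat[of ?P, OF this, of snd]
  obtain Lj where Lj: "?P Lj \<and> (\<forall>y. ?P y \<longrightarrow> snd Lj \<le> snd y)" ..
  obtain L j where "Lj = (L, j)" by (cases Lj)
  with Lj have L: "int_module.subspace L" "L \<subseteq> R" "\<forall>a\<in>R. \<forall>b\<in>L. a * b \<in> L" "Q \<subset> L" "has_index L Q j"
    and least: "\<And>X i. int_module.subspace X \<Longrightarrow> X \<subseteq> R \<Longrightarrow> (\<forall>a\<in>R. \<forall>b\<in>X. a * b \<in> X) \<Longrightarrow> Q \<subset> X \<Longrightarrow> has_index X Q i \<Longrightarrow> j \<le> i"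
    by auto
  have "X = Q \<or> X = L" if X: "int_module.subspace X" "\<forall>a\<in>R. \<forall>b\<in>X. a * b \<in> X" "Q \<subseteq> X" "X \<subseteq> L" for X
  proof (cases "X = Q")
    case False
    have "\<And>x. x \<in> L \<Longrightarrow> real d *\<^sub>R x \<in> Q" using dR L(2) by blast
    from index_tower[OF is_lattice_subset[OF R_full(1) L(1,2)] X(1,4) sQ X(3) d(1) this]
    obtain i l where il: "i \<ge> 1" "l \<ge> 1" "has_index X Q i" "has_index L X l" "has_index L Q (i * l)" by blast
    have "j = i * l" by (rule has_index_unique[OF sQ L(5) il(5)])
    moreover have "j \<le> i" using least[OF X(1) _ X(2) _ il(3)] L(2) X False by blast
    ultimately have "l = 1" using il(1,2) by simp
    then have "X = L" using has_index_1_eq[OF X(1,4) L(1)] il(4) by simp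
    then show ?thesis ..
  qed simp
  then have "min_left Q L" unfolding min_left_def using L(1-4) by blast
  then show ?thesis using that L(5) by blast
qed

text \<open>Choose x in M such that L x is not inside N. The map from l to l x induces an
  isomorphism of L / Q onto M / N, with Q the annihilator: injective by minimality of L, surjective
  since M / N is simple. So the annihilator determines the index.\<close>

lemma simple_pair_index:
  assumes NM: "simple_pair N M" and L: "min_left (ann M N) L" and k: "has_index L (ann M N) k"
  shows "has_index M N k"
proof -
  have N: "Olat N" and M: "Olat M" and sub: "N \<subset> M"
    and s: "\<And>X. Olat X \<Longrightarrow> N \<subseteq> X \<Longrightarrow> X \<subseteq> M \<Longrightarrow> X = N \<or> X = M"
    using NM by (auto simp: simple_pair_def)
  have sL: "int_module.subspace L" "L \<subseteq> R" "\<And>a b. a \<in> R \<Longrightarrow> b \<in> L \<Longrightarrow> a * b \<in> L" "ann M N \<subset> L"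
    and min: "\<And>X. int_module.subspace X \<Longrightarrow> (\<forall>a\<in>R. \<forall>b\<in>X. a * b \<in> X) \<Longrightarrow> ann M N \<subseteq> X \<Longrightarrow> X \<subseteq> L \<Longrightarrow> X = ann M N \<or> X = L"
    using L unfolding min_left_def by auto
  note N0 = int_module.subspace_0[OF OlatD(4)[OF N]] and Nd = int_module.subspace_diff[OF OlatD(4)[OF N]]
    and Na = int_module.subspace_add[OF OlatD(4)[OF N]]
  obtain l0 x where l0: "l0 \<in> L" "x \<in> M" "sc l0 x \<notin> N" using sL(2,4) unfolding ann_def by blast
  \<comment> \<open>The kernel of the map from l to l x modulo N; it lies between the annihilator
    and L and differs from L.\<close>
  let ?K = "{l \<in> L. sc l x \<in> N}"
  have "?K = ann M N \<or> ?K = L"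
  proof (rule min)
    show "int_module.subspace ?K"
      by (rule int_subspaceI) (auto simp: N0 sc_diff_left Nd int_module.subspace_0[OF sL(1)] int_module.subspace_diff[OF sL(1)])
    show "\<forall>a\<in>R. \<forall>b\<in>?K. a * b \<in> ?K" using sL(3) OlatD(3)[OF N] by (auto simp flip: scale_scale)
    show "ann M N \<subseteq> ?K" using sL(4) l0(2) by (auto simp: ann_def)
  qed blast
  then have K: "?K = ann M N" using l0 by blast
  define X where "X = {sc l x + y | l y. l \<in> L \<and> y \<in> N}"
  have XI: "sc l x + y \<in> X" if "l \<in> L" "y \<in> N" for l y unfolding X_def using that by blast
  have NX: "N \<subseteq> X" using XI[OF int_module.subspace_0[OF sL(1)]] by auto
  have XM: "X \<subseteq> M" unfolding X_def
    using OlatD(3)[OF M _ l0(2)] sL(2) sub int_module.subspace_add[OF OlatD(4)[OF M]] by blast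
  have "Olat X"
  proof (rule Olat_between[OF N M NX XM])
    show "int_module.subspace X"
    proof (rule int_subspaceI)
      show "0 \<in> X" using NX N0 by blast
      fix p q assume "p \<in> X" "q \<in> X"
      then obtain l y l' y' where pq: "p = sc l x + y" "q = sc l' x + y'" "l \<in> L" "l' \<in> L" "y \<in> N" "y' \<in> N"
        unfolding X_def by blast
      then have "p - q = sc (l - l') x + (y - y')" by (simp add: sc_diff_left algebra_simps)
      then show "p - q \<in> X" using XI[OF int_module.subspace_diff[OF sL(1) pq(3,4)] Nd[OF pq(5,6)]] by simp
    qed
    fix a p assume a: "a \<in> R" "p \<in> X"
    then obtain l y where p: "p = sc l x + y" "l \<in> L" "y \<in> N" unfolding X_def by blast
    then have "sc a p = sc (a * l) x + sc a y" by (simp add: scale_add_right scale_scale)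
    then show "sc a p \<in> X" using XI[OF sL(3)[OF a(1) p(2)] OlatD(3)[OF N a(1) p(3)]] by simp
  qed
  moreover have "X \<noteq> N" using XI[OF l0(1) N0] l0(3) by auto
  ultimately have X: "X = M" using s NX XM by blast
  obtain T where T: "finite T" "card T = k" "T \<subseteq> L" "\<forall>x\<in>L. \<exists>t\<in>T. x - t \<in> ann M N"
    "\<forall>s\<in>T. \<forall>t\<in>T. s - t \<in> ann M N \<longrightarrow> s = t"
    using k by (rule has_indexE)
  have eq: "s = t" if "s \<in> T" "t \<in> T" "sc s x - sc t x \<in> N" for s t
  proof -
    have "s - t \<in> ?K" using that T(3) int_module.subspace_diff[OF sL(1)] by (auto simp: sc_diff_left)
    then show ?thesis using K T(5) that by blast
  qed
  have inj: "inj_on (\<lambda>t. sc t x) T" using eq N0 by (intro inj_onI) auto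
  show ?thesis
    unfolding has_index_def
  proof (intro exI[of _ "(\<lambda>t. sc t x) ` T"] conjI ballI impI)
    show "finite ((\<lambda>t. sc t x) ` T)" "card ((\<lambda>t. sc t x) ` T) = k" using T by (simp_all add: card_image[OF inj])
    show "(\<lambda>t. sc t x) ` T \<subseteq> M" using T(3) sL(2) OlatD(3)[OF M _ l0(2)] by blast
  next
    fix z assume "z \<in> M"
    then obtain l y where z: "z = sc l x + y" "l \<in> L" "y \<in> N" using X unfolding X_def by blast
    obtain t where t: "t \<in> T" "l - t \<in> ann M N" using T(4) z(2) by blast
    have "sc (l - t) x \<in> N" using t(2) l0(2) by (simp add: ann_def)
    then have "sc (l - t) x + y \<in> N" using z(3) by (rule Na)
    then have "z - sc t x \<in> N" by (simp add: z(1) sc_diff_left algebra_simps)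
    then show "\<exists>u\<in>(\<lambda>t. sc t x) ` T. z - u \<in> N" using t(1) by blast
  next
    fix u v assume "u \<in> (\<lambda>t. sc t x) ` T" "v \<in> (\<lambda>t. sc t x) ` T" "u - v \<in> N"
    then show "u = v" using eq by blast
  qed
qed

lemma det_twist_simple:
  assumes NM: "simple_pair N M" shows "lattice_det N * lattice_det (twist M) = lattice_det (twist N) * lattice_det M"
proof -
  have N: "Olat N" and M: "Olat M" and sub: "N \<subset> M" using NM by (auto simp: simple_pair_def)
  have f: "frac (ann M N)" using frac_ann[OF N M] sub by blast
  have "1 \<notin> ann M N" using sub by (auto simp: ann_def)
  moreover have "ann M N \<subseteq> R" by (auto simp: ann_def)
  ultimately have "ann M N \<subset> R" using R_1 by blast
  then obtain L k where L: "min_left (ann M N) L" "has_index L (ann M N) k" using min_left_exists[OF f] by metis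
  have k: "has_index M N k" by (rule simple_pair_index[OF NM L])
  have k': "has_index (twist M) (twist N) k"
    using simple_pair_index[OF simple_pair_twist[OF NM]] L ann_twist[OF N M] sub by simp
  have det: "lattice_det Y = (real k)\<^sup>2 * lattice_det X" if X: "Olat X" and Y: "Olat Y" and YX: "Y \<subseteq> X" "has_index X Y k" for X Y
  proof -
    obtain d where d: "d \<ge> 1" "\<And>x. x \<in> X \<Longrightarrow> real d *\<^sub>R x \<in> Y" using Olat_commensurable[OF Y X YX(1)] by blast
    obtain l where "has_index X Y l" "lattice_det Y = (real l)\<^sup>2 * lattice_det X"
      using index_det[OF OlatD(1)[OF X] OlatD(4)[OF Y] YX(1) d] by blast
    moreover have "l = k" by (rule has_index_unique[OF OlatD(4)[OF Y] calculation(1) YX(2)])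
    ultimately show ?thesis by simp
  qed
  show ?thesis
    using det[OF M N _ k] det[OF Olat_twist[OF M] Olat_twist[OF N] twist_mono k'] sub by simp
qed

text \<open>Induction on the index of N in M: a maximal sublattice X above N splits off the simple
  quotient M / X, and the ratios for N in X and X in M multiply.\<close>

lemma det_twist_ratio:
  assumes N: "Olat N" and M: "Olat M" and sub: "N \<subseteq> M"
  shows "lattice_det N * lattice_det (twist M) = lattice_det (twist N) * lattice_det M"
proof -
  obtain d where d: "d \<ge> 1" "\<And>x. x \<in> M \<Longrightarrow> real d *\<^sub>R x \<in> N" using Olat_commensurable[OF N M sub] by blast
  obtain k where k: "has_index M N k"
    using index_det[OF OlatD(1)[OF M] OlatD(4)[OF N] sub d] by blast
  show ?thesis
    using N M sub d(2) k
  proof (induction k arbitrary: N M rule: less_induct)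
    case (less k N M)
    note N = less.prems(1) and M = less.prems(2)
    show ?case
    proof (cases "N = M")
      case False
      \<comment> \<open>Least index in M forces X to be maximal among the proper sublattices
        containing N.\<close>
      let ?P = "\<lambda>(X, j). Olat X \<and> N \<subseteq> X \<and> X \<subset> M \<and> has_index M X j"
      have "?P (N, k)" using less.prems False by blast
      from ex_has_least_nat[of ?P, OF this, of snd]
      obtain Xj where Xj: "?P Xj \<and> (\<forall>y. ?P y \<longrightarrow> snd Xj \<le> snd y)" ..
      obtain X j where "Xj = (X, j)" by (cases Xj)
      with Xj have X: "Olat X" "N \<subseteq> X" "X \<subset> M" "has_index M X j"
        and least: "\<And>Y i. Olat Y \<Longrightarrow> N \<subseteq> Y \<Longrightarrow> Y \<subset> M \<Longrightarrow> has_index M Y i \<Longrightarrow> j \<le> i"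
        by auto
      have XM: "X \<subseteq> M" using X(3) by blast
      have dX: "\<And>x. x \<in> M \<Longrightarrow> real d *\<^sub>R x \<in> X" using less.prems(4) X(2) by blast
      have "simple_pair X M"
        unfolding simple_pair_def
      proof (intro conjI allI impI X M)
        fix Y assume Y: "Olat Y" "X \<subseteq> Y" "Y \<subseteq> M"
        from index_tower[OF OlatD(1)[OF M] OlatD(4)[OF Y(1)] Y(3) OlatD(4)[OF X(1)] Y(2) d(1) dX]
        obtain i l where il: "i \<ge> 1" "l \<ge> 1" "has_index Y X i" "has_index M Y l" "has_index M X (i * l)" by blast
        have j: "j = i * l" by (rule has_index_unique[OF OlatD(4)[OF X(1)] X(4) il(5)])
        show "Y = X \<or> Y = M"
        proof (rule disjCI)
          assume "Y \<noteq> M"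
          then have "j \<le> l" using least[OF Y(1) _ _ il(4)] X(2) Y by blast
          then have "i = 1" using j il(1,2) by (cases i) auto
          then show "Y = X" using has_index_1_eq[OF OlatD(4)[OF X(1)] Y(2) OlatD(4)[OF Y(1)]] il(3) by simp
        qed
      qed
      from det_twist_simple[OF this]
      have e1: "lattice_det X * lattice_det (twist M) = lattice_det (twist X) * lattice_det M" .
      from index_tower[OF OlatD(1)[OF M] OlatD(4)[OF X(1)] XM OlatD(4)[OF N] X(2) d(1) less.prems(4)]
      obtain i l where il: "i \<ge> 1" "l \<ge> 1" "has_index X N i" "has_index M X l" "has_index M N (i * l)" by blast
      have kil: "k = i * l" by (rule has_index_unique[OF OlatD(4)[OF N] less.prems(5) il(5)])
      have "l \<noteq> 1" using has_index_1_eq[OF OlatD(4)[OF X(1)] XM OlatD(4)[OF M]] il(4) X(3) by auto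
      then have ik: "i < k" using kil il(1,2) by simp
      have e2: "lattice_det N * lattice_det (twist X) = lattice_det (twist N) * lattice_det X"
        by (rule less.IH[OF ik N X(1,2) _ il(3)]) (use less.prems(4) XM in blast)
      have "(lattice_det X * lattice_det (twist X)) * (lattice_det N * lattice_det (twist M)) =
          (lattice_det X * lattice_det (twist M)) * (lattice_det N * lattice_det (twist X))" by simp
      also have "\<dots> = (lattice_det X * lattice_det (twist X)) * (lattice_det (twist N) * lattice_det M)"
        unfolding e1 e2 by simp
      finally show ?thesis
        using lattice_det_pos[OF OlatD(1)[OF X(1)]] lattice_det_pos[OF OlatD(1)[OF Olat_twist[OF X(1)]]] by simp
    qed simp
  qed
qed

end

section \<open>Flags of $\mathbb{K}$-subspaces\<close>

context hermitian_space
begin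

definition Ksp :: "(nat \<Rightarrow> 'v) \<Rightarrow> nat \<Rightarrow> 'v set" where
  "Ksp f j = range (\<lambda>a. \<Sum>i<j. sc (a i) (f i))"

lemma KspI: "(\<Sum>i<j. sc (a i) (f i)) \<in> Ksp f j"
  unfolding Ksp_def by blast

lemma sc_sum: "sc a (sum g I) = (\<Sum>i\<in>I. sc a (g i))"
  by (rule linear_sum[OF linear_sc])

lemma Ksp_subspace: "subspace (Ksp f j)"
  unfolding subspace_def
proof (intro conjI ballI allI)
  show "0 \<in> Ksp f j" using KspI[where a = "\<lambda>i. 0" and j = j and f = f] by simp
  fix x y assume "x \<in> Ksp f j" "y \<in> Ksp f j"
  then obtain a b where "x = (\<Sum>i<j. sc (a i) (f i))" "y = (\<Sum>i<j. sc (b i) (f i))" unfolding Ksp_def by blast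
  then have "x + y = (\<Sum>i<j. sc (a i + b i) (f i))" by (simp add: scale_add_left sum.distrib)
  then show "x + y \<in> Ksp f j" using KspI by simp
next
  fix t x assume "x \<in> Ksp f j"
  then obtain a where "x = (\<Sum>i<j. sc (a i) (f i))" unfolding Ksp_def by blast
  then have "t *\<^sub>R x = (\<Sum>i<j. sc (t *\<^sub>R a i) (f i))" by (simp add: scaleR_sum_right sc_scaleR)
  then show "t *\<^sub>R x \<in> Ksp f j" using KspI by simp
qed

lemma Ksp_sc: assumes "x \<in> Ksp f j" shows "sc b x \<in> Ksp f j"
proof -
  obtain a where "x = (\<Sum>i<j. sc (a i) (f i))" using assms unfolding Ksp_def by blast
  then have "sc b x = (\<Sum>i<j. sc (b * a i) (f i))" by (simp add: sc_sum scale_scale)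
  then show ?thesis using KspI by simp
qed

lemma Ksp_cong: "(\<And>i. i < j \<Longrightarrow> f i = g i) \<Longrightarrow> Ksp f j = Ksp g j"
  unfolding Ksp_def by simp

lemma Ksp_Suc: "Ksp f (Suc j) = {v + w | v w. v \<in> Ksp f j \<and> w \<in> range (\<lambda>a. sc a (f j))}"
proof
  show "Ksp f (Suc j) \<subseteq> {v + w | v w. v \<in> Ksp f j \<and> w \<in> range (\<lambda>a. sc a (f j))}"
  proof
    fix z assume "z \<in> Ksp f (Suc j)"
    then obtain a where "z = (\<Sum>i<j. sc (a i) (f i)) + sc (a j) (f j)" unfolding Ksp_def by auto
    then show "z \<in> {v + w | v w. v \<in> Ksp f j \<and> w \<in> range (\<lambda>a. sc a (f j))}" using KspI by blast
  qed
  show "{v + w | v w. v \<in> Ksp f j \<and> w \<in> range (\<lambda>a. sc a (f j))} \<subseteq> Ksp f (Suc j)"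
  proof
    fix z assume "z \<in> {v + w | v w. v \<in> Ksp f j \<and> w \<in> range (\<lambda>a. sc a (f j))}"
    then obtain a b where "z = (\<Sum>i<j. sc (a i) (f i)) + sc b (f j)" unfolding Ksp_def by blast
    then have e: "z = (\<Sum>i<Suc j. sc (if i = j then b else a i) (f i))" by simp
    show "z \<in> Ksp f (Suc j)" unfolding e by (rule KspI)
  qed
qed

lemma sc_eq_0: "sc a y = 0 \<Longrightarrow> y \<noteq> 0 \<Longrightarrow> a = 0"
  by (metis sc_inverse sc_zero_right)

lemma dim_K_line: assumes "y \<noteq> 0" shows "dim (range (\<lambda>a. sc a y)) = DIM('k)"
proof -
  have "inj (\<lambda>a. sc a y)"
    by (rule injI) (metis assms eq_iff_diff_eq_0 sc_diff_left sc_eq_0)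
  then show ?thesis using dim_image_eq[OF linear_sc_left, of y UNIV] by simp
qed

lemma subspace_K_line: "subspace (range (\<lambda>a. sc a y))"
  by (rule linear_subspace_image[OF linear_sc_left]) simp

lemma dim_Ksp_Suc: assumes "f j \<notin> Ksp f j" shows "dim (Ksp f (Suc j)) = dim (Ksp f j) + DIM('k)"
proof -
  have "f j \<noteq> 0" using assms subspace_0[OF Ksp_subspace] by metis
  have "Ksp f j \<inter> range (\<lambda>a. sc a (f j)) = {0}"
  proof -
    have "sc a (f j) = 0" if "sc a (f j) \<in> Ksp f j" for a
      using Ksp_sc[OF that, of "inverse a"] assms by (cases "a = 0") (auto simp: sc_inverse)
    then show ?thesis using subspace_0[OF Ksp_subspace[of f j]] by (auto intro!: range_eqI[of _ _ 0])
  qed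
  then show ?thesis
    using dim_sums_Int[OF Ksp_subspace subspace_K_line, of f j "f j"] dim_K_line[OF \<open>f j \<noteq> 0\<close>]
    unfolding Ksp_Suc by simp
qed

lemma Ksp_independent:
  assumes "\<And>i. i < j \<Longrightarrow> f i \<notin> Ksp f i" "(\<Sum>i<j. sc (a i) (f i)) = 0" "i < j"
  shows "a i = 0"
  using assms
proof (induction j arbitrary: i)
  case (Suc j)
  have "a j = 0"
  proof (rule ccontr)
    assume a: "a j \<noteq> 0"
    have e: "sc (a j) (f j) = - (\<Sum>i<j. sc (a i) (f i))" using Suc.prems(2) by (simp add: eq_neg_iff_add_eq_0 add.commute)
    have "sc (a j) (f j) \<in> Ksp f j" unfolding e by (intro subspace_neg Ksp_subspace KspI)
    from Ksp_sc[OF this, of "inverse (a j)"] show False using a Suc.prems(1)[of j] by (simp add: sc_inverse)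
  qed
  moreover have "a i = 0" if "i < j"
    using Suc.IH[OF _ _ that] Suc.prems(1,2) \<open>a j = 0\<close> by simp
  ultimately show ?case using Suc.prems(3) less_Suc_eq by blast
qed simp

text \<open>Chooses a K-basis of S vector by vector, each outside the span of its predecessors and
  in a prescribed relation Q to that span. Q stands for orthonormality in one use and for membership
  in a lattice in the other.\<close>

lemma K_flag:
  assumes S: "subspace S" "\<And>a x. x \<in> S \<Longrightarrow> sc a x \<in> S" and dim: "dim S = DIM('k) * m"
    and nxt: "\<And>V. subspace V \<Longrightarrow> (\<And>a x. x \<in> V \<Longrightarrow> sc a x \<in> V) \<Longrightarrow> V \<subset> S \<Longrightarrow> \<exists>y\<in>S. y \<notin> V \<and> Q V y"
  shows "\<exists>f. (\<forall>i<m. f i \<in> S \<and> f i \<notin> Ksp f i \<and> Q (Ksp f i) (f i)) \<and> Ksp f m = S"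
proof -
  have "\<exists>f. (\<forall>i<j. f i \<in> S \<and> f i \<notin> Ksp f i \<and> Q (Ksp f i) (f i)) \<and> dim (Ksp f j) = DIM('k) * j \<and> Ksp f j \<subseteq> S" if "j \<le> m" for j
    using that
  proof (induction j)
    case 0
    have "Ksp f 0 = {0}" for f by (simp add: Ksp_def)
    then show ?case using subspace_0[OF S(1)] by simp
  next
    case (Suc j)
    then obtain f where f: "\<And>i. i < j \<Longrightarrow> f i \<in> S \<and> f i \<notin> Ksp f i \<and> Q (Ksp f i) (f i)"
      "dim (Ksp f j) = DIM('k) * j" "Ksp f j \<subseteq> S" by auto
    have "Ksp f j \<subset> S" using f(2,3) dim Suc.prems by auto
    then obtain y where y: "y \<in> S" "y \<notin> Ksp f j" "Q (Ksp f j) y"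
      using nxt[OF Ksp_subspace Ksp_sc] by blast
    let ?g = "f(j := y)"
    have e: "Ksp ?g i = Ksp f i" if "i \<le> j" for i by (rule Ksp_cong) (use that in auto)
    have "?g i \<in> S \<and> ?g i \<notin> Ksp ?g i \<and> Q (Ksp ?g i) (?g i)" if "i < Suc j" for i
      using f(1)[of i] y e[of i] that by (cases "i = j") auto
    moreover have "dim (Ksp ?g (Suc j)) = DIM('k) * Suc j"
      using dim_Ksp_Suc[of ?g j] e[of j] y(2) f(2) by simp
    moreover have "Ksp ?g (Suc j) \<subseteq> S"
      unfolding Ksp_Suc using e[of j] f(3) S(2)[OF y(1)] subspace_add[OF S(1)] by auto
    ultimately show ?case by blast
  qed
  then obtain f where f: "\<forall>i<m. f i \<in> S \<and> f i \<notin> Ksp f i \<and> Q (Ksp f i) (f i)" "dim (Ksp f m) = DIM('k) * m" "Ksp f m \<subseteq> S"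
    by blast
  have "Ksp f m = S" using subspace_dim_equal[OF Ksp_subspace S(1) f(3)] f(2) dim by simp
  then show ?thesis using f(1) by blast
qed

lemma h_orth: "(\<And>v. v \<in> V \<Longrightarrow> v \<bullet> z = 0) \<Longrightarrow> (\<And>a v. v \<in> V \<Longrightarrow> sc a v \<in> V) \<Longrightarrow> v \<in> V \<Longrightarrow> h v z = 0"
  using h_eq_0_iff[of v z] by blast

lemma h_sum_left: "h (sum f I) y = (\<Sum>i\<in>I. h (f i) y)"
  by (rule linear_sum[OF linear_h_left])

lemma h_sum_right: "h y (sum f I) = (\<Sum>i\<in>I. h y (f i))"
  by (rule linear_sum[OF linear_h_right])

lemma h_orthonormal_sum:
  fixes m :: nat
  assumes on: "\<And>i j. i < m \<Longrightarrow> j < m \<Longrightarrow> h (e i) (e j) = (if i = j then 1 else 0)"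
  shows "h (\<Sum>i<m. sc (a i) (e i)) (\<Sum>j<m. sc (b j) (e j)) = (\<Sum>i<m. a i * kcnj (b i))"
proof -
  let ?y = "\<Sum>j<m. sc (b j) (e j)"
  have "h (e i) ?y = kcnj (b i)" if i: "i < m" for i
  proof -
    have "h (e i) ?y = (\<Sum>j<m. if j = i then kcnj (b j) else 0)"
      unfolding h_sum_right h_scale_right by (rule sum.cong) (use on i in auto)
    then show ?thesis using i by simp
  qed
  then show ?thesis unfolding h_sum_left[of _ _ ?y] h_scale_left by simp
qed

text \<open>Gram-Schmidt over K: the next vector is taken from the Euclidean orthogonal complement,
  which is orthogonal for h as well.\<close>

lemma orthonormal_K_basis:
  assumes S: "subspace S" "\<And>a x. x \<in> S \<Longrightarrow> sc a x \<in> S" and dim: "dim S = DIM('k) * m"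
  shows "\<exists>e. (\<forall>i<m. e i \<in> S) \<and> (\<forall>i<m. \<forall>j<m. h (e i) (e j) = (if i = j then 1 else 0)) \<and>
    (\<forall>y\<in>S. y = (\<Sum>i<m. sc (h y (e i)) (e i)))"
proof -
  have nxt: "\<exists>y\<in>S. y \<notin> V \<and> ((\<forall>v\<in>V. h v y = 0) \<and> y \<bullet> y = 1)"
    if V: "subspace V" "\<And>a x. x \<in> V \<Longrightarrow> sc a x \<in> V" "V \<subset> S" for V
  proof -
    obtain y where y: "y \<in> S" "y \<notin> V" using V(3) by blast
    obtain v z where vz: "v \<in> span V" "\<And>w. w \<in> span V \<Longrightarrow> real_inner_class.orthogonal z w" "y = v + z"
      using orthogonal_subspace_decomp_exists[of V y] by metis
    have vV: "v \<in> V" using vz(1) V(1) by (simp add: span_eq_iff[THEN iffD2])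
    have z: "z \<in> S" "z \<noteq> 0" using y vz(3) vV V(3) subspace_diff[OF S(1) y(1), of v] by auto
    have "h w z = 0" if "w \<in> V" for w
    proof (rule h_orth[of V, OF _ V(2) that])
      show "u \<bullet> z = 0" if "u \<in> V" for u
        using vz(2)[OF span_base[OF that]] by (simp add: real_inner_class.orthogonal_def inner_commute)
    qed
    then have "\<forall>w\<in>V. h w ((1 / norm z) *\<^sub>R z) = 0" by (simp add: linear_cmul[OF linear_h_right])
    moreover have u: "((1 / norm z) *\<^sub>R z) \<bullet> ((1 / norm z) *\<^sub>R z) = 1"
      using z(2) by (simp flip: power2_norm_eq_inner add: power2_eq_square)
    moreover have "(1 / norm z) *\<^sub>R z \<notin> V"
    proof
      assume "(1 / norm z) *\<^sub>R z \<in> V"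
      then have "h ((1 / norm z) *\<^sub>R z) ((1 / norm z) *\<^sub>R z) = 0" using calculation(1) by blast
      then show False unfolding h_self u by simp
    qed
    ultimately show ?thesis using subspace_scale[OF S(1) z(1)] by blast
  qed
  from K_flag[of S m "\<lambda>V y. (\<forall>v\<in>V. h v y = 0) \<and> y \<bullet> y = 1", OF S dim nxt]
  obtain e where e': "(\<forall>i<m. e i \<in> S \<and> e i \<notin> Ksp e i \<and> (\<forall>v\<in>Ksp e i. h v (e i) = 0) \<and> e i \<bullet> e i = 1) \<and> Ksp e m = S" ..
  then have e: "\<And>i. i < m \<Longrightarrow> e i \<in> S" "\<And>i. i < m \<Longrightarrow> (\<forall>v\<in>Ksp e i. h v (e i) = 0) \<and> e i \<bullet> e i = 1" "Ksp e m = S"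
    by simp_all
  have lt: "h (e i) (e j) = 0" if "i < j" "j < m" for i j
  proof -
    have "(\<Sum>l<j. sc (if l = i then 1 else 0) (e l)) = (\<Sum>l<j. if l = i then e l else 0)"
      by (rule sum.cong) auto
    also have "\<dots> = e i" using that(1) by simp
    finally have "e i \<in> Ksp e j" using KspI[of "\<lambda>l. if l = i then 1 else 0" e j] by simp
    then show ?thesis using e(2)[OF that(2)] by blast
  qed
  have on: "h (e i) (e j) = (if i = j then 1 else 0)" if "i < m" "j < m" for i j
  proof (cases i j rule: linorder_cases)
    case greater
    then show ?thesis using lt[OF greater that(1)] h_sym[of "e i" "e j"] by simp
  qed (use lt that e(2)[OF that(1)] in \<open>auto simp: h_self\<close>)
  have "y = (\<Sum>i<m. sc (h y (e i)) (e i))" if yS: "y \<in> S" for y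
  proof -
    have "y \<in> Ksp e m" using yS e(3) by simp
    then obtain a where a: "y = (\<Sum>i<m. sc (a i) (e i))" unfolding Ksp_def by blast
    have "h y (e j) = a j" if j: "j < m" for j
    proof -
      have "h y (e j) = (\<Sum>i<m. if i = j then a i else 0)"
        unfolding a h_sum_left h_scale_left by (rule sum.cong) (use on j in auto)
      then show ?thesis using j by simp
    qed
    then have "(\<Sum>i<m. sc (h y (e i)) (e i)) = (\<Sum>i<m. sc (a i) (e i))" by simp
    then show ?thesis using a by simp
  qed
  then show ?thesis using e(1) on by (intro exI[of _ e] conjI allI ballI impI)
qed

text \<open>M spans the whole space, so a K-basis f can be chosen inside M; the vectors g represent
  its coordinate functions with respect to h.\<close>

lemma dual_K_basis:
  assumes M: "span M = UNIV" and dim: "DIM('v) = DIM('k) * m"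
  shows "\<exists>f g. (\<forall>i<m. f i \<in> M) \<and> (\<forall>i<m. \<forall>j<m. h (f i) (g j) = (if i = j then 1 else 0)) \<and>
    (\<forall>y. y = (\<Sum>i<m. sc (h y (g i)) (f i)))"
proof -
  have nxt: "\<exists>y\<in>UNIV. y \<notin> V \<and> y \<in> M" if V: "subspace V" "\<And>a x. x \<in> V \<Longrightarrow> sc a x \<in> V" "V \<subset> UNIV" for V
  proof (rule ccontr)
    assume "\<not> ?thesis"
    then have "span M \<subseteq> V" by (intro span_minimal V(1)) auto
    then show False using M V(3) by blast
  qed
  have d: "dim (UNIV :: 'v set) = DIM('k) * m" using dim by simp
  from K_flag[of UNIV m "\<lambda>V y. y \<in> M", OF subspace_UNIV UNIV_I d nxt]
  obtain f where f': "(\<forall>i<m. f i \<in> UNIV \<and> f i \<notin> Ksp f i \<and> f i \<in> M) \<and> Ksp f m = UNIV" ..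
  then have f: "\<And>i. i < m \<Longrightarrow> f i \<notin> Ksp f i" "\<And>i. i < m \<Longrightarrow> f i \<in> M" "Ksp f m = UNIV"
    by simp_all
  have "\<forall>y. \<exists>a. y = (\<Sum>i<m. sc (a i) (f i))" using f(3) unfolding Ksp_def by blast
  from choice[OF this] obtain c where c: "\<And>y. y = (\<Sum>i<m. sc (c y i) (f i))" by blast
  have uniq: "a i = b i" if "(\<Sum>i<m. sc (a i) (f i)) = (\<Sum>i<m. sc (b i) (f i))" "i < m" for a b i
  proof -
    have "(\<Sum>i<m. sc (a i - b i) (f i)) = 0" using that(1) by (simp add: sc_diff_left sum_subtractf)
    from Ksp_independent[OF f(1) this that(2)] show ?thesis by simp
  qed
  have c_sc: "c (sc b y) i = b * c y i" if "i < m" for b y i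
  proof (rule uniq[OF _ that])
    show "(\<Sum>i<m. sc (c (sc b y) i) (f i)) = (\<Sum>i<m. sc (b * c y i) (f i))"
      unfolding c[of "sc b y", symmetric] scale_scale[symmetric] sc_sum[symmetric] c[of y, symmetric] ..
  qed
  have c_add: "c (x + y) i = c x i + c y i" if "i < m" for x y i
  proof (rule uniq[OF _ that])
    show "(\<Sum>i<m. sc (c (x + y) i) (f i)) = (\<Sum>i<m. sc (c x i + c y i) (f i))"
      unfolding c[of "x + y", symmetric] scale_add_left sum.distrib c[of x, symmetric] c[of y, symmetric] ..
  qed
  have lin: "linear (\<lambda>y. c y i \<bullet> 1)" if i: "i < m" for i
  proof (rule linearI)
    show "c (x + y) i \<bullet> 1 = c x i \<bullet> 1 + c y i \<bullet> 1" for x y by (simp add: c_add[OF i] inner_add_left)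
    have "c (t *\<^sub>R x) i = of_real t * c x i" for t x
      using c_sc[OF i, of "of_real t" x] unfolding scale_of_real .
    then show "c (t *\<^sub>R x) i \<bullet> 1 = t *\<^sub>R (c x i \<bullet> 1)" for t x by (simp add: of_real_def)
  qed
  \<comment> \<open>Represents only the real part of the i-th coordinate. Since that coordinate is
    K-linear, replacing y by its K-multiples recovers all of it.\<close>
  define g where "g i = adjoint (\<lambda>y. c y i \<bullet> 1) (1::real)" for i
  have g: "h y (g i) = c y i" if i: "i < m" for y i
  proof -
    have "(b * h y (g i)) \<bullet> 1 = (b * c y i) \<bullet> 1" for b
    proof -
      have "(b * h y (g i)) \<bullet> 1 = sc b y \<bullet> g i" by (simp add: inner_eq_h h_scale_left)
      also have "\<dots> = c (sc b y) i \<bullet> 1" unfolding g_def using adjoint_works[OF lin[OF i], of "sc b y" 1] by simp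
      finally show ?thesis by (simp add: c_sc[OF i])
    qed
    from this[of "kcnj (h y (g i) - c y i)"]
    have "(kcnj (h y (g i) - c y i) * (h y (g i) - c y i)) \<bullet> 1 = 0" by (simp add: right_diff_distrib inner_diff_left)
    then show ?thesis by (simp add: kcnj_mult_self of_real_def flip: power2_norm_eq_inner)
  qed
  have "h (f i) (g j) = (if i = j then 1 else 0)" if ij: "i < m" "j < m" for i j
  proof -
    have "(\<Sum>l<m. sc (if i = l then 1 else 0) (f l)) = (\<Sum>l<m. if i = l then f l else 0)"
      by (rule sum.cong) auto
    also have "\<dots> = f i" using ij by simp
    finally have "(\<Sum>l<m. sc (c (f i) l) (f l)) = (\<Sum>l<m. sc (if i = l then 1 else 0) (f l))"
      using c[of "f i"] by simp
    from uniq[OF this ij(2)] show ?thesis using g[OF ij(2)] by simp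
  qed
  moreover have "y = (\<Sum>i<m. sc (h y (g i)) (f i))" for y
  proof -
    have "(\<Sum>i<m. sc (h y (g i)) (f i)) = (\<Sum>i<m. sc (c y i) (f i))" using g by (intro sum.cong) auto
    then show ?thesis using c[of y] by simp
  qed
  ultimately show ?thesis using f(2) by (intro exI[of _ f] exI[of _ g] conjI allI impI)
qed

end

text \<open>Identifies a K-subspace with any Hermitian space of its dimension by matching
  orthonormal bases. Sections of a lattice are thereby compared with the Hermite constant of the
  type \<open>'w\<close>.\<close>

lemma K_isometry:
  assumes v: "hermitian_space sc h" and w: "hermitian_space sc' h'"
    and S: "subspace S" "\<And>a x. x \<in> S \<Longrightarrow> sc a x \<in> S" and dim: "dim S = DIM('k) * m" "DIM('w) = DIM('k) * m"
  shows "\<exists>g :: 'w::euclidean_space \<Rightarrow> 'v::euclidean_space. linear g \<and> (\<forall>x y. g x \<bullet> g y = x \<bullet> y) \<and> range g = S \<and>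
    (\<forall>a x. g (sc' (a::'k::conj_div_algebra) x) = sc a (g x))"
proof -
  interpret v: hermitian_space sc h by (rule v)
  interpret w: hermitian_space sc' h' by (rule w)
  from v.orthonormal_K_basis[OF S dim(1)]
  obtain e where e0: "(\<forall>i<m. e i \<in> S) \<and> (\<forall>i<m. \<forall>j<m. h (e i) (e j) = (if i = j then 1 else 0)) \<and>
    (\<forall>y\<in>S. y = (\<Sum>i<m. sc (h y (e i)) (e i)))" ..
  note e = e0[THEN conjunct1, rule_format] e0[THEN conjunct2, THEN conjunct1, rule_format]
    e0[THEN conjunct2, THEN conjunct2, rule_format]
  have dw: "dim (UNIV :: 'w set) = DIM('k) * m" using dim(2) by simp
  from w.orthonormal_K_basis[OF subspace_UNIV UNIV_I dw]
  obtain e' where e0': "(\<forall>i<m. e' i \<in> UNIV) \<and> (\<forall>i<m. \<forall>j<m. h' (e' i) (e' j) = (if i = j then 1 else 0)) \<and>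
    (\<forall>y\<in>UNIV. y = (\<Sum>i<m. sc' (h' y (e' i)) (e' i)))" ..
  note e' = e0'[THEN conjunct2, THEN conjunct1, rule_format]
    e0'[THEN conjunct2, THEN conjunct2, rule_format, OF UNIV_I]
  define g where "g y = (\<Sum>i<m. sc (h' y (e' i)) (e i))" for y
  have lin: "linear g"
    unfolding g_def
    by (rule linearI) (simp_all add: w.h_add_left v.scale_add_left sum.distrib linear_cmul[OF w.linear_h_left] v.sc_scaleR scaleR_sum_right)
  note hh = v.h_orthonormal_sum[OF e(2)] and hh' = w.h_orthonormal_sum[OF e'(1)]
  have "g x \<bullet> g y = x \<bullet> y" for x y
  proof -
    have "h (g x) (g y) = (\<Sum>i<m. h' x (e' i) * kcnj (h' y (e' i)))" unfolding g_def by (rule hh)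
    also have "\<dots> = h' (\<Sum>i<m. sc' (h' x (e' i)) (e' i)) (\<Sum>i<m. sc' (h' y (e' i)) (e' i))" by (rule hh'[symmetric])
    also have "\<dots> = h' x y" by (simp only: e'(2)[symmetric])
    finally show ?thesis unfolding v.inner_eq_h w.inner_eq_h by simp
  qed
  moreover have "range g = S"
  proof
    show "range g \<subseteq> S" unfolding g_def using e(1) S by (auto intro!: subspace_sum)
    show "S \<subseteq> range g"
    proof
      fix y assume y: "y \<in> S"
      let ?x = "\<Sum>i<m. sc' (h y (e i)) (e' i)"
      have "h' ?x (e' j) = h y (e j)" if j: "j < m" for j
      proof -
        have "h' ?x (e' j) = (\<Sum>i<m. if i = j then h y (e i) else 0)"
          unfolding w.h_sum_left w.h_scale_left by (rule sum.cong) (use e'(1) j in auto)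
        then show ?thesis using j by simp
      qed
      then have "g ?x = (\<Sum>i<m. sc (h y (e i)) (e i))" unfolding g_def by simp
      then have "g ?x = y" using e(3)[OF y] by simp
      then show "y \<in> range g" using rangeI[of g ?x] by simp
    qed
  qed
  moreover have "g (sc' a x) = sc a (g x)" for a x
    unfolding g_def v.sc_sum w.h_scale_left v.scale_scale ..
  ultimately show ?thesis using lin by blast
qed

text \<open>K as a one-dimensional Hermitian space, in which projections of lattices to a K-line are
  studied.\<close>

lemma hermitian_space_self: "hermitian_space (*) (\<lambda>x y. x * kcnj (y :: 'k::conj_div_algebra))"
proof
  fix x y :: 'k and t :: real
  show "of_real t * x = t *\<^sub>R x" by (simp add: of_real_def)
  show "y * kcnj x = kcnj (x * kcnj y)" by (simp add: kcnj_mult kcnj_kcnj)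
  show "of_real (x \<bullet> y) = (1/2) *\<^sub>R (x * kcnj y + kcnj (x * kcnj y))"
    unfolding of_real_inner by (simp add: kcnj_mult kcnj_kcnj)
qed (simp_all add: algebra_simps)

section \<open>The determinant of the O-dual\<close>

context O_hermitian
begin

text \<open>Since the O-dual and the twist are Euclidean duals of each other, the product equals det
  M / det (\<open>twist M\<close>). By \<open>det_twist_ratio\<close> this ratio is the same for a
  free sublattice N, whose twist has its coordinates in the codifferent.\<close>

theorem det_dualO:
  assumes M: "Olat M" and dim: "DIM('v) = DIM('k) * m"
  shows "lattice_det M * lattice_det (dualO M) = lattice_det R ^ (2 * m)"
proof -
  let ?r = "DIM('k)" and ?D = "lattice_det R"
  from dual_K_basis[OF OlatD(2)[OF M] dim]
  obtain f where "\<exists>g. (\<forall>i<m. f i \<in> M) \<and> (\<forall>i<m. \<forall>j<m. h (f i) (g j) = (if i = j then 1 else 0)) \<and>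
    (\<forall>y. y = (\<Sum>i<m. sc (h y (g i)) (f i)))" ..
  then obtain g where fg0: "(\<forall>i<m. f i \<in> M) \<and> (\<forall>i<m. \<forall>j<m. h (f i) (g j) = (if i = j then 1 else 0)) \<and>
    (\<forall>y. y = (\<Sum>i<m. sc (h y (g i)) (f i)))" ..
  note fM = fg0[THEN conjunct1, rule_format]
    and fg = fg0[THEN conjunct2, THEN conjunct1, rule_format]
    and rep = fg0[THEN conjunct2, THEN conjunct2, rule_format]
  define comb where "comb a = (\<Sum>i<m. sc (a i) (f i))" for a
  have coord: "h (comb a) (g j) = a j" if j: "j < m" for a j
  proof -
    have "h (comb a) (g j) = (\<Sum>i<m. if i = j then a i else 0)"
      unfolding comb_def h_sum_left h_scale_left by (rule sum.cong) (use fg j in auto)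
    then show ?thesis using j by simp
  qed
  \<comment> \<open>The direct sum of the J f_i, in coordinates with respect to the K-basis
    f.\<close>
  define LL where "LL J = {y. \<forall>i<m. h y (g i) \<in> J}" for J
  have LLI: "comb a \<in> LL J" if "\<And>i. i < m \<Longrightarrow> a i \<in> J" for a J
    unfolding LL_def using coord that by simp
  have LL_subspace: "int_module.subspace (LL J)" if "int_module.subspace J" for J
    unfolding LL_def
    by (rule int_subspaceI) (auto simp: linear_0[OF linear_h_left] linear_diff[OF linear_h_left]
        int_module.subspace_0[OF that] int_module.subspace_diff[OF that])
  let ?N = "LL R"
  have NM: "?N \<subseteq> M"
  proof
    fix y assume "y \<in> ?N"
    then have "(\<Sum>i<m. sc (h y (g i)) (f i)) \<in> M"
      unfolding LL_def using fM OlatD(3)[OF M] by (intro int_module.subspace_sum[OF OlatD(4)[OF M]]) auto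
    then show "y \<in> M" unfolding rep[of y, symmetric] .
  qed
  have scf: "sc a (f i) \<in> LL J" if "i < m" "a \<in> J" "0 \<in> J" for a i J
    unfolding LL_def using that fg by (auto simp: h_scale_left)
  have N: "Olat ?N"
    unfolding is_O_lattice_def
  proof (intro conjI ballI)
    show "is_lattice ?N" by (rule is_lattice_subset[OF OlatD(1)[OF M] LL_subspace[OF R_subspace] NM])
    show "sc a y \<in> ?N" if "a \<in> R" "y \<in> ?N" for a y
      using that unfolding LL_def by (auto simp: h_scale_left R_mult)
    have "sc a (f i) \<in> span ?N" if i: "i < m" for a i
    proof -
      have "(\<lambda>a. sc a (f i)) ` span R = span ((\<lambda>a. sc a (f i)) ` R)"
        by (rule linear_span_image[OF linear_sc_left, symmetric])
      also have "\<dots> \<subseteq> span ?N" using scf[OF i _ R_0] by (intro span_mono) blast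
      finally show ?thesis using R_full(2) by blast
    qed
    then have sp: "(\<Sum>i<m. sc (h y (g i)) (f i)) \<in> span ?N" for y by (intro span_sum) auto
    have "y \<in> span ?N" for y using sp[of y] unfolding rep[of y, symmetric] .
    then show "span ?N = UNIV" by blast
  qed
  have fN: "f i \<in> ?N" if "i < m" for i
  proof -
    have "sc 1 (f i) \<in> ?N" by (rule scf[OF that R_1 R_0])
    then show ?thesis unfolding sc_1 .
  qed
  have tw: "twist ?N = LL codiff"
  proof
    show "LL codiff \<subseteq> twist ?N"
      unfolding twist_def zdual_def
    proof (intro subsetI CollectI ballI)
      fix y z assume y: "y \<in> LL codiff" and z: "z \<in> dualO ?N"
      have "sc (h y (g i)) (f i) \<bullet> z \<in> \<int>" if i: "i < m" for i
      proof -
        have "h z (f i) \<in> R" using z fN[OF i] unfolding O_dual_def by blast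
        then have "h (f i) z \<in> R" unfolding h_sym[of "f i" z] by (rule kcnj_R)
        then have "h y (g i) * h (f i) z \<in> codiff" using y i unfolding LL_def by (intro codiff_mult) auto
        then show ?thesis using codiff_inner_1 by (simp add: inner_eq_h h_scale_left)
      qed
      then have "(\<Sum>i<m. sc (h y (g i)) (f i)) \<bullet> z \<in> \<int>" unfolding inner_sum_left by (intro Ints_sum) auto
      then show "y \<bullet> z \<in> \<int>" unfolding rep[of y, symmetric] .
    qed
    show "twist ?N \<subseteq> LL codiff"
    proof
      fix y assume y: "y \<in> twist ?N"
      have "h y (g i) \<bullet> r \<in> \<int>" if i: "i < m" and r: "r \<in> R" for i r
      proof -
        have "h (g i) z \<in> R" if "z \<in> ?N" for z
        proof -
          have "h z (g i) \<in> R" using that i unfolding LL_def by blast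
          then show ?thesis unfolding h_sym[of "g i" z] by (rule kcnj_R)
        qed
        then have "g i \<in> dualO ?N" unfolding O_dual_def by blast
        then have "y \<bullet> sc r (g i) \<in> \<int>" using y dualO_mult[OF r] unfolding twist_def zdual_def by blast
        then show ?thesis unfolding inner_eq_h[of y] h_scale_right inner_eq_mult_1[of "h y (g i)" r] .
      qed
      then show "y \<in> LL codiff" unfolding LL_def codiff_def zdual_def by blast
    qed
  qed
  obtain d :: nat where d: "d \<ge> 1" "\<And>z. z \<in> codiff \<Longrightarrow> real d *\<^sub>R z \<in> R" using codiff_denominator by blast
  have d0: "real d \<noteq> 0" using d(1) by simp
  \<comment> \<open>Scaling by d moves the codifferent into R, so that an index can be
    formed.\<close>
  let ?J = "(*\<^sub>R) (real d) ` codiff"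
  have J: "int_module.subspace ?J" "?J \<subseteq> R" using int_subspace_image[OF linear_scale_self codiff_subspace] d(2) by auto
  have dJ: "real (2 * d) *\<^sub>R x \<in> ?J" if "x \<in> R" for x
    using two_R_codiff[OF that] by (intro image_eqI[of _ _ "2 *\<^sub>R x"]) (simp_all add: mult.commute)
  have d2: "2 * d \<ge> 1" using d(1) by simp
  obtain k where k: "k \<ge> 1" "has_index R ?J k" "lattice_det ?J = (real k)\<^sup>2 * ?D"
    using index_det[OF R_full(1) J d2 dJ] by blast
  have D: "?D > 0" by (rule lattice_det_pos[OF R_full(1)])
  have "(real k)\<^sup>2 * ?D = ((real d)\<^sup>2) ^ ?r * lattice_det codiff"
    using k(3) lattice_det_scale[OF d0 codiff_full(1)] full_lattice_dim[OF codiff_full(2)] by simp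
  then have "(real k)\<^sup>2 * ?D * ?D = ((real d)\<^sup>2) ^ ?r * (?D * lattice_det codiff)" by simp
  \<comment> \<open>As det \<open>codiff\<close> = 1 / D, this says that the index k of d
    \<open>codiff\<close> in R is d^r / D.\<close>
  then have kD: "((real d)\<^sup>2) ^ ?r = (real k)\<^sup>2 * ?D\<^sup>2" using codiff_full(3) by (simp add: power2_eq_square)
  have LJ: "LL ?J = (*\<^sub>R) (real d) ` twist ?N"
  proof
    show "LL ?J \<subseteq> (*\<^sub>R) (real d) ` twist ?N"
    proof
      fix y assume y: "y \<in> LL ?J"
      have "h ((1 / real d) *\<^sub>R y) (g i) \<in> codiff" if "i < m" for i
        using y that d0 unfolding LL_def by (force simp: linear_cmul[OF linear_h_left])
      then have "(1 / real d) *\<^sub>R y \<in> twist ?N" unfolding tw unfolding LL_def by blast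
      then show "y \<in> (*\<^sub>R) (real d) ` twist ?N"
        using d0 by (intro image_eqI[of _ _ "(1 / real d) *\<^sub>R y"]) auto
    qed
    show "(*\<^sub>R) (real d) ` twist ?N \<subseteq> LL ?J"
      unfolding tw unfolding LL_def by (auto simp: linear_cmul[OF linear_h_left])
  qed
  have LJN: "LL ?J \<subseteq> ?N" unfolding LL_def using J(2) by blast
  have "real (2 * d) *\<^sub>R y \<in> LL ?J" if "y \<in> ?N" for y
    using that dJ unfolding LL_def by (simp add: linear_cmul[OF linear_h_left])
  then obtain l where l: "has_index ?N (LL ?J) l" "lattice_det (LL ?J) = (real l)\<^sup>2 * lattice_det ?N"
    using index_det[OF OlatD(1)[OF N] LL_subspace[OF J(1)] LJN d2] by blast
  \<comment> \<open>Representatives are chosen coordinate by coordinate, which gives k^m of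
    them.\<close>
  have "has_index ?N (LL ?J) (k ^ m)"
  proof -
    obtain T where T: "finite T" "card T = k" "T \<subseteq> R" "\<forall>x\<in>R. \<exists>t\<in>T. x - t \<in> ?J"
      "\<forall>s\<in>T. \<forall>t\<in>T. s - t \<in> ?J \<longrightarrow> s = t"
      using k(2) by (rule has_indexE)
    let ?F = "{..<m} \<rightarrow>\<^sub>E T"
    have eq: "a = b" if "a \<in> ?F" "b \<in> ?F" "comb a - comb b \<in> LL ?J" for a b
    proof (rule PiE_ext[OF that(1,2)])
      fix i assume "i \<in> {..<m}"
      then have i: "i < m" by simp
      have "h (comb a - comb b) (g i) \<in> ?J" using that(3) i unfolding LL_def by blast
      then have "a i - b i \<in> ?J" by (simp only: linear_diff[OF linear_h_left] coord[OF i])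
      moreover have "a i \<in> T" "b i \<in> T" using that(1,2) i by auto
      ultimately show "a i = b i" using T(5) by blast
    qed
    have zJ: "0 \<in> LL ?J" by (rule int_module.subspace_0[OF LL_subspace[OF J(1)]])
    have inj: "inj_on comb ?F" using eq zJ by (intro inj_onI) auto
    show ?thesis
      unfolding has_index_def
    proof (intro exI[of _ "comb ` ?F"] conjI ballI impI)
      show "finite (comb ` ?F)" using T(1) by (intro finite_imageI finite_PiE) auto
      show "card (comb ` ?F) = k ^ m" using T(2) by (simp add: card_image[OF inj] card_PiE)
      show "comb ` ?F \<subseteq> ?N" using T(3) by (intro image_subsetI LLI) auto
    next
      fix y assume y: "y \<in> ?N"
      have "\<forall>i. \<exists>t. i < m \<longrightarrow> t \<in> T \<and> h y (g i) - t \<in> ?J" using y T(4) unfolding LL_def by blast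
      from choice[OF this] obtain t where t: "\<And>i. i < m \<Longrightarrow> t i \<in> T \<and> h y (g i) - t i \<in> ?J" by blast
      let ?a = "restrict t {..<m}"
      have "h (y - comb ?a) (g i) \<in> ?J" if i: "i < m" for i
        using t[OF i] i by (simp only: linear_diff[OF linear_h_left] coord[OF i]) simp
      then have "y - comb ?a \<in> LL ?J" unfolding LL_def by blast
      moreover have "?a \<in> ?F" using t by auto
      ultimately show "\<exists>z\<in>comb ` ?F. y - z \<in> LL ?J" by blast
    next
      fix u v assume "u \<in> comb ` ?F" "v \<in> comb ` ?F" "u - v \<in> LL ?J"
      then show "u = v" using eq by blast
    qed
  qed
  then have "l = k ^ m" using has_index_unique[OF LL_subspace[OF J(1)] l(1)] by blast
  then have "((real d)\<^sup>2) ^ (?r * m) * lattice_det (twist ?N) = (real (k ^ m))\<^sup>2 * lattice_det ?N"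
    using l(2) unfolding LJ lattice_det_scale[OF d0 OlatD(1)[OF Olat_twist[OF N]]]
    by (simp add: full_lattice_dim[OF OlatD(2)[OF Olat_twist[OF N]]] dim)
  moreover have "((real d)\<^sup>2) ^ (?r * m) = (real (k ^ m))\<^sup>2 * ?D ^ (2 * m)"
    unfolding power_mult kD by (simp add: power_mult_distrib power_mult[symmetric] mult.commute)
  ultimately have "(real (k ^ m))\<^sup>2 * (?D ^ (2 * m) * lattice_det (twist ?N)) = (real (k ^ m))\<^sup>2 * lattice_det ?N"
    by simp
  moreover have "(real (k ^ m))\<^sup>2 \<noteq> 0" using k(1) by simp
  ultimately have N_tw: "?D ^ (2 * m) * lattice_det (twist ?N) = lattice_det ?N" by (metis mult_left_cancel)
  have "lattice_det (twist ?N) * (?D ^ (2 * m) * lattice_det (twist M)) = lattice_det (twist ?N) * lattice_det M"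
    using det_twist_ratio[OF N M NM] unfolding N_tw[symmetric] by (simp add: mult_ac)
  moreover have "lattice_det (twist ?N) > 0" by (rule lattice_det_pos[OF OlatD(1)[OF Olat_twist[OF N]]])
  ultimately have "?D ^ (2 * m) * lattice_det (twist M) = lattice_det M" by simp
  moreover have "lattice_det (dualO M) * lattice_det (twist M) = 1"
    unfolding twist_def by (rule zdual_full(3)[OF OlatD(1,2)[OF Olat_dualO[OF M]]])
  ultimately show ?thesis by (metis mult.assoc mult.commute mult.right_neutral)
qed

end

section \<open>Sections orthogonal to a vector of the dual\<close>

context O_hermitian
begin

lemma orth_K_line_iff: "y \<in> (K_line sc x)\<^sup>\<bottom> \<longleftrightarrow> h y x = 0"
proof -
  have "y \<in> (K_line sc x)\<^sup>\<bottom> \<longleftrightarrow> (\<forall>a. sc a x \<bullet> y = 0)"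
    unfolding orthogonal_comp_def real_inner_class.orthogonal_def K_line_def by blast
  also have "\<dots> \<longleftrightarrow> h x y = 0" by (rule h_eq_0_iff)
  also have "\<dots> \<longleftrightarrow> h y x = 0" using h_sym[of x y] h_sym[of y x] by auto
  finally show ?thesis .
qed

lemma orth_K_line_sc: "y \<in> (K_line sc x)\<^sup>\<bottom> \<Longrightarrow> sc a y \<in> (K_line sc x)\<^sup>\<bottom>"
  by (simp add: orth_K_line_iff h_scale_left)

lemma dim_orth_K_line: assumes "x \<noteq> 0" shows "dim ((K_line sc x)\<^sup>\<bottom>) + DIM('k) = DIM('v)"
proof -
  have e: "K_line sc x = range (\<lambda>a. sc a x)" unfolding K_line_def by auto
  have "(K_line sc x)\<^sup>\<bottom> = {y \<in> UNIV. \<forall>z\<in>range (\<lambda>a. sc a x). real_inner_class.orthogonal z y}"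
    unfolding e orthogonal_comp_def by simp
  then show ?thesis
    using dim_subspace_orthogonal_to_vectors[OF subspace_K_line subspace_UNIV subset_UNIV, of x] dim_K_line[OF assms] by simp
qed

text \<open>The number k is the index of O x in L# cut with K x. It is kept in the formula because k
  = 1 is exactly the second of the equality conditions.\<close>

lemma section_lattice:
  assumes L: "Olat L" and x: "x \<in> dualO L" "x \<noteq> 0" and dim: "DIM('v) = DIM('k) * m"
  defines "S \<equiv> (K_line sc x)\<^sup>\<bottom>"
  shows "is_lattice (L \<inter> S)" "dim (L \<inter> S) = DIM('k) * (m - 1)" "S \<subseteq> span (L \<inter> S)"
    and "\<exists>k\<ge>1. (real k)\<^sup>2 * lattice_det R * lattice_det (L \<inter> S) = (x \<bullet> x) ^ DIM('k) * lattice_det L \<and>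
      (k = 1 \<longleftrightarrow> dualO L \<inter> K_line sc x = {sc a x | a. a \<in> R})"
proof -
  let ?n = "norm x"
  \<comment> \<open>With x normalized to a unit vector, the map from a to a u is an isometry of K
    onto K x.\<close>
  define u where "u = (1 / ?n) *\<^sub>R x"
  have n0: "?n \<noteq> 0" using x(2) by simp
  have uu: "u \<bullet> u = 1" unfolding u_def using x(2) by (simp flip: power2_norm_eq_inner add: power2_eq_square)
  have huu: "h u u = 1" unfolding h_self uu by simp
  have hu: "h y u = (1 / ?n) *\<^sub>R h y x" for y unfolding u_def by (rule linear_cmul[OF linear_h_right])
  have hx: "h y x = ?n *\<^sub>R h y u" for y unfolding hu using n0 by simp
  have xu: "sc a x = sc (?n *\<^sub>R a) u" for a unfolding u_def sc_scaleR sc_scaleR_right using n0 by simp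
  have S_iff: "y \<in> S \<longleftrightarrow> h y u = 0" for y unfolding S_def orth_K_line_iff hu using n0 by simp
  have S: "subspace S" unfolding S_def by (rule subspace_orthogonal_comp)
  define i where "i a = sc a u" for a
  have i: "linear i" "\<And>a b. i a \<bullet> i b = a \<bullet> b"
    unfolding i_def by (rule linear_sc_left) (simp add: inner_sc_sc uu)
  note inj_i = isometry_inj[OF i]
  define p where "p y = i (h y u)" for y
  have p: "linear p" unfolding p_def by (rule linear_compose[OF linear_h_left i(1), unfolded o_def])
  have pS: "y - p y \<in> S" for y
    unfolding S_iff p_def i_def linear_diff[OF linear_h_left] h_scale_left huu by simp
  have Sp: "s \<bullet> p y = 0" if "s \<in> S" for s y
    using that unfolding S_iff p_def i_def inner_eq_h[of s] h_scale_right by simp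
  define J where "J = (\<lambda>y. h y u) ` L"
  have pL: "p ` L = i ` J" unfolding p_def J_def by (simp add: image_image)
  interpret K: O_hermitian A R "(*)" "\<lambda>x y. x * kcnj y"
    unfolding O_hermitian_def using maximal_order_axioms hermitian_space_self by blast
  have hR: "h y x \<in> R" if "y \<in> L" for y
    using x(1) that kcnj_R unfolding h_sym[of y x] O_dual_def by blast
  have JO: "K.Olat J"
    unfolding is_O_lattice_def
  proof (intro conjI ballI)
    have "J \<subseteq> (*\<^sub>R) (1 / ?n) ` R" unfolding J_def hu using hR by blast
    moreover have "int_module.subspace J" unfolding J_def by (rule int_subspace_image[OF linear_h_left OlatD(4)[OF L]])
    moreover have "is_lattice ((*\<^sub>R) (1 / ?n) ` R)" by (rule is_lattice_scale[OF _ R_full(1)]) (use n0 in simp)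
    ultimately show "is_lattice J" using is_lattice_subset by blast
    show mult: "a * b \<in> J" if "a \<in> R" "b \<in> J" for a b
      using that OlatD(3)[OF L] unfolding J_def by (auto simp flip: h_scale_left)
    have "\<exists>y\<in>L. h y u \<noteq> 0"
    proof (rule ccontr)
      assume "\<not> (\<exists>y\<in>L. h y u \<noteq> 0)"
      then have "span L \<subseteq> S" using S by (intro span_minimal) (auto simp: S_iff)
      then have "u \<in> S" using OlatD(2)[OF L] by blast
      then show False using huu by (simp add: S_iff)
    qed
    then obtain j where j: "j \<in> J" "j \<noteq> 0" unfolding J_def by blast
    have lj: "linear (\<lambda>b. b * j)" by (rule linearI) (simp_all add: distrib_right)
    have "(\<lambda>b. b * j) ` span R = span ((\<lambda>b. b * j) ` R)" by (rule linear_span_image[OF lj, symmetric])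
    also have "\<dots> \<subseteq> span J" using mult[OF _ j(1)] by (intro span_mono) blast
    finally have sub: "(\<lambda>b. b * j) ` UNIV \<subseteq> span J" unfolding R_full(2) .
    have "a \<in> span J" for a
    proof -
      have "a = (a * inverse j) * j" using j(2) by (simp add: mult.assoc)
      then show ?thesis using sub by blast
    qed
    then show "span J = UNIV" by blast
  qed
  have latpL: "is_lattice (p ` L)" unfolding pL by (rule is_lattice_isometry_image[OF i K.OlatD(1)[OF JO]])
  have dimL: "dim L = DIM('k) * m" using full_lattice_dim[OF OlatD(2)[OF L]] dim by simp
  have dimpL: "dim (p ` L) = DIM('k)"
    unfolding pL dim_isometry_image[OF i] by (rule full_lattice_dim[OF K.OlatD(2)[OF JO]])
  note split = split_lattice[OF OlatD(1)[OF L] p S pS Sp latpL]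
  show dimS: "dim (L \<inter> S) = DIM('k) * (m - 1)" using split(1) dimL dimpL by (simp add: right_diff_distrib')
  have "int_module.subspace (L \<inter> S)"
    by (rule int_subspaceI) (auto intro: int_module.subspace_diff[OF OlatD(4)[OF L]] subspace_diff[OF S]
        int_module.subspace_0[OF OlatD(4)[OF L]] subspace_0[OF S])
  then show "is_lattice (L \<inter> S)" by (rule is_lattice_subset[OF OlatD(1)[OF L]]) blast
  have "span (L \<inter> S) = S"
  proof (rule subspace_dim_equal[OF subspace_span S])
    show "span (L \<inter> S) \<subseteq> S" by (rule span_minimal[OF _ S]) blast
    show "dim S \<le> dim (span (L \<inter> S))"
      using dim_orth_K_line[OF x(2)] split(1) dimL dimpL dim unfolding S_def[symmetric] by simp
  qed
  then show sp: "S \<subseteq> span (L \<inter> S)" by simp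
  have det: "lattice_det L = lattice_det (L \<inter> S) * lattice_det J"
    using split(2)[OF _ sp] unfolding pL lattice_det_isometry_image[OF i K.OlatD(1)[OF JO]] .
  let ?J' = "K.dualO J" and ?W = "(*\<^sub>R) ?n ` R"
  \<comment> \<open>The determinant formula for m = 1, in K itself.\<close>
  have JJ': "lattice_det J * lattice_det ?J' = (lattice_det R)\<^sup>2" using K.det_dualO[OF JO, of 1] by simp
  \<comment> \<open>Under i the O-dual of J becomes L# cut with K x, and \<open>?W\<close> becomes O
    x.\<close>
  have J'_iff: "b \<in> ?J' \<longleftrightarrow> i b \<in> dualO L" for b
    unfolding O_dual_def J_def i_def by (auto simp: h_scale_left simp flip: h_sym)
  have WJ': "?W \<subseteq> ?J'"
  proof
    fix b assume "b \<in> ?W"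
    then obtain a where a: "a \<in> R" "b = ?n *\<^sub>R a" by blast
    have "i b = sc a x" unfolding i_def a(2) xu ..
    then show "b \<in> ?J'" unfolding J'_iff using dualO_mult[OF a(1) x(1)] by simp
  qed
  have J'O: "K.Olat ?J'" by (rule K.Olat_dualO[OF JO])
  have WO: "K.Olat ?W"
    unfolding is_O_lattice_def
  proof (intro conjI ballI)
    show l: "is_lattice ?W" by (rule is_lattice_scale[OF n0 R_full(1)])
    have "dim ?W = DIM('k)" unfolding dim_scale[OF n0 R_full(1)] by (rule full_lattice_dim[OF R_full(2)])
    then show "span ?W = UNIV" by (metis dim_eq_full dim_span span_span)
    show "a * b \<in> ?W" if "a \<in> R" "b \<in> ?W" for a b using that R_mult by auto
  qed
  obtain d where d: "d \<ge> 1" "\<And>y. y \<in> ?J' \<Longrightarrow> real d *\<^sub>R y \<in> ?W" using K.Olat_commensurable[OF WO J'O WJ'] by blast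
  obtain k where k: "k \<ge> 1" "has_index ?J' ?W k" "lattice_det ?W = (real k)\<^sup>2 * lattice_det ?J'"
    using index_det[OF K.OlatD(1)[OF J'O] K.OlatD(4)[OF WO] WJ' d] by blast
  have detW: "lattice_det ?W = (x \<bullet> x) ^ DIM('k) * lattice_det R"
    unfolding lattice_det_scale[OF n0 R_full(1)] full_lattice_dim[OF R_full(2)] power2_norm_eq_inner ..
  have pos: "lattice_det R > 0" "lattice_det ?J' > 0" using lattice_det_pos[OF R_full(1)] lattice_det_pos[OF K.OlatD(1)[OF J'O]] .
  have "lattice_det R * ((real k)\<^sup>2 * lattice_det R * lattice_det (L \<inter> S)) = (real k)\<^sup>2 * (lattice_det J * lattice_det ?J') * lattice_det (L \<inter> S)"
    unfolding JJ' by (simp add: power2_eq_square)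
  also have "\<dots> = ((real k)\<^sup>2 * lattice_det ?J') * (lattice_det (L \<inter> S) * lattice_det J)" by simp
  also have "\<dots> = lattice_det R * ((x \<bullet> x) ^ DIM('k) * lattice_det L)"
    unfolding k(3)[symmetric] detW det by simp
  finally have main: "(real k)\<^sup>2 * lattice_det R * lattice_det (L \<inter> S) = (x \<bullet> x) ^ DIM('k) * lattice_det L"
    using pos(1) by simp
  have k1: "k = 1 \<longleftrightarrow> ?W = ?J'"
  proof
    assume "k = 1"
    then show "?W = ?J'" using has_index_1_eq[OF K.OlatD(4)[OF WO] WJ' K.OlatD(4)[OF J'O]] k(2) by simp
  next
    assume "?W = ?J'"
    then have "(real k)\<^sup>2 = 1" using k(3) pos(2) by simp
    then show "k = 1" by (simp add: power2_eq_1_iff)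
  qed
  have F: "K_line sc x = range i"
  proof
    show "K_line sc x \<subseteq> range i" unfolding K_line_def i_def xu by blast
    show "range i \<subseteq> K_line sc x"
    proof
      fix z assume "z \<in> range i"
      then obtain b where "z = sc b u" unfolding i_def by blast
      then have "z = sc ((1 / ?n) *\<^sub>R b) x" unfolding xu using n0 by simp
      then show "z \<in> K_line sc x" unfolding K_line_def by blast
    qed
  qed
  have e1: "dualO L \<inter> K_line sc x = i ` ?J'" unfolding F using J'_iff by blast
  have e2: "{sc a x | a. a \<in> R} = i ` ?W" unfolding xu i_def by blast
  have "k = 1 \<longleftrightarrow> dualO L \<inter> K_line sc x = {sc a x | a. a \<in> R}"
    unfolding k1 e1 e2 inj_image_eq_iff[OF inj_i] by (rule eq_commute)
  then show "\<exists>k\<ge>1. (real k)\<^sup>2 * lattice_det R * lattice_det (L \<inter> S) = (x \<bullet> x) ^ DIM('k) * lattice_det L \<and>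
      (k = 1 \<longleftrightarrow> dualO L \<inter> K_line sc x = {sc a x | a. a \<in> R})"
    using main k(1) by blast
qed

end

section \<open>Existence of optimal lattices\<close>

text \<open>Hadamard's inequality: projecting orthogonally to v does not lengthen the remaining
  vectors.\<close>

lemma gdet_hadamard: "gdet bs \<le> prod_list (map (\<lambda>b. b \<bullet> b) bs) \<and> 0 \<le> gdet bs"
proof (induction bs rule: length_induct)
  case (1 bs)
  show ?case
  proof (cases bs)
    case (Cons v cs)
    have rej: "rej v c \<bullet> rej v c \<le> c \<bullet> c" for c
    proof -
      have "rej v c \<bullet> rej v c = c \<bullet> c - (c \<bullet> v)\<^sup>2 / (v \<bullet> v)"
        by (cases "v = 0") (simp_all add: rej_def inner_diff_left inner_diff_right inner_commute power2_eq_square)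
      then show ?thesis by simp
    qed
    have "prod_list (map (\<lambda>b. b \<bullet> b) (map (rej v) ds)) \<le> prod_list (map (\<lambda>b. b \<bullet> b) ds) \<and>
        0 \<le> prod_list (map (\<lambda>b. b \<bullet> b) (map (rej v) ds))" for ds
      by (induction ds) (auto intro!: mult_mono rej)
    then have "gdet (map (rej v) cs) \<le> prod_list (map (\<lambda>b. b \<bullet> b) cs)" "0 \<le> gdet (map (rej v) cs)"
      using 1[rule_format, of "map (rej v) cs"] Cons by (auto intro: order_trans)
    then show ?thesis unfolding Cons gdet_Cons by (auto intro!: mult_left_mono)
  qed simp
qed

text \<open>Put the j-th basis vector last. Its component orthogonal to the others has length
  inverse to that of the dual vector, so det L times the norm of the dual vector is the Gram
  determinant of the others, bounded by Hadamard. Bounded dual bases keep a limit of bases from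
  degenerating.\<close>

lemma dual_vector_bound:
  fixes L :: "'v::euclidean_space set"
  assumes b: "lbasis bs L" and len: "length bs = DIM('v)" and j: "j < length bs"
    and d: "\<And>i l. i < length bs \<Longrightarrow> l < length bs \<Longrightarrow> bs ! i \<bullet> ds ! l = (if i = l then 1 else 0)" "length ds = length bs"
    and B: "B \<ge> 1" "\<And>b. b \<in> set bs \<Longrightarrow> b \<bullet> b \<le> B"
  shows "lattice_det L * (ds ! j \<bullet> ds ! j) \<le> B ^ DIM('v)"
proof -
  let ?d = "ds ! j"
  define os where "os = take j bs @ drop (Suc j) bs"
  have dist: "distinct bs" and ind: "independent (set bs)" using b by (auto simp: lbasis_def free_list_iff)
  have split: "bs = take j bs @ bs ! j # drop (Suc j) bs" by (rule id_take_nth_drop[OF j])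
  have sets: "set (os @ [bs ! j]) = set bs" unfolding os_def by (subst (4) split) auto
  have dist': "distinct (os @ [bs ! j])"
    using dist unfolding os_def by (subst (asm) split) auto
  have b': "lbasis (os @ [bs ! j]) L"
    using b dist' unfolding lbasis_def free_list_iff int_span_eq_lcomb[symmetric] sets by simp
  have bjd: "bs ! j \<bullet> ?d = 1" using d j by simp
  then have d0: "?d \<bullet> ?d > 0" by (metis inner_gt_zero_iff inner_zero_right zero_neq_one)
  have os_d: "o' \<bullet> ?d = 0" if o': "o' \<in> set os" for o'
  proof -
    have "o' \<in> set bs" using o' sets by auto
    then obtain i where i: "i < length bs" "o' = bs ! i" by (metis in_set_conv_nth)
    have "i \<noteq> j" using dist' i(2) o' by auto
    then show ?thesis using d i j by simp
  qed
  define p where "p y = ((y \<bullet> ?d) / (?d \<bullet> ?d)) *\<^sub>R ?d" for y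
  have "span (set bs) = UNIV" using full_lbasis_iff[of L] b len lbasis_span[OF b] by auto
  then have UNIV_bs: "range (lcomb bs) = UNIV" unfolding span_eq_lcomb .
  have perp: "z \<in> span (set os)" if z: "z \<bullet> ?d = 0" for z
  proof -
    obtain c where c: "z = lcomb bs c" using UNIV_bs by blast
    have "c j = 0" using z lcomb_inner_dual[OF d(2,1) j, of c] unfolding c by simp
    have "c i *\<^sub>R bs ! i \<in> span (set os)" if i: "i < length bs" for i
    proof (cases "i = j")
      case False
      then have "bs ! i \<noteq> bs ! j" using dist i j by (simp add: nth_eq_iff_index_eq)
      then have "bs ! i \<in> set os" using sets nth_mem[OF i] by auto
      then show ?thesis by (intro span_scale span_base)
    qed (simp add: \<open>c j = 0\<close> span_zero)
    then show ?thesis unfolding c lcomb_def by (intro span_sum) auto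
  qed
  have "gdet (os @ [bs ! j]) = gdet os * gdet (map p [bs ! j])"
  proof (rule gdet_append)
    fix l assume "l < length [bs ! j]"
    then have "l = 0" by simp
    moreover have "(bs ! j - p (bs ! j)) \<bullet> ?d = 0" unfolding p_def using d0 by (simp add: inner_diff_left)
    ultimately show "[bs ! j] ! l - p ([bs ! j] ! l) \<in> span (set os)" using perp by simp
  next
    fix i l assume "i < length os"
    then show "os ! i \<bullet> p ([bs ! j] ! l) = 0" unfolding p_def using os_d nth_mem by simp
  qed
  also have "gdet (map p [bs ! j]) = 1 / (?d \<bullet> ?d)"
    using d0 by (simp add: gdet_Cons p_def bjd)
  finally have "lattice_det L * (?d \<bullet> ?d) = gdet os" using lattice_det_eq[OF b'] d0 by simp
  also have "\<dots> \<le> prod_list (map (\<lambda>b. b \<bullet> b) os)" using gdet_hadamard by blast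
  also have "\<dots> \<le> B ^ length os"
  proof -
    have "set cs \<subseteq> set bs \<Longrightarrow> prod_list (map (\<lambda>b. b \<bullet> b) cs) \<le> B ^ length cs \<and> 0 \<le> prod_list (map (\<lambda>b. b \<bullet> b) cs)" for cs
      by (induction cs) (use B in \<open>auto intro!: mult_mono\<close>)
    then show ?thesis using sets by auto
  qed
  also have "\<dots> \<le> B ^ DIM('v)" using B(1) len j by (intro power_increasing) (auto simp: os_def)
  finally show ?thesis .
qed

lemma common_convergent_subsequence:
  fixes b :: "nat \<Rightarrow> nat \<Rightarrow> 'v::euclidean_space"
  assumes "\<And>i. i < n \<Longrightarrow> bounded (range (\<lambda>k. b k i))"
  shows "\<exists>r c. strict_mono r \<and> (\<forall>i<n. (\<lambda>k. b (r k) i) \<longlonglongrightarrow> c i)"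
  using assms
proof (induction n)
  case 0
  have "strict_mono (\<lambda>k::nat. k)" by (simp add: strict_mono_def)
  then show ?case by blast
next
  case (Suc n)
  then obtain r c where rc: "strict_mono (r :: nat \<Rightarrow> nat)" "\<And>i. i < n \<Longrightarrow> (\<lambda>k. b (r k) i) \<longlonglongrightarrow> c i" by force
  have "bounded (range (\<lambda>k. b (r k) n))"
    by (rule bounded_subset[OF Suc.prems[of n]]) auto
  from bounded_imp_convergent_subsequence[OF this]
  obtain l s where ls: "strict_mono (s :: nat \<Rightarrow> nat)" "((\<lambda>k. b (r k) n) \<circ> s) \<longlonglongrightarrow> l" by blast
  have "(\<lambda>k. b (r (s k)) i) \<longlonglongrightarrow> (if i = n then l else c i)" if "i < Suc n" for i
  proof (cases "i = n")
    case True then show ?thesis using ls(2) by (simp add: o_def)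
  next
    case False
    then have "i < n" using that by simp
    from LIMSEQ_subseq_LIMSEQ[OF rc(2)[OF this] ls(1)] show ?thesis using False by (simp add: o_def)
  qed
  moreover have "strict_mono (\<lambda>k. r (s k))" using strict_mono_o[OF rc(1) ls(1)] by (simp add: o_def)
  ultimately show ?case by (intro exI[of _ "\<lambda>k. r (s k)"] exI[of _ "\<lambda>i. if i = n then l else c i"]) auto
qed

text \<open>By the Leibniz formula the Gram determinant is a polynomial in inner products.\<close>

lemma tendsto_gdet:
  fixes b :: "nat \<Rightarrow> nat \<Rightarrow> 'v::real_inner"
  assumes "\<And>i. i < n \<Longrightarrow> (\<lambda>k. b k i) \<longlonglongrightarrow> c i"
  shows "(\<lambda>k. gdet (map (b k) [0..<n])) \<longlonglongrightarrow> gdet (map c [0..<n])"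
proof -
  have g: "gdet (map f [0..<n]) = (\<Sum>p\<in>{p. p permutes {0..<n}}. signof p * (\<Prod>i = 0..<n. f i \<bullet> f (p i)))" for f :: "nat \<Rightarrow> 'v"
  proof -
    have "gdet (map f [0..<n]) = Determinant.det (mat n n (\<lambda>(i, j). f i \<bullet> f j))"
      unfolding gdet_def by (rule arg_cong[of _ _ Determinant.det], rule eq_matI) auto
    also have "\<dots> = (\<Sum>p\<in>{p. p permutes {0..<n}}. signof p * (\<Prod>i = 0..<n. mat n n (\<lambda>(i, j). f i \<bullet> f j) $$ (i, p i)))"
      by (rule det_def') simp
    also have "\<dots> = (\<Sum>p\<in>{p. p permutes {0..<n}}. signof p * (\<Prod>i = 0..<n. f i \<bullet> f (p i)))"
    proof (intro sum.cong arg_cong2[where f = "(*)"] refl prod.cong)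
      fix p i assume "p \<in> {p. p permutes {0..<n}}" "i \<in> {0..<n}"
      then have "p i \<in> {0..<n}" by (simp only: mem_Collect_eq permutes_in_image)
      then show "mat n n (\<lambda>(i, j). f i \<bullet> f j) $$ (i, p i) = f i \<bullet> f (p i)" using \<open>i \<in> {0..<n}\<close> by simp
    qed
    finally show ?thesis .
  qed
  show ?thesis
    unfolding g
  proof (intro tendsto_sum tendsto_mult tendsto_const tendsto_prod tendsto_inner)
    fix p i assume "p \<in> {p. p permutes {0..<n}}" "i \<in> {0..<n}"
    then have "p i \<in> {0..<n}" by (simp only: mem_Collect_eq permutes_in_image)
    then show "(\<lambda>k. b k i) \<longlonglongrightarrow> c i" "(\<lambda>k. b k (p i)) \<longlonglongrightarrow> c (p i)"
      using \<open>i \<in> {0..<n}\<close> by (auto intro: assms)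
  qed
qed

context O_hermitian
begin

lemma Olat_exists: assumes dim: "DIM('v) = DIM('k) * m" shows "\<exists>L. Olat L"
proof -
  have d: "dim (UNIV :: 'v set) = DIM('k) * m" using dim by simp
  from orthonormal_K_basis[OF subspace_UNIV UNIV_I d]
  obtain e where e0: "(\<forall>i<m. e i \<in> UNIV) \<and> (\<forall>i<m. \<forall>j<m. h (e i) (e j) = (if i = j then 1 else 0)) \<and>
    (\<forall>y\<in>UNIV. y = (\<Sum>i<m. sc (h y (e i)) (e i)))" ..
  note on = e0[THEN conjunct2, THEN conjunct1, rule_format]
    and rep = e0[THEN conjunct2, THEN conjunct2, rule_format, OF UNIV_I]
  define L where "L = {y. \<forall>i<m. h y (e i) \<in> R}"
  obtain a where a: "a > 0" "\<forall>x\<in>R - {0}. a \<le> x \<bullet> x" by (rule is_lattice_discrete[OF R_full(1)])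
  have "is_lattice L"
  proof (rule discrete_imp_is_lattice[OF _ a(1)])
    show "int_module.subspace L"
      unfolding L_def
      by (rule int_subspaceI) (auto simp: linear_0[OF linear_h_left] linear_diff[OF linear_h_left] R_0 R_diff)
    show "\<forall>y\<in>L - {0}. a \<le> y \<bullet> y"
    proof
      fix y assume y: "y \<in> L - {0}"
      have "h y y = h (\<Sum>i<m. sc (h y (e i)) (e i)) (\<Sum>i<m. sc (h y (e i)) (e i))"
        unfolding rep[of y, symmetric] ..
      also have "\<dots> = (\<Sum>i<m. h y (e i) * kcnj (h y (e i)))" by (rule h_orthonormal_sum[OF on])
      also have "\<dots> = of_real (\<Sum>i<m. h y (e i) \<bullet> h y (e i))" by (simp add: mult_kcnj)
      finally have yy: "y \<bullet> y = (\<Sum>i<m. h y (e i) \<bullet> h y (e i))" unfolding h_self by (simp only: of_real_eq_iff)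
      have "\<exists>i<m. h y (e i) \<noteq> 0"
      proof (rule ccontr)
        assume "\<not> (\<exists>i<m. h y (e i) \<noteq> 0)"
        then have "y \<bullet> y = 0" unfolding yy by simp
        then show False using y by simp
      qed
      then obtain i where i: "i < m" "h y (e i) \<noteq> 0" by blast
      have "a \<le> h y (e i) \<bullet> h y (e i)" using a(2) y i unfolding L_def by blast
      also have "\<dots> \<le> y \<bullet> y" unfolding yy
        using i(1) by (intro member_le_sum[of i "{..<m}" "\<lambda>i. h y (e i) \<bullet> h y (e i)"]) auto
      finally show "a \<le> y \<bullet> y" .
    qed
  qed
  moreover have "span L = UNIV"
  proof -
    have "sc a (e i) \<in> span L" if i: "i < m" for a i
    proof -
      have "(\<lambda>a. sc a (e i)) ` span R = span ((\<lambda>a. sc a (e i)) ` R)"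
        by (rule linear_span_image[OF linear_sc_left, symmetric])
      also have "\<dots> \<subseteq> span L"
        using on i R_0 by (intro span_mono) (auto simp: L_def h_scale_left)
      finally show ?thesis using R_full(2) by blast
    qed
    then have sp: "(\<Sum>i<m. sc (h y (e i)) (e i)) \<in> span L" for y by (intro span_sum) auto
    have "y \<in> span L" for y using sp[of y] unfolding rep[of y, symmetric] .
    then show ?thesis by blast
  qed
  moreover have "sc a y \<in> L" if "a \<in> R" "y \<in> L" for a y
    using that unfolding L_def by (auto simp: h_scale_left R_mult)
  ultimately show ?thesis unfolding is_O_lattice_def by blast
qed

lemma Olat_dim: "Olat L \<Longrightarrow> dim L = DIM('v)"
  by (rule full_lattice_dim[OF OlatD(2)])

lemma Olat_dim_pos: "Olat L \<Longrightarrow> dim L > 0"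
  by (simp add: Olat_dim)

lemma bdd_above_hermite: "bdd_above (hermite_invariant ` {L. Olat L})"
proof (rule bdd_aboveI2)
  fix L assume "L \<in> {L. Olat L}"
  then have L: "Olat L" by simp
  let ?n = "DIM('v)" and ?x = "hermite_invariant L"
  let ?C = "1 / hermite_lower ?n 1"
  have le: "?x ^ ?n \<le> ?C" using hermite_invariant_bound[OF OlatD(1)[OF L] Olat_dim_pos[OF L]] by (simp add: Olat_dim[OF L])
  show "?x \<le> max 1 ?C"
  proof (cases "?x \<le> 1")
    case False
    then have "?x \<le> ?x ^ ?n" by (intro self_le_power) auto
    then show ?thesis using le by simp
  qed simp
qed

lemma hermite_invariant_le: "Olat L \<Longrightarrow> hermite_invariant L \<le> hermite_constant R sc"
  unfolding hermite_constant_def by (rule cSUP_upper[OF _ bdd_above_hermite]) simp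

lemma hermite_constant_pos: assumes "DIM('v) = DIM('k) * m" shows "0 < hermite_constant R sc"
proof -
  obtain L where L: "Olat L" using Olat_exists[OF assms] by blast
  show ?thesis
    using hermite_invariant_pos[OF OlatD(1)[OF L] Olat_dim_pos[OF L]] hermite_invariant_le[OF L] by linarith
qed

lemma Olat_scale: assumes t: "t \<noteq> 0" and L: "Olat L" shows "Olat ((*\<^sub>R) t ` L)"
  unfolding is_O_lattice_def
proof (intro conjI ballI)
  show "is_lattice ((*\<^sub>R) t ` L)" by (rule is_lattice_scale[OF t OlatD(1)[OF L]])
  have "dim ((*\<^sub>R) t ` L) = DIM('v)" using dim_scale[OF t OlatD(1)[OF L]] Olat_dim[OF L] by simp
  then show "span ((*\<^sub>R) t ` L) = UNIV" by (metis dim_eq_full dim_span span_span)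
  show "sc a x \<in> (*\<^sub>R) t ` L" if "a \<in> R" "x \<in> (*\<^sub>R) t ` L" for a x
    using that OlatD(3)[OF L] by (auto simp: sc_scaleR_right)
qed

lemma Olat_normalize:
  assumes L: "Olat L"
  shows "\<exists>M. Olat M \<and> lattice_det M = 1 \<and> min_norm M = hermite_invariant L"
proof -
  let ?n = "DIM('v)" and ?D = "lattice_det L"
  have D: "?D > 0" by (rule lattice_det_pos[OF OlatD(1)[OF L]])
  define t where "t = sqrt (?D powr (- 1 / real ?n))"
  have t2: "t\<^sup>2 = ?D powr (- 1 / real ?n)" and t0: "t \<noteq> 0" using D by (simp_all add: t_def)
  have "(t\<^sup>2) ^ ?n = ?D powr - 1" unfolding t2 using D by (simp add: powr_powr flip: powr_realpow)
  then have d1: "lattice_det ((*\<^sub>R) t ` L) = 1"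
    using D unfolding lattice_det_scale[OF t0 OlatD(1)[OF L]] Olat_dim[OF L] by (simp add: powr_minus)
  have "hermite_invariant ((*\<^sub>R) t ` L) = hermite_invariant L"
    by (rule hermite_invariant_scale[OF t0 OlatD(1)[OF L] Olat_dim_pos[OF L]])
  then have "min_norm ((*\<^sub>R) t ` L) = hermite_invariant L"
    unfolding hermite_invariant_def[of "(*\<^sub>R) t ` L"] d1 by simp
  then show ?thesis using d1 Olat_scale[OF t0 L] by blast
qed

text \<open>A maximizing sequence of normalized lattices has reduced bases whose vectors, and those of
  the dual bases, are bounded; the limits of both are again dual to each other, and the structure
  constants of the \<open>R\<close>-action are integers, hence pass to the limit.\<close>

theorem optimal_exists:
  assumes dim: "DIM('v) = DIM('k) * m" shows "\<exists>L. optimal R sc L"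
proof -
  let ?n = "DIM('v)" and ?G = "hermite_constant R sc"
  have G: "?G > 0" by (rule hermite_constant_pos[OF dim])
  \<comment> \<open>The factor 2 keeps every bound at least \<open>?G / 2\<close>, so that all
    lattices of the sequence share one positive lower bound for their minima.\<close>
  have "\<exists>M. Olat M \<and> lattice_det M = 1 \<and> min_norm M > ?G - ?G / (2 * real (Suc k))" for k
  proof -
    have "?G - ?G / (2 * real (Suc k)) < ?G" using G by simp
    then obtain L where L: "Olat L" "?G - ?G / (2 * real (Suc k)) < hermite_invariant L"
      unfolding hermite_constant_def using less_cSUP_iff[OF _ bdd_above_hermite] Olat_exists[OF dim] by auto
    then show ?thesis using Olat_normalize[OF L(1)] by metis
  qed
  then obtain M where M: "\<And>k. Olat (M k)" "\<And>k. lattice_det (M k) = 1" "\<And>k. min_norm (M k) > ?G - ?G / (2 * real (Suc k))"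
    by metis
  have half: "min_norm (M k) \<ge> ?G / 2" for k
  proof -
    have "?G / (2 * real (Suc k)) \<le> ?G / 2" using G by (intro divide_left_mono) auto
    then show ?thesis using M(3)[of k] by simp
  qed
  define B where "B = max 1 (reduced_bound ?n (?G / 2) 1)"
  have "\<exists>bs. lbasis bs (M k) \<and> length bs = ?n \<and> (\<forall>b\<in>set bs. b \<bullet> b \<le> B)" for k
  proof -
    have "\<forall>x\<in>M k - {0}. ?G / 2 \<le> x \<bullet> x" using half[of k] min_norm_le[of _ "M k"] by force
    then obtain bs where bs: "lbasis bs (M k)" "\<forall>b\<in>set bs. b \<bullet> b \<le> reduced_bound (length bs) (?G / 2) (gdet bs)"
      using reduced_basis[OF OlatD(4)[OF M(1)], of "?G / 2" k] G by auto
    have "length bs = ?n" "gdet bs = 1"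
      using lbasis_length[OF bs(1)] Olat_dim[OF M(1)] lattice_det_eq[OF bs(1)] M(2)[of k] by simp_all
    then show ?thesis using bs unfolding B_def by (intro exI[of _ bs]) force
  qed
  then obtain bs where bs: "\<And>k. lbasis (bs k) (M k)" "\<And>k. length (bs k) = ?n" "\<And>k b. b \<in> set (bs k) \<Longrightarrow> b \<bullet> b \<le> B"
    by metis
  have "\<exists>ds. length ds = ?n \<and> (\<forall>i<?n. \<forall>j<?n. bs k ! i \<bullet> ds ! j = (if i = j then 1 else 0))" for k
    using dual_list[of "bs k"] bs(1,2)[of k] unfolding lbasis_def by simp
  from choice[OF allI[OF this]] obtain ds where
    ds0: "\<forall>k. length (ds k) = ?n \<and> (\<forall>i<?n. \<forall>j<?n. bs k ! i \<bullet> ds k ! j = (if i = j then 1 else 0))" ..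
  then have dsl: "length (ds k) = ?n" and dual: "i < ?n \<Longrightarrow> j < ?n \<Longrightarrow> bs k ! i \<bullet> ds k ! j = (if i = j then 1 else 0)" for k i j
    by auto
  have B1: "B \<ge> 1" by (simp add: B_def)
  have bbd: "bounded (range (\<lambda>k. bs k ! i))" if "i < ?n" for i
  proof -
    have "bs k ! i \<bullet> bs k ! i \<le> B" for k using bs(3)[OF nth_mem, of i k] bs(2)[of k] that by simp
    then show ?thesis unfolding bounded_iff by (intro exI[of _ "sqrt B"]) (auto simp: norm_eq_sqrt_inner)
  qed
  have dbd: "bounded (range (\<lambda>k. ds k ! i))" if "i < ?n" for i
  proof -
    have "ds k ! i \<bullet> ds k ! i \<le> B ^ ?n" for k
      using dual_vector_bound[OF bs(1,2) _ _ _ B1 bs(3), of i k "ds k"] that bs(2)[of k] dsl[of k] dual M(2)[of k] by simp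
    then show ?thesis unfolding bounded_iff by (intro exI[of _ "sqrt (B ^ ?n)"]) (auto simp: norm_eq_sqrt_inner)
  qed
  \<comment> \<open>Basis and dual basis are concatenated so that one subsequence makes both
    converge.\<close>
  let ?b = "\<lambda>k i. if i < ?n then bs k ! i else ds k ! (i - ?n)"
  have bnd: "bounded (range (\<lambda>k. ?b k i))" if "i < 2 * ?n" for i
    using bbd[of i] dbd[of "i - ?n"] that by (cases "i < ?n") auto
  have "\<exists>r c. strict_mono r \<and> (\<forall>i<2 * ?n. (\<lambda>k. ?b (r k) i) \<longlonglongrightarrow> c i)"
    by (rule common_convergent_subsequence[of "2 * ?n" ?b]) (rule bnd)
  then obtain r cc where
    rcc: "strict_mono (r :: nat \<Rightarrow> nat) \<and> (\<forall>i<2 * ?n. (\<lambda>k. ?b (r k) i) \<longlonglongrightarrow> cc i)" by (elim exE)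
  then have r: "strict_mono r" and cc: "\<And>i. i < 2 * ?n \<Longrightarrow> (\<lambda>k. ?b (r k) i) \<longlonglongrightarrow> cc i" by blast+
  define e where "e j = cc (?n + j)" for j
  have c: "(\<lambda>k. bs (r k) ! i) \<longlonglongrightarrow> cc i" if "i < ?n" for i using cc[of i] that by simp
  have e: "(\<lambda>k. ds (r k) ! j) \<longlonglongrightarrow> e j" if "j < ?n" for j using cc[of "?n + j"] that unfolding e_def by simp
  have ce: "cc i \<bullet> e j = (if i = j then 1 else 0)" if "i < ?n" "j < ?n" for i j
  proof -
    have "(\<lambda>k. bs (r k) ! i \<bullet> ds (r k) ! j) \<longlonglongrightarrow> cc i \<bullet> e j" using c e that by (intro tendsto_inner)
    then show ?thesis unfolding dual[OF that] by (simp only: LIMSEQ_const_iff)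
  qed
  define cs where "cs = map cc [0..<?n]"
  define es where "es = map e [0..<?n]"
  have len: "length cs = ?n" "length es = ?n" and nth: "i < ?n \<Longrightarrow> cs ! i = cc i" "i < ?n \<Longrightarrow> es ! i = e i" for i
    by (simp_all add: cs_def es_def)
  have coords: "lcomb cs a \<bullet> e j = a j" if "j < ?n" for a j
    using lcomb_inner_dual[of es cs j a] that len nth ce by simp
  have free: "free_list cs"
    unfolding free_list_def using coords len by (metis inner_zero_left)
  define L where "L = range (\<lambda>a::nat \<Rightarrow> int. lcomb cs (\<lambda>j. of_int (a j)))"
  have lb: "lbasis cs L" using free by (simp add: lbasis_def L_def)
  have full: "is_lattice L" "span L = UNIV" using full_lbasis_iff[of L] lb len by auto
  have UNIV_cs: "range (lcomb cs) = UNIV" using full(2) unfolding lbasis_span[OF lb] span_eq_lcomb .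
  have rep: "y = lcomb cs (\<lambda>j. y \<bullet> e j)" for y
  proof -
    obtain a where a: "y = lcomb cs a" using UNIV_cs by blast
    have "lcomb cs a = lcomb cs (\<lambda>j. lcomb cs a \<bullet> e j)" using coords len by (intro lcomb_cong) simp
    then show ?thesis unfolding a .
  qed
  have OL: "Olat L"
    unfolding is_O_lattice_def
  proof (intro conjI ballI full)
    fix a x assume a: "a \<in> R" and x: "x \<in> L"
    have basis: "sc a (cs ! i) \<in> L" if i: "i < ?n" for i
    proof -
      have int: "sc a (bs (r k) ! i) \<bullet> ds (r k) ! j \<in> \<int>" if j: "j < ?n" for k j
      proof -
        have "bs (r k) ! i \<in> M (r k)" using lbasis_subset[OF bs(1)] bs(2) i nth_mem by (metis subsetD)
        then have "sc a (bs (r k) ! i) \<in> M (r k)" by (rule OlatD(3)[OF M(1) a])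
        then obtain q :: "nat \<Rightarrow> int" where q: "sc a (bs (r k) ! i) = lcomb (bs (r k)) (\<lambda>j. of_int (q j))"
          using bs(1)[of "r k"] unfolding lbasis_def by blast
        have "lcomb (bs (r k)) (\<lambda>j. of_int (q j)) \<bullet> ds (r k) ! j = of_int (q j)"
          using lcomb_inner_dual[of "ds (r k)" "bs (r k)" j "\<lambda>j. of_int (q j)"] bs(2)[of "r k"] dsl[of "r k"] dual j by simp
        then show ?thesis unfolding q by simp
      qed
      have "(\<lambda>k. sc a (bs (r k) ! i)) \<longlonglongrightarrow> sc a (cc i)"
        using linear_continuous_at[OF linear_conv_bounded_linear[THEN iffD1, OF linear_sc]] c[OF i] isCont_tendsto_compose by blast
      then have "(\<lambda>k. sc a (bs (r k) ! i) \<bullet> ds (r k) ! j) \<longlonglongrightarrow> sc a (cc i) \<bullet> e j" if "j < ?n" for j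
        using e[OF that] by (intro tendsto_inner)
      then have "sc a (cc i) \<bullet> e j \<in> \<int>" if "j < ?n" for j
        using Lim_in_closed_set[OF closed_Ints _ trivial_limit_sequentially] int that by (metis (no_types, lifting) eventually_sequentiallyI)
      then have "sc a (cc i) \<bullet> e j = of_int \<lfloor>sc a (cc i) \<bullet> e j\<rfloor>" if "j < ?n" for j using that by (auto elim!: Ints_cases)
      then have "sc a (cc i) = lcomb cs (\<lambda>j. of_int \<lfloor>sc a (cc i) \<bullet> e j\<rfloor>)"
        using rep[of "sc a (cc i)"] len lcomb_cong[of cs "\<lambda>j. sc a (cc i) \<bullet> e j" "\<lambda>j. of_int \<lfloor>sc a (cc i) \<bullet> e j\<rfloor>"] by simp
      then show ?thesis unfolding L_def nth(1)[OF i]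
        by (rule image_eqI[where x = "\<lambda>j. \<lfloor>sc a (cc i) \<bullet> e j\<rfloor>"]) (rule UNIV_I)
    qed
    obtain q :: "nat \<Rightarrow> int" where q: "x = lcomb cs (\<lambda>j. of_int (q j))" using x unfolding L_def by blast
    have "sc a x = (\<Sum>j<?n. of_int (q j) *\<^sub>R sc a (cs ! j))"
      unfolding q lcomb_def len by (simp add: sc_sum sc_scaleR_right)
    also have "\<dots> \<in> L"
      using basis by (intro int_module.subspace_sum[OF lbasis_subspace[OF lb]] int_module.subspace_scale[OF lbasis_subspace[OF lb]]) auto
    finally show "sc a x \<in> L" .
  qed
  have "(\<lambda>k. gdet (map ((!) (bs (r k))) [0..<?n])) \<longlonglongrightarrow> gdet (map cc [0..<?n])"
    by (rule tendsto_gdet) (rule c)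
  moreover have "gdet (map ((!) (bs (r k))) [0..<?n]) = 1" for k
    using lattice_det_eq[OF bs(1)] M(2) bs(2)[of "r k"] map_nth[of "bs (r k)"] by metis
  ultimately have "gdet cs = 1" unfolding cs_def by (simp add: LIMSEQ_const_iff)
  then have det1: "lattice_det L = 1" using lattice_det_eq[OF lb] by simp
  have "?G \<le> min_norm L"
  proof (rule min_norm_ge)
    show "L - {0} \<noteq> {}" using Olat_dim_pos[OF OL] lattice_dim_pos[of L] int_module.subspace_0[OF OlatD(4)[OF OL]] by blast
    fix x assume x: "x \<in> L" "x \<noteq> 0"
    obtain q :: "nat \<Rightarrow> int" where q: "x = lcomb cs (\<lambda>j. of_int (q j))" using x unfolding L_def by blast
    let ?x = "\<lambda>k. lcomb (bs (r k)) (\<lambda>j. of_int (q j))"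
    have "?x k \<in> M (r k)" "?x k \<noteq> 0" for k
    proof -
      show "?x k \<in> M (r k)" using bs(1)[of "r k"] unfolding lbasis_def by blast
      show "?x k \<noteq> 0"
      proof
        assume "?x k = 0"
        then have "\<forall>j<?n. (of_int (q j) :: real) = 0" using bs(1,2)[of "r k"] unfolding lbasis_def free_list_def by metis
        then have "x = 0" unfolding q lcomb_def len by simp
        then show False using x(2) by simp
      qed
    qed
    then have ge: "?x k \<bullet> ?x k \<ge> ?G - ?G / (2 * real (Suc (r k)))" for k
      using min_norm_le[of "?x k" "M (r k)"] M(3)[of "r k"] by (meson less_imp_le order_trans)
    have ge': "?x k \<bullet> ?x k \<ge> ?G - ?G / (2 * real (Suc k))" for k
    proof -
      have "k \<le> r k" using r by (rule seq_suble)
      then have "?G / (2 * real (Suc (r k))) \<le> ?G / (2 * real (Suc k))" using G by (intro divide_left_mono) auto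
      then show ?thesis using ge[of k] by simp
    qed
    have "?x \<longlonglongrightarrow> x"
      unfolding q lcomb_def bs(2) len using c nth by (intro tendsto_sum tendsto_scaleR tendsto_const) auto
    then have "(\<lambda>k. ?x k \<bullet> ?x k) \<longlonglongrightarrow> x \<bullet> x" by (intro tendsto_inner)
    moreover have "(\<lambda>k. ?G - ?G / (2 * real (Suc k))) \<longlonglongrightarrow> ?G - 0"
    proof (intro tendsto_diff tendsto_const)
      have "(\<lambda>k. (?G / 2) * inverse (real (Suc k))) \<longlonglongrightarrow> (?G / 2) * 0"
        by (intro tendsto_mult tendsto_const LIMSEQ_inverse_real_of_nat)
      then show "(\<lambda>k. ?G / (2 * real (Suc k))) \<longlonglongrightarrow> 0" by (simp add: field_simps)
    qed
    ultimately have "?G - 0 \<le> x \<bullet> x" using ge' by (intro LIMSEQ_le) auto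
    then show "?G \<le> x \<bullet> x" by simp
  qed
  then have "?G \<le> hermite_invariant L" unfolding hermite_invariant_def det1 by simp
  then show ?thesis using hermite_invariant_le[OF OL] OL unfolding optimal_def by (intro exI[of _ L]) auto
qed

end

section \<open>The inequality and its equality case\<close>

lemma ln_hermite_invariant:
  fixes L :: "'v::euclidean_space set"
  assumes "is_lattice L" "dim L > 0"
  shows "real (dim L) * ln (hermite_invariant L) = real (dim L) * ln (min_norm L) - ln (lattice_det L)"
proof -
  have ln: "real n * ln (N / D powr (1 / real n)) = real n * ln N - ln D" if "N > 0" "D > 0" "n > 0" for N D :: real and n :: nat
    using that by (simp add: ln_div ln_powr algebra_simps)
  show ?thesis
    unfolding hermite_invariant_def
    by (rule ln[OF min_norm_pos[OF assms(1) lattice_dim_pos[OF assms(2)]] lattice_det_pos[OF assms(1)] assms(2)])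
qed

text \<open>The linear bookkeeping among logarithms. With G the section, a and b belong to the
  minima of L and G, xx to the norm of x, dl and dG to the determinants of L and G, and q = dl / m;
  g, gs and gG belong to the Hermite invariants of L, L# and G, D to the discriminant of the order
  and \<kappa> to the index. The value c may be arbitrary.\<close>

lemma slack_identity:
  fixes r m g q a b c gs gG D dG dl xx \<kappa> :: real
  assumes f1: "r * a = r * g + q" and f2: "r * xx = r * gs + 2 * D - q"
    and e2: "r * (m - 1) * gG = r * (m - 1) * b - dG" and e5: "2 * \<kappa> + D + dG = r * xx + dl" and q: "dl = m * q"
  shows "r * (m - 2) * g = r * (m - 1) * c + D
    - (r * (m - 1) * (b - a) + r * (m - 1) * (c - gG) + r * (g - gs) + 2 * \<kappa>)"
proof -
  have A: "r * (m - 1) * a = (m - 1) * (r * g + q)" by (simp add: f1[symmetric])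
  have dG: "dG = r * gs + 2 * D - q + m * q - 2 * \<kappa> - D" using f2 e5 q by linarith
  have "r * (m - 1) * c + D - (r * (m - 1) * (b - a) + r * (m - 1) * (c - gG) + r * (g - gs) + 2 * \<kappa>)
      = D - r * (m - 1) * b + r * (m - 1) * a + r * (m - 1) * gG - r * (g - gs) - 2 * \<kappa>"
    by (simp add: right_diff_distrib)
  also have "\<dots> = r * (m - 2) * g"
    unfolding A e2 dG by (simp add: algebra_simps)
  finally show ?thesis ..
qed

context O_hermitian
begin

lemma section_hermite_le:
  fixes sc' :: "'k \<Rightarrow> 'w::euclidean_space \<Rightarrow> 'w"
  assumes w: "hermitian_space sc' h'" and dimv: "DIM('v) = DIM('k) * m" and dimw: "DIM('w) = DIM('k) * (m - 1)"
    and L: "Olat L" and x: "x \<in> dualO L" "x \<noteq> 0"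
  shows "hermite_invariant (L \<inter> (K_line sc x)\<^sup>\<bottom>) \<le> hermite_constant R sc'"
proof -
  let ?S = "(K_line sc x)\<^sup>\<bottom>"
  interpret W: O_hermitian A R sc' h'
    unfolding O_hermitian_def using maximal_order_axioms w by blast
  note sec = section_lattice[OF L x dimv]
  have dimS: "dim ?S = DIM('k) * (m - 1)"
    using dim_orth_K_line[OF x(2)] dimv by (simp add: right_diff_distrib')
  from K_isometry[OF hermitian_space_axioms w subspace_orthogonal_comp orth_K_line_sc dimS dimw]
  obtain g where g0: "linear g \<and> (\<forall>x y. g x \<bullet> g y = x \<bullet> y) \<and> range g = ?S \<and> (\<forall>a x. g (sc' a x) = sc a (g x))" ..
  then have g: "linear g" "\<And>x y. g x \<bullet> g y = x \<bullet> y" "range g = ?S" "\<And>a x. g (sc' a x) = sc a (g x)" by auto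
  let ?M = "g -` (L \<inter> ?S)"
  have img: "g ` ?M = L \<inter> ?S" using g(3) by (simp only: image_vimage_eq) blast
  have lat: "is_lattice ?M" by (rule is_lattice_isometry_vimage[OF g(1,2) sec(1)])
  have "dim ?M = DIM('w)" using dim_isometry_image[OF g(1,2), of ?M] sec(2) dimw unfolding img by simp
  then have "span ?M = UNIV" by (metis dim_eq_full dim_span span_span)
  moreover have "sc' a y \<in> ?M" if "a \<in> R" "y \<in> ?M" for a y
    using that OlatD(3)[OF L] orth_K_line_sc g(4) by auto
  ultimately have "W.Olat ?M" unfolding is_O_lattice_def using lat by blast
  then have "hermite_invariant ?M \<le> hermite_constant R sc'" by (rule W.hermite_invariant_le)
  then show ?thesis using hermite_invariant_isometry_image[OF g(1,2) lat] unfolding img by simp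
qed

text \<open>The four subtracted terms are the losses of the chain of estimates. With c the logarithm
  argument of the lower-dimensional constant they vanish, in this order, under conditions (1) and
  (3), under optimality of the dual, and under (2), which is k = 1.\<close>

lemma hermite_log_identity:
  fixes sc' :: "'k \<Rightarrow> 'w::euclidean_space \<Rightarrow> 'w"
  assumes dimv: "DIM('v) = DIM('k) * m" and m: "m \<ge> 3"
    and L: "optimal R sc L" and x: "x \<in> minimal_vectors (dualO L)"
  defines "G \<equiv> L \<inter> (K_line sc x)\<^sup>\<bottom>"
  shows "\<exists>k\<ge>1. (k = 1 \<longleftrightarrow> dualO L \<inter> K_line sc x = {sc a x | a. a \<in> R}) \<and>
    DIM('k) * (real m - 2) * ln (hermite_constant R sc) =
      DIM('k) * (real m - 1) * ln c + ln (lattice_det R)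
      - (DIM('k) * (real m - 1) * (ln (min_norm G) - ln (min_norm L))
         + DIM('k) * (real m - 1) * (ln c - ln (hermite_invariant G))
         + DIM('k) * (ln (hermite_constant R sc) - ln (hermite_invariant (dualO L)))
         + 2 * ln (real k))"
proof -
  let ?r = "real DIM('k)" and ?L' = "dualO L"
  have OL: "Olat L" and LG: "hermite_invariant L = hermite_constant R sc" using L by (auto simp: optimal_def)
  have OL': "Olat ?L'" by (rule Olat_dualO[OF OL])
  have x': "x \<in> ?L'" "x \<noteq> 0" "x \<bullet> x = min_norm ?L'" using x by (auto simp: minimal_vectors_def)
  note sec = section_lattice[OF OL x'(1,2) dimv, folded G_def]
  obtain k where k: "k \<ge> 1" "(real k)\<^sup>2 * lattice_det R * lattice_det G = (x \<bullet> x) ^ DIM('k) * lattice_det L"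
    "k = 1 \<longleftrightarrow> dualO L \<inter> K_line sc x = {sc a x | a. a \<in> R}"
    using sec(4) by blast
  have dG: "real (dim G) = ?r * (real m - 1)" using sec(2) m by (simp add: of_nat_diff)
  have "dim G > 0" using sec(2) m by simp
  have pos: "lattice_det R > 0" "lattice_det G > 0" "lattice_det L > 0" "lattice_det ?L' > 0" "x \<bullet> x > 0"
    using lattice_det_pos[OF R_full(1)] lattice_det_pos[OF sec(1)] lattice_det_pos[OF OlatD(1)[OF OL]]
      lattice_det_pos[OF OlatD(1)[OF OL']] x'(2) by auto
  have dn: "real (dim L) = ?r * real m" "real (dim ?L') = ?r * real m" using Olat_dim[OF OL] Olat_dim[OF OL'] dimv by simp_all
  define dl where "dl = ln (lattice_det L)"
  define D where "D = ln (lattice_det R)"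
  define q where "q = dl / real m"
  have r0: "?r \<noteq> 0" and m0: "real m \<noteq> 0" using m by auto
  have q: "dl = real m * q" using m0 by (simp add: q_def)
  have e1: "?r * real m * ln (hermite_constant R sc) = ?r * real m * ln (min_norm L) - dl"
    using ln_hermite_invariant[OF OlatD(1)[OF OL] Olat_dim_pos[OF OL]] unfolding dn LG dl_def by simp
  have e2: "?r * (real m - 1) * ln (hermite_invariant G) = ?r * (real m - 1) * ln (min_norm G) - ln (lattice_det G)"
    using ln_hermite_invariant[OF sec(1) \<open>dim G > 0\<close>] unfolding dG by simp
  have e3: "?r * real m * ln (hermite_invariant ?L') = ?r * real m * ln (x \<bullet> x) - ln (lattice_det ?L')"
    using ln_hermite_invariant[OF OlatD(1)[OF OL'] Olat_dim_pos[OF OL']] unfolding dn x'(3) by simp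
  have "ln (lattice_det L * lattice_det ?L') = ln (lattice_det R ^ (2 * m))" by (simp only: det_dualO[OF OL dimv])
  then have e4: "dl + ln (lattice_det ?L') = 2 * real m * D"
    using pos by (simp add: ln_mult ln_realpow dl_def D_def)
  have "ln ((real k)\<^sup>2 * lattice_det R * lattice_det G) = ln ((x \<bullet> x) ^ DIM('k) * lattice_det L)" by (simp only: k(2))
  then have e5: "2 * ln (real k) + D + ln (lattice_det G) = ?r * ln (x \<bullet> x) + dl"
    using pos k(1) by (simp add: ln_mult ln_realpow dl_def D_def)
  have "real m * (?r * ln (min_norm L)) = real m * (?r * ln (hermite_constant R sc) + q)"
    using e1 q by (simp add: algebra_simps)
  then have f1: "?r * ln (min_norm L) = ?r * ln (hermite_constant R sc) + q" using m0 by simp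
  have "real m * (?r * ln (x \<bullet> x)) = real m * (?r * ln (hermite_invariant ?L') + 2 * D - q)"
    using e3 e4 q by (simp add: algebra_simps)
  then have f2: "?r * ln (x \<bullet> x) = ?r * ln (hermite_invariant ?L') + 2 * D - q" using m0 by simp
  have "?r * (real m - 2) * ln (hermite_constant R sc) =
      ?r * (real m - 1) * ln c + D
      - (?r * (real m - 1) * (ln (min_norm G) - ln (min_norm L))
         + ?r * (real m - 1) * (ln c - ln (hermite_invariant G))
         + ?r * (ln (hermite_constant R sc) - ln (hermite_invariant ?L'))
         + 2 * ln (real k))"
    by (rule slack_identity[OF f1 f2 e2 e5 q])
  then show ?thesis using k(1,3) unfolding D_def by blast
qed

text \<open>The weighted sum \<open>bad\<close> of the losses equals r(m-2) (ln P - ln gamma),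
  whichever optimal L and minimal x are taken. Equality therefore makes every loss vanish for all
  pairs, and conversely the conditions for the single pair \<open>L0\<close>, \<open>x0\<close>
  already give equality.\<close>

theorem hermite_constant_bound:
  fixes sc' :: "'k \<Rightarrow> 'w::euclidean_space \<Rightarrow> 'w"
  assumes w: "hermitian_space sc' h'" and dimv: "DIM('v) = DIM('k) * m" and dimw: "DIM('w) = DIM('k) * (m - 1)"
    and m: "m \<ge> 3"
  defines "P \<equiv> hermite_constant R sc' powr ((real m - 1) / (real m - 2))
           * order_disc R powr (1 / (real DIM('k) * (real m - 2)))"
  shows "hermite_constant R sc \<le> P"
    and "hermite_constant R sc = P \<longleftrightarrow>
       (\<forall>\<Lambda>. optimal R sc \<Lambda> \<longrightarrow>
          optimal R sc (dualO \<Lambda>) \<and>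
          (\<forall>x\<in>minimal_vectors (dualO \<Lambda>).
             min_norm (\<Lambda> \<inter> (K_line sc x)\<^sup>\<bottom>) = min_norm \<Lambda> \<and>
             dualO \<Lambda> \<inter> K_line sc x = {sc a x | a. a \<in> R} \<and>
             hermite_invariant (\<Lambda> \<inter> (K_line sc x)\<^sup>\<bottom>) = hermite_constant R sc'))"
proof -
  let ?r = "real DIM('k)" and ?g = "hermite_constant R sc" and ?c = "hermite_constant R sc'"
  interpret W: O_hermitian A R sc' h'
    unfolding O_hermitian_def using maximal_order_axioms w by blast
  have g0: "?g > 0" by (rule hermite_constant_pos[OF dimv])
  have c0: "?c > 0" by (rule W.hermite_constant_pos[OF dimw])
  have D0: "lattice_det R > 0" by (rule lattice_det_pos[OF R_full(1)])
  have P0: "P > 0" unfolding P_def order_disc_eq_lattice_det using c0 D0 by simp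
  have rm: "?r * (real m - 2) > 0" "?r > 0" "?r * (real m - 1) > 0" using m by auto
  have "ln P = (real m - 1) / (real m - 2) * ln ?c + 1 / (?r * (real m - 2)) * ln (lattice_det R)"
    unfolding P_def order_disc_eq_lattice_det using c0 D0 by (simp add: ln_mult ln_powr)
  moreover have "r * M * (N / M * y + 1 / (r * M) * z) = r * N * y + z" if "r \<noteq> 0" "M \<noteq> 0" for r M N y z :: real
    using that by (simp add: distrib_left)
  from this[of ?r "real m - 2" "real m - 1"]
  have "?r * (real m - 2) * ((real m - 1) / (real m - 2) * ln ?c + 1 / (?r * (real m - 2)) * ln (lattice_det R))
      = ?r * (real m - 1) * ln ?c + ln (lattice_det R)" using m by simp
  ultimately have lnP: "?r * (real m - 2) * ln P = ?r * (real m - 1) * ln ?c + ln (lattice_det R)" by simp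
  define bad where "bad L x k = ?r * (real m - 1) * (ln (min_norm (L \<inter> (K_line sc x)\<^sup>\<bottom>)) - ln (min_norm L))
         + ?r * (real m - 1) * (ln ?c - ln (hermite_invariant (L \<inter> (K_line sc x)\<^sup>\<bottom>)))
         + ?r * (ln ?g - ln (hermite_invariant (dualO L)))
         + 2 * ln (real k)" for L x and k :: nat
  have main: "\<exists>k\<ge>1. (k = 1 \<longleftrightarrow> dualO L \<inter> K_line sc x = {sc a x | a. a \<in> R}) \<and>
      ?r * (real m - 2) * (ln P - ln ?g) = bad L x k \<and> bad L x k \<ge> 0 \<and>
      (bad L x k = 0 \<longleftrightarrow> min_norm (L \<inter> (K_line sc x)\<^sup>\<bottom>) = min_norm L \<and>
         hermite_invariant (L \<inter> (K_line sc x)\<^sup>\<bottom>) = ?c \<and> hermite_invariant (dualO L) = ?g \<and> k = 1)"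
    if L: "optimal R sc L" and x: "x \<in> minimal_vectors (dualO L)" for L x
  proof -
    let ?G = "L \<inter> (K_line sc x)\<^sup>\<bottom>"
    obtain k where k: "k \<ge> 1" "k = 1 \<longleftrightarrow> dualO L \<inter> K_line sc x = {sc a x | a. a \<in> R}"
      "?r * (real m - 2) * ln ?g = ?r * (real m - 1) * ln ?c + ln (lattice_det R) - bad L x k"
      using hermite_log_identity[OF dimv m L x, of ?c] unfolding bad_def by blast
    have e: "?r * (real m - 2) * (ln P - ln ?g) = bad L x k"
      using k(3) lnP by (simp add: right_diff_distrib)
    have OL: "Olat L" using L by (simp add: optimal_def)
    have OL': "Olat (dualO L)" by (rule Olat_dualO[OF OL])
    have x': "x \<in> dualO L" "x \<noteq> 0" using x by (auto simp: minimal_vectors_def)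
    note sec = section_lattice[OF OL x' dimv]
    have dG: "dim ?G > 0" using sec(2) m by simp
    have G0: "?G \<noteq> {0}" by (rule lattice_dim_pos[OF dG])
    have p: "min_norm ?G > 0" "min_norm L > 0" "hermite_invariant ?G > 0" "hermite_invariant (dualO L) > 0"
      using min_norm_pos[OF sec(1) G0] min_norm_pos[OF OlatD(1)[OF OL] lattice_dim_pos[OF Olat_dim_pos[OF OL]]]
        hermite_invariant_pos[OF sec(1) dG] hermite_invariant_pos[OF OlatD(1)[OF OL'] Olat_dim_pos[OF OL']] by auto
    have "?G - {0} \<noteq> {}" using G0 int_module.subspace_0[OF is_lattice_subspace[OF sec(1)]] by blast
    then have i1: "min_norm L \<le> min_norm ?G" by (intro min_norm_antimono) auto
    have i2: "hermite_invariant ?G \<le> ?c" by (rule section_hermite_le[OF w dimv dimw OL x'])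
    have i3: "hermite_invariant (dualO L) \<le> ?g" by (rule hermite_invariant_le[OF OL'])
    have s1: "0 \<le> ln (min_norm ?G) - ln (min_norm L)" "ln (min_norm ?G) - ln (min_norm L) = 0 \<longleftrightarrow> min_norm ?G = min_norm L"
      using i1 p by auto
    have s2: "0 \<le> ln ?c - ln (hermite_invariant ?G)" "ln ?c - ln (hermite_invariant ?G) = 0 \<longleftrightarrow> hermite_invariant ?G = ?c"
      using i2 p c0 by auto
    have s3: "0 \<le> ln ?g - ln (hermite_invariant (dualO L))" "ln ?g - ln (hermite_invariant (dualO L)) = 0 \<longleftrightarrow> hermite_invariant (dualO L) = ?g"
      using i3 p g0 by auto
    have s4: "0 \<le> ln (real k)" "ln (real k) = 0 \<longleftrightarrow> k = 1" using k(1) by auto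
    have sum: "0 \<le> a * s + a * t + b * u + 2 * v \<and> (a * s + a * t + b * u + 2 * v = 0 \<longleftrightarrow> s = 0 \<and> t = 0 \<and> u = 0 \<and> v = 0)"
      if "0 < a" "0 < b" "0 \<le> s" "0 \<le> t" "0 \<le> u" "0 \<le> v" for a b s t u v :: real
    proof -
      have "0 \<le> a * s" "0 \<le> a * t" "0 \<le> b * u" using that by auto
      moreover have "a * s = 0 \<longleftrightarrow> s = 0" "a * t = 0 \<longleftrightarrow> t = 0" "b * u = 0 \<longleftrightarrow> u = 0" using that by auto
      ultimately show ?thesis using that(6) by (smt (verit))
    qed
    have "0 \<le> bad L x k \<and> (bad L x k = 0 \<longleftrightarrow> min_norm ?G = min_norm L \<and> hermite_invariant ?G = ?c \<and>
        hermite_invariant (dualO L) = ?g \<and> k = 1)"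
      using sum[OF rm(3,2) s1(1) s2(1) s3(1) s4(1)] unfolding bad_def s1(2) s2(2) s3(2) s4(2) .
    then show ?thesis using k(1,2) e by blast
  qed
  have nonempty: "\<exists>x. x \<in> minimal_vectors (dualO L)" if "optimal R sc L" for L
  proof -
    have O: "Olat (dualO L)" using that by (intro Olat_dualO) (simp add: optimal_def)
    show ?thesis using minimal_vectors_nonempty[OF OlatD(1)[OF O] lattice_dim_pos[OF Olat_dim_pos[OF O]]] by blast
  qed
  obtain L0 where L0: "optimal R sc L0" using optimal_exists[OF dimv] by blast
  obtain x0 where x0: "x0 \<in> minimal_vectors (dualO L0)" using nonempty[OF L0] by blast
  have "0 \<le> ?r * (real m - 2) * (ln P - ln ?g)" using main[OF L0 x0] by auto
  then have "ln ?g \<le> ln P" using rm(1) by (simp add: zero_le_mult_iff)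
  then show "?g \<le> P" using g0 P0 by simp
  have eq_iff: "?g = P \<longleftrightarrow> ?r * (real m - 2) * (ln P - ln ?g) = 0"
    using rm(1) g0 P0 by auto
  show "?g = P \<longleftrightarrow>
       (\<forall>\<Lambda>. optimal R sc \<Lambda> \<longrightarrow>
          optimal R sc (dualO \<Lambda>) \<and>
          (\<forall>x\<in>minimal_vectors (dualO \<Lambda>).
             min_norm (\<Lambda> \<inter> (K_line sc x)\<^sup>\<bottom>) = min_norm \<Lambda> \<and>
             dualO \<Lambda> \<inter> K_line sc x = {sc a x | a. a \<in> R} \<and>
             hermite_invariant (\<Lambda> \<inter> (K_line sc x)\<^sup>\<bottom>) = ?c))" (is "_ \<longleftrightarrow> ?C")
  proof
    assume "?g = P"
    then have z: "?r * (real m - 2) * (ln P - ln ?g) = 0" using eq_iff by blast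
    have all: "hermite_invariant (dualO L) = ?g \<and> min_norm (L \<inter> (K_line sc x)\<^sup>\<bottom>) = min_norm L \<and>
        dualO L \<inter> K_line sc x = {sc a x | a. a \<in> R} \<and> hermite_invariant (L \<inter> (K_line sc x)\<^sup>\<bottom>) = ?c"
      if L: "optimal R sc L" and x: "x \<in> minimal_vectors (dualO L)" for L x
      using main[OF L x] unfolding z by metis
    show ?C
    proof (intro allI impI conjI ballI)
      fix L assume L: "optimal R sc L"
      obtain x where x: "x \<in> minimal_vectors (dualO L)" using nonempty[OF L] by blast
      have "Olat (dualO L)" using L by (intro Olat_dualO) (simp add: optimal_def)
      then show "optimal R sc (dualO L)" unfolding optimal_def using all[OF L x] by blast
    qed (use all in blast)+
  next
    assume C: ?C
    then have "optimal R sc (dualO L0)" using L0 by blast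
    then have "hermite_invariant (dualO L0) = ?g" by (simp add: optimal_def)
    moreover have "min_norm (L0 \<inter> (K_line sc x0)\<^sup>\<bottom>) = min_norm L0"
        "dualO L0 \<inter> K_line sc x0 = {sc a x0 | a. a \<in> R}" "hermite_invariant (L0 \<inter> (K_line sc x0)\<^sup>\<bottom>) = ?c"
      using C L0 x0 by blast+
    ultimately have "?r * (real m - 2) * (ln P - ln ?g) = 0" using main[OF L0 x0] by metis
    then show "?g = P" using eq_iff by blast
  qed
qed

end

section \<open>The real spans of the two kinds of algebras\<close>

lemma span_imaginary_quadratic_field:
  assumes "imaginary_quadratic_field A" shows "span A = UNIV"
proof -
  obtain d :: nat where d: "d > 0" "A = {of_rat p + of_rat q * (\<i> * of_real (sqrt (real d))) | p q. True}"
    using assms unfolding imaginary_quadratic_field_def by blast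
  have "of_rat 1 + of_rat 0 * (\<i> * of_real (sqrt (real d))) \<in> A"
    "of_rat 0 + of_rat 1 * (\<i> * of_real (sqrt (real d))) \<in> A"
    unfolding d(2) by blast+
  then have mem: "1 \<in> A" "\<i> * of_real (sqrt (real d)) \<in> A" by simp_all
  have "z \<in> span A" for z
  proof -
    have "z = Re z *\<^sub>R 1 + (Im z / sqrt (real d)) *\<^sub>R (\<i> * of_real (sqrt (real d)))"
      using d(1) by (simp add: complex_eq_iff)
    also have "\<dots> \<in> span A" using mem by (intro span_add span_scale span_base)
    finally show ?thesis .
  qed
  then show ?thesis by blast
qed

text \<open>The imaginary part of i^2 is twice the real part of i times its imaginary part. With a
  nonzero real part, i would be real and its square nonnegative.\<close>

lemma qRe_of_neg_square:
  assumes "i * i = of_real a" "a < 0" shows "qRe i = 0"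
proof (rule ccontr)
  assume n: "qRe i \<noteq> 0"
  have "of_real a = Quat a 0 0 0" by (simp add: of_real_def quat_eq_iff one_quat_def)
  then have e: "qRe i * qRe i - qI i * qI i - qJ i * qJ i - qK i * qK i = a"
    "qRe i * qI i + qI i * qRe i + qJ i * qK i - qK i * qJ i = 0"
    "qRe i * qJ i - qI i * qK i + qJ i * qRe i + qK i * qI i = 0"
    "qRe i * qK i + qI i * qJ i - qJ i * qI i + qK i * qRe i = 0"
    using assms(1) by (simp_all add: times_quat_def)
  have "qI i = 0" "qJ i = 0" "qK i = 0" using e(2-4) n by (simp_all add: mult.commute)
  then have "qRe i * qRe i = a" using e(1) by simp
  then show False using assms(2) by (metis not_square_less_zero)
qed

text \<open>The elements 1, i, j, ij are nonzero and mutually orthogonal: i and j are purely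
  imaginary, and anticommutation makes the real part of ij vanish.\<close>

lemma span_totally_definite_quaternion_algebra:
  assumes "totally_definite_quaternion_algebra A" shows "span A = UNIV"
proof -
  obtain a b :: rat and i j where ab: "a < 0" "b < 0" "i * i = of_real (of_rat a)" "j * j = of_real (of_rat b)" "i * j = - (j * i)"
    and A: "A = {of_real (of_rat p) + of_rat q *\<^sub>R i + of_rat s *\<^sub>R j + of_rat t *\<^sub>R (i * j) | p q s t. True}"
    using assms unfolding totally_definite_quaternion_algebra_def by blast
  have i0: "qRe i = 0" and j0: "qRe j = 0"
    using qRe_of_neg_square[OF ab(3)] qRe_of_neg_square[OF ab(4)] ab(1,2) by simp_all
  have "qRe (i * j) = qRe (- (j * i))" using ab(5) by (rule arg_cong)
  then have ij: "qI i * qI j + qJ i * qJ j + qK i * qK j = 0" using i0 j0 by (simp add: times_quat_def mult.commute)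
  have nz: "i \<noteq> 0" "j \<noteq> 0" using ab by auto
  let ?B = "[1, i, j, i * j]"
  have orth: "1 \<bullet> i = 0" "1 \<bullet> j = 0" "1 \<bullet> (i * j) = 0" "i \<bullet> j = 0" "i \<bullet> (i * j) = 0" "j \<bullet> (i * j) = 0"
    using i0 j0 ij by (simp_all add: inner_quat_def one_quat_def times_quat_def algebra_simps)
  have "free_list ?B"
    unfolding free_list_def
  proof (intro allI impI)
    fix c k assume z: "lcomb ?B c = 0" and k: "k < length ?B"
    have l: "lcomb ?B c = c 0 *\<^sub>R 1 + c 1 *\<^sub>R i + c 2 *\<^sub>R j + c 3 *\<^sub>R (i * j)"
      by (simp add: lcomb_def eval_nat_numeral)
    have "lcomb ?B c \<bullet> 1 = 0" "lcomb ?B c \<bullet> i = 0" "lcomb ?B c \<bullet> j = 0" "lcomb ?B c \<bullet> (i * j) = 0" using z by simp_all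
    then have "c 0 = 0" "c 1 = 0" "c 2 = 0" "c 3 = 0"
      unfolding l using orth nz by (simp_all add: inner_add_left inner_add_right inner_commute)
    then show "c k = 0" using k by (auto simp: less_Suc_eq eval_nat_numeral)
  qed
  then have B: "independent (set ?B)" "distinct ?B" unfolding free_list_iff by blast+
  have "card (set ?B) = 4" using distinct_card[OF B(2)] by simp
  then have "UNIV \<subseteq> span (set ?B)"
    using card_eq_dim[of "set ?B" UNIV] B(1) by (simp add: DIM_quat)
  moreover have "set ?B \<subseteq> A"
  proof -
    have "of_real (of_rat p) + of_rat q *\<^sub>R i + of_rat s *\<^sub>R j + of_rat t *\<^sub>R (i * j) \<in> A" for p q s t
      unfolding A by blast
    from this[of 1 0 0 0] this[of 0 1 0 0] this[of 0 0 1 0] this[of 0 0 0 1] show ?thesis by simp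
  qed
  ultimately show ?thesis using span_mono[of "set ?B" A] by blast
qed

text \<open>The dimension occurs as a natural number \<open>r\<close> and as a real number
  \<open>\<rho>\<close>, so that the literals 2 and 4 can be matched in both roles.\<close>

theorem hermite_constant_theorem:
  fixes sc :: "'k::conj_div_algebra \<Rightarrow> 'v::euclidean_space \<Rightarrow> 'v" and sc' :: "'k \<Rightarrow> 'w::euclidean_space \<Rightarrow> 'w"
  assumes "is_maximal_order A R" "span A = UNIV" and r: "r = DIM('k)" "r dvd 4" "\<rho> = real r"
    and "hermitian_space sc h" "DIM('v) = r * m" "hermitian_space sc' h'" "DIM('w) = r * (m - 1)" and "m \<ge> 3"
  shows "hermite_constant R sc
        \<le> hermite_constant R sc' powr ((real m - 1) / (real m - 2))
           * order_disc R powr (1 / (\<rho> * (real m - 2))) \<and>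
      (hermite_constant R sc
        = hermite_constant R sc' powr ((real m - 1) / (real m - 2))
           * order_disc R powr (1 / (\<rho> * (real m - 2)))
       \<longleftrightarrow>
       (\<forall>\<Lambda>. optimal R sc \<Lambda> \<longrightarrow>
          optimal R sc (O_dual R h \<Lambda>) \<and>
          (\<forall>x\<in>minimal_vectors (O_dual R h \<Lambda>).
             min_norm (\<Lambda> \<inter> (K_line sc x)\<^sup>\<bottom>) = min_norm \<Lambda> \<and>
             O_dual R h \<Lambda> \<inter> K_line sc x = {sc a x | a. a \<in> R} \<and>
             hermite_invariant (\<Lambda> \<inter> (K_line sc x)\<^sup>\<bottom>)
               = hermite_constant R sc')))"
proof -
  interpret O_hermitian A R sc h
    unfolding O_hermitian_def maximal_order_def using assms by auto
  have dim: "DIM('v) = DIM('k) * m" "DIM('w) = DIM('k) * (m - 1)" using assms by simp_all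
  show ?thesis
    unfolding r(3) r(1)
    using hermite_constant_bound[OF assms(8) dim assms(10)] by blast
qed

theorem theorem3p1:
  fixes m :: nat
    and A\<^sub>C \<O>\<^sub>C :: "complex set"
    and sc\<^sub>C :: "complex \<Rightarrow> 'v::euclidean_space \<Rightarrow> 'v" and h\<^sub>C :: "'v \<Rightarrow> 'v \<Rightarrow> complex"
    and sc\<^sub>C' :: "complex \<Rightarrow> 'w::euclidean_space \<Rightarrow> 'w" and h\<^sub>C' :: "'w \<Rightarrow> 'w \<Rightarrow> complex"
    and A\<^sub>H \<O>\<^sub>H :: "quat set"
    and sc\<^sub>H :: "quat \<Rightarrow> 'x::euclidean_space \<Rightarrow> 'x" and h\<^sub>H :: "'x \<Rightarrow> 'x \<Rightarrow> quat"
    and sc\<^sub>H' :: "quat \<Rightarrow> 'y::euclidean_space \<Rightarrow> 'y" and h\<^sub>H' :: "'y \<Rightarrow> 'y \<Rightarrow> quat"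
  assumes "m \<ge> 3"
  shows
    "(imaginary_quadratic_field A\<^sub>C \<and> is_maximal_order A\<^sub>C \<O>\<^sub>C \<and>
      hermitian_space sc\<^sub>C h\<^sub>C \<and> DIM('v) = 2 * m \<and>
      hermitian_space sc\<^sub>C' h\<^sub>C' \<and> DIM('w) = 2 * (m - 1)
      \<longrightarrow>
      hermite_constant \<O>\<^sub>C sc\<^sub>C
        \<le> hermite_constant \<O>\<^sub>C sc\<^sub>C' powr ((real m - 1) / (real m - 2))
           * order_disc \<O>\<^sub>C powr (1 / (2 * (real m - 2))) \<and>
      (hermite_constant \<O>\<^sub>C sc\<^sub>C
        = hermite_constant \<O>\<^sub>C sc\<^sub>C' powr ((real m - 1) / (real m - 2))
           * order_disc \<O>\<^sub>C powr (1 / (2 * (real m - 2)))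
       \<longleftrightarrow>
       (\<forall>\<Lambda>. optimal \<O>\<^sub>C sc\<^sub>C \<Lambda> \<longrightarrow>
          optimal \<O>\<^sub>C sc\<^sub>C (O_dual \<O>\<^sub>C h\<^sub>C \<Lambda>) \<and>
          (\<forall>x\<in>minimal_vectors (O_dual \<O>\<^sub>C h\<^sub>C \<Lambda>).
             min_norm (\<Lambda> \<inter> (K_line sc\<^sub>C x)\<^sup>\<bottom>) = min_norm \<Lambda> \<and>
             O_dual \<O>\<^sub>C h\<^sub>C \<Lambda> \<inter> K_line sc\<^sub>C x = {sc\<^sub>C a x | a. a \<in> \<O>\<^sub>C} \<and>
             hermite_invariant (\<Lambda> \<inter> (K_line sc\<^sub>C x)\<^sup>\<bottom>)
               = hermite_constant \<O>\<^sub>C sc\<^sub>C'))))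
     \<and>
     (totally_definite_quaternion_algebra A\<^sub>H \<and> is_maximal_order A\<^sub>H \<O>\<^sub>H \<and>
      hermitian_space sc\<^sub>H h\<^sub>H \<and> DIM('x) = 4 * m \<and>
      hermitian_space sc\<^sub>H' h\<^sub>H' \<and> DIM('y) = 4 * (m - 1)
      \<longrightarrow>
      hermite_constant \<O>\<^sub>H sc\<^sub>H
        \<le> hermite_constant \<O>\<^sub>H sc\<^sub>H' powr ((real m - 1) / (real m - 2))
           * order_disc \<O>\<^sub>H powr (1 / (4 * (real m - 2))) \<and>
      (hermite_constant \<O>\<^sub>H sc\<^sub>H
        = hermite_constant \<O>\<^sub>H sc\<^sub>H' powr ((real m - 1) / (real m - 2))
           * order_disc \<O>\<^sub>H powr (1 / (4 * (real m - 2)))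
       \<longleftrightarrow>
       (\<forall>\<Lambda>. optimal \<O>\<^sub>H sc\<^sub>H \<Lambda> \<longrightarrow>
          optimal \<O>\<^sub>H sc\<^sub>H (O_dual \<O>\<^sub>H h\<^sub>H \<Lambda>) \<and>
          (\<forall>x\<in>minimal_vectors (O_dual \<O>\<^sub>H h\<^sub>H \<Lambda>).
             min_norm (\<Lambda> \<inter> (K_line sc\<^sub>H x)\<^sup>\<bottom>) = min_norm \<Lambda> \<and>
             O_dual \<O>\<^sub>H h\<^sub>H \<Lambda> \<inter> K_line sc\<^sub>H x = {sc\<^sub>H a x | a. a \<in> \<O>\<^sub>H} \<and>
             hermite_invariant (\<Lambda> \<inter> (K_line sc\<^sub>H x)\<^sup>\<bottom>)
               = hermite_constant \<O>\<^sub>H sc\<^sub>H'))))"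
proof (rule conjI, goal_cases)
  case 1
  show ?case
  proof (rule impI, elim conjE, rule hermite_constant_theorem[where A = "A\<^sub>C" and r = 2 and h' = "h\<^sub>C'"])
  qed (use assms in \<open>simp_all add: span_imaginary_quadratic_field\<close>)
next
  case 2
  show ?case
  proof (rule impI, elim conjE, rule hermite_constant_theorem[where A = "A\<^sub>H" and r = 4 and h' = "h\<^sub>H'"])
  qed (use assms in \<open>simp_all add: span_totally_definite_quaternion_algebra DIM_quat\<close>)
qed

end
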